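(* Let $K$ be a compact Abelian group such that $C:=c(K)$ is locally essential in $K$. The following are equivalent: (a) $K\in\mathcal C_{Clm}$; (b) $\pi^*(K/C)$ is infinite; (c) $K/C$ is infinite.
   Context: Groups are Abelian and Hausdorff; $c(H)$ is the connected component of $0$ and $\widetilde H$ the completion. A subgroup $S$ of $K$ is locally essential if there is a neighbourhood $V$ of $0$ such that $S$ meets non-trivially every non-trivial closed subgroup of $K$ contained in $V$. A topological group is $p$-monothetic if it is a cyclic $p$-group or topologically isomorphic to a subgroup of $\mathbb Z_p$; $td_p(A)$ is the union of all $p$-monothetic subgroups of $A$; $\pi^*(A)=\{p \text{ prime}: td_p(A)\ne\{0\}\}$. A group $G$ is locally minimal if there is a neighbourhood $V$ of $0$ such that every continuous isomorphism $f:G\to H$ onto a Hausdorff group with $f(V)$ a neighbourhood of $0$ is open; a locally minimal $G$ is critical if $c(G)=c(\widetilde G)$ is compact and $G/c(G)$ is not locally minimal. $\mathcal C_{Clm}$ is the class of compact Abelian groups having a dense critical locally minimal subgroup. *)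

theory Defs
  imports "HOL-Analysis.Analysis" "HOL-Algebra.Algebra"
begin

definition top_group :: "'a monoid \<Rightarrow> 'a topology \<Rightarrow> bool" where
  "top_group G T \<longleftrightarrow> comm_group G \<and> topspace T = carrier G \<and> Hausdorff_space T \<and>
     continuous_map (prod_topology T T) T (\<lambda>(x, y). x \<otimes>\<^bsub>G\<^esub> y) \<and>
     continuous_map T T (\<lambda>x. inv\<^bsub>G\<^esub> x)"

definition nbhd :: "'a topology \<Rightarrow> 'a \<Rightarrow> 'a set \<Rightarrow> bool" where
  "nbhd T x V \<longleftrightarrow> V \<subseteq> topspace T \<and> (\<exists>U. openin T U \<and> x \<in> U \<and> U \<subseteq> V)"

definition conn_comp :: "'a monoid \<Rightarrow> 'a topology \<Rightarrow> 'a set" where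
  "conn_comp G T = connected_component_of_set T \<one>\<^bsub>G\<^esub>"

definition quot_top :: "'a monoid \<Rightarrow> 'a topology \<Rightarrow> 'a set \<Rightarrow> 'a set topology" where
  "quot_top G T H = topology (\<lambda>U. U \<subseteq> rcosets\<^bsub>G\<^esub> H \<and> openin T (\<Union>U))"

definition subgrp :: "'a monoid \<Rightarrow> 'a set \<Rightarrow> 'a monoid" where
  "subgrp G S = G\<lparr>carrier := S\<rparr>"

definition locally_essential :: "'a monoid \<Rightarrow> 'a topology \<Rightarrow> 'a set \<Rightarrow> bool" where
  "locally_essential K T S \<longleftrightarrow> subgroup S K \<and>
     (\<exists>V. nbhd T \<one>\<^bsub>K\<^esub> V \<and>
        (\<forall>N. subgroup N K \<and> closedin T N \<and> N \<subseteq> V \<and> N \<noteq> {\<one>\<^bsub>K\<^esub>}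
              \<longrightarrow> S \<inter> N \<noteq> {\<one>\<^bsub>K\<^esub>}))"

text \<open>Local minimality. The target groups H range over groups on the same element type;
  since f is a bijection onto H, this loses no generality (any H can be transported).\<close>
definition locally_minimal :: "'a monoid \<Rightarrow> 'a topology \<Rightarrow> bool" where
  "locally_minimal G T \<longleftrightarrow>
     (\<exists>V. nbhd T \<one>\<^bsub>G\<^esub> V \<and>
       (\<forall>(H :: 'a monoid) TH f. top_group H TH \<and> f \<in> iso G H \<and> continuous_map T TH f \<and>
            nbhd TH \<one>\<^bsub>H\<^esub> (f ` V) \<longrightarrow> open_map T TH f))"

text \<open>The p-adic integers as the inverse limit of the Z/p^n Z, with the topology
  inherited from the product of discrete spaces.\<close>
definition Zp_carrier :: "nat \<Rightarrow> (nat \<Rightarrow> int) set" where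
  "Zp_carrier p = {x. \<forall>n. 0 \<le> x n \<and> x n < int p ^ n \<and> x n = x (Suc n) mod (int p ^ n)}"

definition Zp :: "nat \<Rightarrow> (nat \<Rightarrow> int) monoid" where
  "Zp p = \<lparr>carrier = Zp_carrier p,
           mult = (\<lambda>x y n. (x n + y n) mod (int p ^ n)),
           one = (\<lambda>n. 0)\<rparr>"

definition Zp_top :: "nat \<Rightarrow> (nat \<Rightarrow> int) topology" where
  "Zp_top p = subtopology (product_topology (\<lambda>_. discrete_topology UNIV) UNIV) (Zp_carrier p)"

definition p_monothetic_sub :: "nat \<Rightarrow> 'a monoid \<Rightarrow> 'a topology \<Rightarrow> 'a set \<Rightarrow> bool" where
  "p_monothetic_sub p A TA S \<longleftrightarrow> subgroup S A \<and>
     (((\<exists>x\<in>S. S = generate A {x}) \<and> finite S \<and> (\<exists>k. card S = p ^ k)) \<or>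
      (\<exists>Z f. subgroup Z (Zp p) \<and> f \<in> iso (subgrp A S) (subgrp (Zp p) Z) \<and>
             homeomorphic_map (subtopology TA S) (subtopology (Zp_top p) Z) f))"

definition td :: "nat \<Rightarrow> 'a monoid \<Rightarrow> 'a topology \<Rightarrow> 'a set" where
  "td p A TA = \<Union>{S. p_monothetic_sub p A TA S}"

definition pi_star :: "'a monoid \<Rightarrow> 'a topology \<Rightarrow> nat set" where
  "pi_star A TA = {p. Factorial_Ring.prime p \<and> td p A TA \<noteq> {\<one>\<^bsub>A\<^esub>}}"

text \<open>A locally minimal dense subgroup G of the compact group (K,T) is critical.
  Since K is compact (hence complete) and G is dense in K, K is the completion of G,
  so c(G~) is c(K).\<close>
definition critical_in :: "'a monoid \<Rightarrow> 'a topology \<Rightarrow> 'a set \<Rightarrow> bool" where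
  "critical_in K T G \<longleftrightarrow>
     (let TG = subtopology T G; cG = conn_comp (subgrp K G) TG in
      locally_minimal (subgrp K G) TG \<and>
      cG = conn_comp K T \<and> compactin TG cG \<and>
      \<not> locally_minimal (subgrp K G Mod cG) (quot_top (subgrp K G) TG cG))"

definition in_C_Clm :: "'a monoid \<Rightarrow> 'a topology \<Rightarrow> bool" where
  "in_C_Clm K T \<longleftrightarrow> top_group K T \<and> compact_space T \<and>
     (\<exists>G. subgroup G K \<and> T closure_of G = carrier K \<and> critical_in K T G)"

end

(* Everything rests on one alternative for K/C with C = c(K) locally essential. If x is an element
   of K whose p-power multiples tend to C without ever reaching it, then x + C contains a topological
   generator of a copy of the p-adic integers meeting C trivially (the p-adic integers are projective
   among compact Abelian groups), and small multiples of it contradict local essentiality. If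
   x is p-torsion modulo C, then, C being divisible, x can be corrected to a genuine p-torsion
   element, and local essentiality leaves only finitely many classes. Hence K/C has finite p-torsion
   for every p, all its topologically p-torsion elements are torsion, and K/C is infinite exactly
   when infinitely many primes occur.

   If K/C is infinite, the open subgroups mK + C are cofinal among the open subgroups, so a countable
   recursion produces a dense subgroup G containing C with G/C torsion-free. G is locally essential, hence locally
   minimal, while every neighbourhood in K/C contains a subgroup of prime order missing G/C, so that
   G/C is not locally minimal. If K/C is finite, a dense G containing C is all of K and G/C is discrete.

   Both the lifting of p-adic integers and the divisibility of C would usually be read off from
   Pontryagin duality. Here the only harmonic analysis is Bogolyubov's lemma on the finite groups
   (Z/n)^k: a neighbourhood of 0 pulled back to Z contains a Bohr set, and Kronecker's theorem then
   yields small monothetic subgroups; pulled back to (Z/p)^k it contains subgroups of bounded index. *)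
theory Submission
  imports Defs
begin

section \<open>Bogolyubov's lemma\<close>

text \<open>Comments write groups additively. The obstacle is that \<open>K\<close> comes with
  neither characters nor convergent subsequences. A finite cover of \<open>K\<close> by translates
  of a small neighbourhood is therefore read as a colouring and pulled back to finite groups.
  Bogolyubov's bounds depend on the number of colours but not on the size of the finite group, so
  the finite stages survive a compactness argument, in a cube of frequencies or in a space of
  subsets.

  The p-adic generator is not lifted by hand. Zorn's lemma gives a closed subgroup M minimal among
  those meeting x + C. Every element of M in x + C generates M, so a generator may be shifted by any
  element of M \<inter> C. That intersection turns out to be p-divisible, and this freedom suffices
  to move p^a M into any given neighbourhood, which in turn forces M \<inter> C = 0.

  The recursion for G succeeds because k g = s has finitely many solutions modulo C: each stage
  forbids countably many classes, and no coset of an open subgroup is exhausted by these.\<close>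

text \<open>\<open>L\<close> consists of the characters at which the indicator of \<open>A\<close>
  has a large Fourier coefficient. In the sum of |f|^4 Re E the term at \<open>y0\<close> is k^4,
  and negative terms occur outside \<open>L\<close> only, where |f|^2 \<le> t bounds them by t n k
  in total. Characters enter through orthogonality on \<open>A\<close> alone, so that the estimate
  serves (Z/p)^k as well as windows of Z.\<close>

lemma bogolyubov_spectrum:
  fixes e :: "'y \<Rightarrow> 'b \<Rightarrow> complex"
  assumes "finite Y" "finite A" "A \<noteq> {}" "y0 \<in> Y" "\<And>a. a \<in> A \<Longrightarrow> e y0 a = 1"
    and orth: "\<And>a b. a \<in> A \<Longrightarrow> b \<in> A \<Longrightarrow>
        (\<Sum>y\<in>Y. e y a * cnj (e y b)) = (if a = b then of_nat (card Y) else 0)"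
  obtains L where "L \<subseteq> Y" "card L * (card A)\<^sup>2 \<le> 2 * (card Y)\<^sup>2"
    "\<And>E. \<lbrakk>E y0 = 1; \<And>y. y \<in> Y \<Longrightarrow> norm (E y) \<le> 1; \<And>y. y \<in> L \<Longrightarrow> Re (E y) \<ge> 0\<rbrakk> \<Longrightarrow>
       \<exists>a\<in>A. \<exists>b\<in>A. \<exists>c\<in>A. \<exists>d\<in>A.
         (\<Sum>y\<in>Y. e y a * e y b * cnj (e y c) * cnj (e y d) * cnj (E y)) \<noteq> 0"
proof -
  define n where "n = real (card Y)"
  define k where "k = real (card A)"
  define f where "f y = (\<Sum>a\<in>A. e y a)" for y
  define S where "S y = (norm (f y))\<^sup>2" for y
  \<comment> \<open>By Parseval the values |f|^2 add up to n k, so this threshold keeps the loss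
    outside \<open>L\<close> below t n k = k^4 / 2, half of the term at \<open>y0\<close>.\<close>
  define t where "t = k ^ 3 / (2 * n)"
  define L where "L = {y \<in> Y. S y > t}"
  have npos: "n > 0" unfolding n_def using assms(1,4) by (auto simp: card_gt_0_iff)
  have kpos: "k > 0" unfolding k_def using assms(2,3) by (auto simp: card_gt_0_iff)
  have tpos: "t > 0" unfolding t_def using npos kpos by simp
  have Sc: "complex_of_real (S y) = f y * cnj (f y)" for y
    unfolding S_def by (metis complex_norm_square)
  have "complex_of_real (\<Sum>y\<in>Y. S y) = (\<Sum>y\<in>Y. \<Sum>a\<in>A. \<Sum>b\<in>A. e y a * cnj (e y b))"
    by (simp add: Sc f_def sum_product)
  also have "\<dots> = (\<Sum>a\<in>A. \<Sum>b\<in>A. \<Sum>y\<in>Y. e y a * cnj (e y b))"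
    by (subst sum.swap, rule sum.cong[OF refl], rule sum.swap)
  also have "\<dots> = (\<Sum>a\<in>A. \<Sum>b\<in>A. if a = b then of_nat (card Y) else 0)"
    by (intro sum.cong refl orth)
  also have "\<dots> = complex_of_real (n * k)"
    using assms(2) by (simp add: n_def k_def)
  finally have parseval: "(\<Sum>y\<in>Y. S y) = n * k"
    using of_real_eq_iff by blast
  have S0: "S y \<ge> 0" for y by (simp add: S_def)
  have Sy0: "S y0 = k\<^sup>2"
    unfolding S_def f_def k_def using assms(5) by simp
  have "real (card L) * t = (\<Sum>y\<in>L. t)" by simp
  also have "\<dots> \<le> (\<Sum>y\<in>L. S y)" by (rule sum_mono) (auto simp: L_def)
  also have "\<dots> \<le> (\<Sum>y\<in>Y. S y)" using assms(1) S0 by (intro sum_mono2) (auto simp: L_def)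
  finally have "real (card L) * k ^ 3 \<le> (2 * n\<^sup>2) * k"
    using npos unfolding parseval t_def by (simp add: field_simps power2_eq_square)
  then have "real (card L) * k\<^sup>2 \<le> 2 * n\<^sup>2"
    using kpos by (simp add: power3_eq_cube power2_eq_square)
  then have c: "card L * (card A)\<^sup>2 \<le> 2 * (card Y)\<^sup>2"
    unfolding k_def n_def by (metis of_nat_le_iff of_nat_mult of_nat_numeral of_nat_power)
  show thesis
  proof (rule that[OF _ c])
    show "L \<subseteq> Y" by (auto simp: L_def)
    fix E :: "'y \<Rightarrow> complex"
    assume E: "E y0 = 1" "\<And>y. y \<in> Y \<Longrightarrow> norm (E y) \<le> 1" "\<And>y. y \<in> L \<Longrightarrow> Re (E y) \<ge> 0"
    have lower: "- t * S y \<le> (S y)\<^sup>2 * Re (E y)" if "y \<in> Y" for y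
    proof (cases "y \<in> L")
      case True
      have "- t * S y \<le> 0" using tpos S0[of y] by simp
      also have "0 \<le> (S y)\<^sup>2 * Re (E y)" using E(3)[OF True] by simp
      finally show ?thesis .
    next
      case False
      then have "S y \<le> t" using that by (auto simp: L_def)
      then have "S y * S y \<le> t * S y" using S0[of y] by (rule mult_right_mono)
      moreover have "\<bar>Re (E y)\<bar> \<le> 1" using E(2)[OF that] abs_Re_le_cmod order_trans by blast
      then have "- ((S y)\<^sup>2) \<le> (S y)\<^sup>2 * Re (E y)"
        using mult_left_mono[of "-1" "Re (E y)" "(S y)\<^sup>2"] by (simp add: abs_le_iff)
      ultimately show ?thesis by (simp add: power2_eq_square)
    qed
    have "(\<Sum>y\<in>Y. (S y)\<^sup>2 * Re (E y)) = (S y0)\<^sup>2 + (\<Sum>y\<in>Y-{y0}. (S y)\<^sup>2 * Re (E y))"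
      using assms(1,4) E(1) by (simp add: sum.remove)
    also have "\<dots> \<ge> (S y0)\<^sup>2 + (\<Sum>y\<in>Y-{y0}. - t * S y)"
      using lower by (intro add_left_mono sum_mono) auto
    also have "(S y0)\<^sup>2 + (\<Sum>y\<in>Y-{y0}. - t * S y) = (S y0)\<^sup>2 + t * S y0 - t * (\<Sum>y\<in>Y. S y)"
      using assms(1,4) by (simp add: sum.remove sum_negf sum_distrib_left algebra_simps)
    also have "\<dots> = k^4 + t * k\<^sup>2 - t * (n * k)" by (simp add: Sy0 parseval)
    also have "t * (n * k) = k^4 / 2" using npos by (simp add: t_def power3_eq_cube power4_eq_xxxx)
    finally have "(\<Sum>y\<in>Y. (S y)\<^sup>2 * Re (E y)) \<ge> k^4 / 2 + t * k\<^sup>2" by simp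
    moreover have "k^4 / 2 + t * k\<^sup>2 > 0" using kpos tpos by (intro add_pos_pos) auto
    ultimately have pos: "(\<Sum>y\<in>Y. (S y)\<^sup>2 * Re (E y)) > 0" by linarith
    show "\<exists>a\<in>A. \<exists>b\<in>A. \<exists>c\<in>A. \<exists>d\<in>A.
         (\<Sum>y\<in>Y. e y a * e y b * cnj (e y c) * cnj (e y d) * cnj (E y)) \<noteq> 0"
    proof (rule ccontr)
      assume "\<not> ?thesis"
      then have z: "(\<Sum>y\<in>Y. e y a * e y b * cnj (e y c) * cnj (e y d) * cnj (E y)) = 0"
        if "a \<in> A" "b \<in> A" "c \<in> A" "d \<in> A" for a b c d using that by blast
      \<comment> \<open>Expanding |f|^4 gives a fourfold sum over \<open>A\<close> of the inner sums
        over \<open>Y\<close>; if all of these vanished, the positive quantity above would be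
        0.\<close>
      have "(\<Sum>y\<in>Y. complex_of_real ((S y)\<^sup>2) * cnj (E y))
          = (\<Sum>y\<in>Y. \<Sum>a\<in>A. \<Sum>b\<in>A. \<Sum>c\<in>A. \<Sum>d\<in>A. e y a * e y b * cnj (e y c) * cnj (e y d) * cnj (E y))"
      proof (rule sum.cong[OF refl])
        fix y
        have "complex_of_real ((S y)\<^sup>2) * cnj (E y) = f y * (f y * (cnj (f y) * (cnj (f y) * cnj (E y))))"
          by (simp add: Sc power2_eq_square mult_ac)
        also have "\<dots> = (\<Sum>a\<in>A. \<Sum>b\<in>A. \<Sum>c\<in>A. \<Sum>d\<in>A. e y a * (e y b * (cnj (e y c) * (cnj (e y d) * cnj (E y)))))"
          unfolding f_def cnj_sum by (simp add: sum_distrib_right flip: sum_distrib_left)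
        finally show "complex_of_real ((S y)\<^sup>2) * cnj (E y) = (\<Sum>a\<in>A. \<Sum>b\<in>A. \<Sum>c\<in>A. \<Sum>d\<in>A. e y a * e y b * cnj (e y c) * cnj (e y d) * cnj (E y))"
          by (simp add: mult.assoc)
      qed
      also have "\<dots> = (\<Sum>a\<in>A. \<Sum>y\<in>Y. \<Sum>b\<in>A. \<Sum>c\<in>A. \<Sum>d\<in>A. e y a * e y b * cnj (e y c) * cnj (e y d) * cnj (E y))"
        by (rule sum.swap)
      also have "\<dots> = (\<Sum>a\<in>A. \<Sum>b\<in>A. \<Sum>y\<in>Y. \<Sum>c\<in>A. \<Sum>d\<in>A. e y a * e y b * cnj (e y c) * cnj (e y d) * cnj (E y))"
        by (intro sum.cong refl sum.swap)
      also have "\<dots> = (\<Sum>a\<in>A. \<Sum>b\<in>A. \<Sum>c\<in>A. \<Sum>y\<in>Y. \<Sum>d\<in>A. e y a * e y b * cnj (e y c) * cnj (e y d) * cnj (E y))"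
        by (intro sum.cong refl sum.swap)
      also have "\<dots> = (\<Sum>a\<in>A. \<Sum>b\<in>A. \<Sum>c\<in>A. \<Sum>d\<in>A. \<Sum>y\<in>Y. e y a * e y b * cnj (e y c) * cnj (e y d) * cnj (E y))"
        by (intro sum.cong refl sum.swap)
      also have "\<dots> = 0" using z by simp
      finally have "Re (\<Sum>y\<in>Y. complex_of_real ((S y)\<^sup>2) * cnj (E y)) = 0" by simp
      then have "(\<Sum>y\<in>Y. (S y)\<^sup>2 * Re (E y)) = 0" by simp
      with pos show False by simp
    qed
  qed
qed

lemma sum_cis_multiples:
  fixes p :: nat and x :: int
  assumes "p > 0"
  shows "(\<Sum>j\<in>{0..<int p}. cis (2 * pi * (of_int (j * x) / of_nat p))) =
         (if int p dvd x then of_nat p else 0)"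
proof -
  define w where "w = cis (2 * pi * (of_int x / of_nat p))"
  have "(\<Sum>j\<in>{0..<int p}. cis (2 * pi * (of_int (j * x) / of_nat p))) = (\<Sum>j<p. w ^ j)"
  proof (rule sum.reindex_bij_witness[of _ int nat])
    fix j assume "j \<in> {0..<int p}"
    then show "w ^ nat j = cis (2 * pi * (of_int (j * x) / of_nat p))"
      unfolding w_def Complex.DeMoivre by (intro arg_cong[of _ _ cis]) (simp add: field_simps)
  qed auto
  moreover have wp: "w ^ p = 1"
    unfolding w_def Complex.DeMoivre using assms cis_multiple_2pi[of "of_int x"]
    by (simp add: field_simps)
  moreover have w1: "w = 1 \<longleftrightarrow> int p dvd x"
  proof
    assume "w = 1"
    then have "cos (2 * pi * (of_int x / of_nat p)) = 1"
      unfolding w_def by (metis cis.sel(1) one_complex.sel(1))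
    then obtain m :: int where "2 * pi * (real_of_int x / of_nat p) = of_int m * 2 * pi"
      by (auto simp: cos_one_2pi_int)
    then have "real_of_int x = of_int (m * int p)" using assms by (simp add: field_simps)
    then have "x = m * int p" using of_int_eq_iff by blast
    then show "int p dvd x" by simp
  next
    assume "int p dvd x"
    then obtain m where "x = int p * m" ..
    then have "w = cis (2 * pi * of_int m)" using assms by (simp add: w_def)
    then show "w = 1" by (simp add: cis_multiple_2pi)
  qed
  ultimately show ?thesis
  proof (cases "w = 1")
    case False
    have "(1 - w) * (\<Sum>j<p. w ^ j) = 0"
      using wp by (metis one_diff_power_eq diff_self)
    then show ?thesis using False w1 \<open>_ = (\<Sum>j<p. w ^ j)\<close> by auto
  qed auto
qed

lemma cis_minus_cnj: "cnj (cis a) = cis (- a)"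
  by (simp add: complex_eq_iff)

lemma pigeonhole_colour:
  assumes "finite B" "B \<noteq> {}" "finite F" "col ` B \<subseteq> F"
  obtains c where "c \<in> F" "card B \<le> card F * card {b \<in> B. col b = c}"
proof -
  have F: "F \<noteq> {}" using assms by auto
  obtain c where c: "c \<in> F" "card B \<le> card (col -` {c} \<inter> B) * card F"
    using pigeonhole_card[of col B F] assms F by auto
  have "col -` {c} \<inter> B = {b \<in> B. col b = c}" by auto
  then show thesis using that c by (simp add: mult.commute)
qed

text \<open>The densest colour class in (Z/p)^k has density at least 1 / |F|, hence at most 2 |F|^2
  large characters, whatever \<open>k\<close> is. A vector \<open>v\<close> killed by these forms
  has character value 1 on \<open>L\<close>, and orthogonality turns the nonvanishing sum into the
  congruence. Such \<open>v\<close> form a subgroup of index at most p^(2 |F|^2).\<close>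

lemma bogolyubov_torsion:
  fixes p k :: nat and col :: "(nat \<Rightarrow> int) \<Rightarrow> 'c"
  assumes p: "p > 0" and F: "finite F" "range col \<subseteq> F"
  obtains L where "finite L" "card L \<le> 2 * (card F)\<^sup>2"
    "\<And>v. (\<And>y. y \<in> L \<Longrightarrow> int p dvd (\<Sum>i<k. y i * v i)) \<Longrightarrow>
       \<exists>a b c d. col a = col b \<and> col b = col c \<and> col c = col d \<and>
         (\<forall>i<k. int p dvd a i + b i - c i - d i - v i)"
proof -
  \<comment> \<open>(Z/p)^k is its own dual: \<open>Y\<close> holds the vectors and also indexes the
    characters.\<close>
  define Y where "Y = PiE {..<k} (\<lambda>_. {0..<int p})"
  have finY: "finite Y" unfolding Y_def by (intro finite_PiE) auto
  have cardY: "card Y = p ^ k" unfolding Y_def by (simp add: card_PiE)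
  have Yne: "Y \<noteq> {}" using cardY p by (metis card.empty power_not_zero less_numeral_extra(3))
  obtain q where q: "q \<in> F" "card Y \<le> card F * card {a \<in> Y. col a = q}"
    using pigeonhole_colour[OF finY Yne F(1), of col] F(2) by blast
  define A where "A = {a \<in> Y. col a = q}"
  have A: "finite A" "A \<noteq> {}"
  proof -
    show "finite A" using finY by (simp add: A_def)
    show "A \<noteq> {}"
    proof
      assume "A = {}"
      then have "card Y = 0" using q(2) unfolding A_def[symmetric] by simp
      then show False using cardY p by simp
    qed
  qed
  define e :: "(nat \<Rightarrow> int) \<Rightarrow> (nat \<Rightarrow> int) \<Rightarrow> complex"
    where "e y a = cis (2 * pi * (of_int (\<Sum>i<k. y i * a i) / of_nat p))" for y a
  define y0 where "y0 = (\<lambda>i\<in>{..<k}. 0::int)"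
  have y0: "y0 \<in> Y" using p by (auto simp: Y_def y0_def)
  have sum0: "(\<Sum>i<k. y0 i * a i) = 0" for a by (simp add: y0_def)
  have cadd: "cis (2 * pi * (of_int r / of_nat p)) * cis (2 * pi * (of_int s / of_nat p)) =
      cis (2 * pi * (of_int (r + s) / of_nat p))" for r s :: int
    by (simp add: cis_mult ring_distribs add_divide_distrib)
  have ccnj: "cnj (cis (2 * pi * (of_int r / of_nat p))) = cis (2 * pi * (of_int (-r) / of_nat p))" for r :: int
    by (simp add: cis_minus_cnj)
  have full: "(\<Sum>y\<in>Y. e y x) = (if \<forall>i<k. int p dvd x i then of_nat (card Y) else 0)" for x
  proof -
    have "e y x = (\<Prod>i<k. cis (2 * pi * (of_int (y i * x i) / of_nat p)))" for y
    proof -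
      have "(\<Prod>i\<in>I. cis (2 * pi * (of_int (y i * x i) / of_nat p))) =
          cis (2 * pi * (of_int (\<Sum>i\<in>I. y i * x i) / of_nat p))" if "finite I" for I
        using that
      proof induction
        case (insert i I)
        show ?case
          unfolding prod.insert[OF insert.hyps] sum.insert[OF insert.hyps] insert.IH by (rule cadd)
      qed simp
      then show ?thesis by (simp add: e_def)
    qed
    then have "(\<Sum>y\<in>Y. e y x) = (\<Sum>y\<in>Y. \<Prod>i<k. cis (2 * pi * (of_int (y i * x i) / of_nat p)))"
      by simp
    also have "\<dots> = (\<Prod>i<k. \<Sum>j\<in>{0..<int p}. cis (2 * pi * (of_int (j * x i) / of_nat p)))"
      unfolding Y_def by (rule prod_sum_PiE[symmetric]) auto
    also have "\<dots> = (\<Prod>i<k. if int p dvd x i then of_nat p else 0)"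
      by (simp only: sum_cis_multiples[OF p])
    also have "\<dots> = (if \<forall>i<k. int p dvd x i then of_nat (card Y) else 0)"
      by (auto simp: cardY)
    finally show ?thesis .
  qed
  have orth: "(\<Sum>y\<in>Y. e y a * cnj (e y b)) = (if a = b then of_nat (card Y) else 0)"
    if "a \<in> A" "b \<in> A" for a b
  proof -
    have "e y a * cnj (e y b) = e y (\<lambda>i. a i - b i)" for y
      unfolding e_def ccnj cadd by (simp add: sum_subtractf algebra_simps)
    then have "(\<Sum>y\<in>Y. e y a * cnj (e y b)) = (if \<forall>i<k. int p dvd a i - b i then of_nat (card Y) else 0)"
      by (simp only: full)
    moreover have "(\<forall>i<k. int p dvd a i - b i) \<longleftrightarrow> a = b"
    proof
      assume *: "\<forall>i<k. int p dvd a i - b i"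
      have "a i = b i" if "i < k" for i
      proof -
        have "a i \<in> {0..<int p}" "b i \<in> {0..<int p}"
          using \<open>a \<in> A\<close> \<open>b \<in> A\<close> that by (auto simp: A_def Y_def PiE_def Pi_def)
        with * that show ?thesis
          by (metis atLeastLessThan_iff mod_eq_dvd_iff mod_pos_pos_trivial)
      qed
      moreover have "a \<in> PiE {..<k} (\<lambda>_. {0..<int p})" "b \<in> PiE {..<k} (\<lambda>_. {0..<int p})"
        using that by (simp_all add: A_def Y_def)
      ultimately show "a = b" by (metis PiE_ext lessThan_iff)
    qed auto
    ultimately show ?thesis by simp
  qed
  have e0: "e y0 a = 1" for a unfolding e_def sum0 by simp
  obtain L where L: "L \<subseteq> Y" "card L * (card A)\<^sup>2 \<le> 2 * (card Y)\<^sup>2"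
    and good: "\<And>E. \<lbrakk>E y0 = 1; \<And>y. y \<in> Y \<Longrightarrow> norm (E y) \<le> 1; \<And>y. y \<in> L \<Longrightarrow> Re (E y) \<ge> 0\<rbrakk> \<Longrightarrow>
       \<exists>a\<in>A. \<exists>b\<in>A. \<exists>c\<in>A. \<exists>d\<in>A.
         (\<Sum>y\<in>Y. e y a * e y b * cnj (e y c) * cnj (e y d) * cnj (E y)) \<noteq> 0"
    by (rule bogolyubov_spectrum[of Y A y0 e, OF finY A y0 e0 orth]) blast+
  show thesis
  proof (rule that)
    show "finite L" using L(1) finY finite_subset by blast
    have "card L * (card A)\<^sup>2 \<le> 2 * (card F * card A)\<^sup>2"
      using L(2) q(2) unfolding A_def[symmetric] by (meson mult_le_mono2 order_trans power_mono zero_le)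
    also have "\<dots> = (2 * (card F)\<^sup>2) * (card A)\<^sup>2" by (simp add: power_mult_distrib)
    finally show "card L \<le> 2 * (card F)\<^sup>2" using A by auto
  next
    fix v :: "nat \<Rightarrow> int"
    assume v: "\<And>y. y \<in> L \<Longrightarrow> int p dvd (\<Sum>i<k. y i * v i)"
    have "e y v = 1" if "y \<in> L" for y
    proof -
      have "int p dvd (\<Sum>i<k. y i * v i)" by (rule v[OF that])
      then obtain m where "(\<Sum>i<k. y i * v i) = int p * m" ..
      then have "e y v = cis (2 * pi * of_int m)" using p by (simp add: e_def)
      then show ?thesis by (simp add: cis_multiple_2pi)
    qed
    then obtain a b c d where abcd: "a \<in> A" "b \<in> A" "c \<in> A" "d \<in> A"
      "(\<Sum>y\<in>Y. e y a * e y b * cnj (e y c) * cnj (e y d) * cnj (e y v)) \<noteq> 0"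
      using good[of "\<lambda>y. e y v"] e0 by (auto simp: e_def)
    have "e y a * e y b * cnj (e y c) * cnj (e y d) * cnj (e y v) =
        e y (\<lambda>i. a i + b i - c i - d i - v i)" for y
      unfolding e_def ccnj cadd by (simp add: sum_subtractf sum.distrib algebra_simps)
    then have "(if \<forall>i<k. int p dvd a i + b i - c i - d i - v i then of_nat (card Y) else (0::complex)) \<noteq> 0"
      using abcd(5) unfolding full[symmetric] by simp
    then have "\<forall>i<k. int p dvd a i + b i - c i - d i - v i" by (auto split: if_splits)
    then show "\<exists>a b c d. col a = col b \<and> col b = col c \<and> col c = col d \<and>
         (\<forall>i<k. int p dvd a i + b i - c i - d i - v i)"
      using abcd(1-4) unfolding A_def by (intro exI[of _ a] exI[of _ b] exI[of _ c] exI[of _ d]) simp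
  qed
qed

text \<open>A window of length \<open>N\<close> is placed in a cyclic group long enough that sums of
  a few of its elements do not wrap around. The number of frequencies is independent of
  \<open>N\<close>, as the passage to all of Z requires.\<close>

lemma bogolyubov_int_window:
  fixes col :: "int \<Rightarrow> 'c" and N :: nat
  assumes N: "N > 0" and F: "finite F" "range col \<subseteq> F"
  obtains \<theta> :: "nat \<Rightarrow> real" where "\<And>i. \<theta> i \<in> {0..1}"
    "\<And>g. \<lbrakk>\<bar>g\<bar> < int N; \<And>i. i < 32 * (card F)\<^sup>2 \<Longrightarrow> cos (2 * pi * (of_int g * \<theta> i)) \<ge> 0\<rbrakk> \<Longrightarrow>
       \<exists>a b c d. col a = col b \<and> col b = col c \<and> col c = col d \<and> g = a + b - c - d"
proof -
  \<comment> \<open>|a + b - c - d - g| < 3 N < M, so congruence modulo \<open>M\<close> is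
    equality. The factor 4 is also the source of 32 = 2 * 4^2.\<close>
  define M where "M = 4 * N"
  have M: "M > 0" using N by (simp add: M_def)
  define Y where "Y = {0..<int M}"
  obtain q where q: "q \<in> F" "card {0..<int N} \<le> card F * card {a \<in> {0..<int N}. col a = q}"
  proof (rule pigeonhole_colour[of "{0..<int N}" F col])
    show "col ` {0..<int N} \<subseteq> F" using F(2) by auto
  qed (use F N in auto)
  define A where "A = {a \<in> {0..<int N}. col a = q}"
  have cA: "N \<le> card F * card A" using q(2) by (simp add: A_def)
  have A: "finite A" "A \<noteq> {}"
  proof -
    show "finite A" unfolding A_def by (rule finite_subset[of _ "{0..<int N}"]) auto
    show "A \<noteq> {}" using cA N by (metis card.empty mult_0_right not_le)
  qed
  define e :: "int \<Rightarrow> int \<Rightarrow> complex" where "e y a = cis (2 * pi * (of_int (y * a) / of_nat M))" for y a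
  have cadd: "cis (2 * pi * (of_int r / of_nat M)) * cis (2 * pi * (of_int s / of_nat M)) =
      cis (2 * pi * (of_int (r + s) / of_nat M))" for r s :: int
    by (simp add: cis_mult ring_distribs add_divide_distrib)
  have ccnj: "cnj (cis (2 * pi * (of_int r / of_nat M))) = cis (2 * pi * (of_int (-r) / of_nat M))" for r :: int
    by (simp add: cis_minus_cnj)
  have full: "(\<Sum>y\<in>Y. e y x) = (if int M dvd x then of_nat M else 0)" for x
    unfolding e_def Y_def by (rule sum_cis_multiples[OF M])
  have orth: "(\<Sum>y\<in>Y. e y a * cnj (e y b)) = (if a = b then of_nat (card Y) else 0)"
    if "a \<in> A" "b \<in> A" for a b
  proof -
    have "e y a * cnj (e y b) = e y (a - b)" for y
      unfolding e_def ccnj cadd by (simp add: algebra_simps)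
    then have "(\<Sum>y\<in>Y. e y a * cnj (e y b)) = (if int M dvd a - b then of_nat M else 0)"
      by (simp only: full)
    moreover have "int M dvd a - b \<longleftrightarrow> a = b"
    proof
      assume "int M dvd a - b"
      moreover have "\<bar>a - b\<bar> < int M" using that by (auto simp: A_def M_def)
      ultimately show "a = b" using dvd_imp_le_int[of "a - b" "int M"] by linarith
    qed auto
    ultimately show ?thesis by (simp add: Y_def)
  qed
  have Y: "finite Y" "0 \<in> Y" using M by (auto simp: Y_def)
  have e0: "e 0 a = 1" for a by (simp add: e_def)
  obtain L where L: "L \<subseteq> Y" "card L * (card A)\<^sup>2 \<le> 2 * (card Y)\<^sup>2"
    and good: "\<And>E. \<lbrakk>E 0 = 1; \<And>y. y \<in> Y \<Longrightarrow> norm (E y) \<le> 1; \<And>y. y \<in> L \<Longrightarrow> Re (E y) \<ge> 0\<rbrakk> \<Longrightarrow>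
       \<exists>a\<in>A. \<exists>b\<in>A. \<exists>c\<in>A. \<exists>d\<in>A.
         (\<Sum>y\<in>Y. e y a * e y b * cnj (e y c) * cnj (e y d) * cnj (E y)) \<noteq> 0"
    by (rule bogolyubov_spectrum[of Y A 0 e, OF Y(1) A Y(2) e0 orth]) blast+
  have "card L * (card A)\<^sup>2 \<le> 32 * N\<^sup>2"
  proof -
    have "card Y = 4 * N" by (simp add: Y_def M_def)
    then show ?thesis using L(2) by (simp add: power_mult_distrib)
  qed
  also have "\<dots> \<le> 32 * (card F * card A)\<^sup>2" using cA by (intro mult_le_mono2 power_mono) auto
  also have "\<dots> = (32 * (card F)\<^sup>2) * (card A)\<^sup>2" by (simp add: power_mult_distrib)
  finally have cL: "card L \<le> 32 * (card F)\<^sup>2" using A by auto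
  have "finite L" using L(1) Y(1) finite_subset by blast
  then obtain h where h: "bij_betw h {0..<card L} L" using ex_bij_betw_nat_finite by blast
  \<comment> \<open>Padding with the frequency 0 adds conditions that always hold and makes the
    number of frequencies the same for every window.\<close>
  define \<theta> where "\<theta> i = (if i < card L then of_int (h i) / of_nat M else 0 :: real)" for i
  show thesis
  proof (rule that[of \<theta>])
    fix i show "\<theta> i \<in> {0..1}"
    proof (cases "i < card L")
      case True
      then have "h i \<in> Y" using h L(1) by (auto simp: bij_betw_def)
      then have "0 \<le> h i" "h i \<le> int M" by (auto simp: Y_def)
      then have "0 \<le> real_of_int (h i)" "real_of_int (h i) \<le> real M" by linarith+
      then show ?thesis using M True by (simp add: \<theta>_def)
    qed (simp add: \<theta>_def)
  next
    fix g :: int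
    assume g: "\<bar>g\<bar> < int N" "\<And>i. i < 32 * (card F)\<^sup>2 \<Longrightarrow> cos (2 * pi * (of_int g * \<theta> i)) \<ge> 0"
    have "Re (e y g) \<ge> 0" if "y \<in> L" for y
    proof -
      have "y \<in> h ` {0..<card L}" using h that by (simp add: bij_betw_def)
      then obtain i where i: "i < card L" "h i = y" by auto
      then have "cos (2 * pi * (of_int g * \<theta> i)) \<ge> 0" using g(2) cL by auto
      then show ?thesis using i by (simp add: e_def \<theta>_def mult.commute)
    qed
    then obtain a b c d where abcd: "a \<in> A" "b \<in> A" "c \<in> A" "d \<in> A"
      "(\<Sum>y\<in>Y. e y a * e y b * cnj (e y c) * cnj (e y d) * cnj (e y g)) \<noteq> 0"
      using good[of "\<lambda>y. e y g"] e0 by (auto simp: e_def)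
    have "e y a * e y b * cnj (e y c) * cnj (e y d) * cnj (e y g) = e y (a + b - c - d - g)" for y
      unfolding e_def ccnj cadd by (simp add: algebra_simps)
    then have "(if int M dvd a + b - c - d - g then of_nat M else (0::complex)) \<noteq> 0"
      using abcd(5) unfolding full[symmetric] by simp
    then have "int M dvd a + b - c - d - g" by (auto split: if_splits)
    moreover have "\<bar>a + b - c - d - g\<bar> < int M" using abcd(1-4) g(1) by (auto simp: A_def M_def)
    ultimately have "g = a + b - c - d"
      using dvd_imp_le_int[of "a + b - c - d - g" "int M"] by linarith
    then show "\<exists>a b c d. col a = col b \<and> col b = col c \<and> col c = col d \<and> g = a + b - c - d"
      using abcd(1-4) unfolding A_def by (intro exI[of _ a] exI[of _ b] exI[of _ c] exI[of _ d]) simp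
  qed
qed

text \<open>A sequence in a compact space need not have a convergent subsequence, but a cluster
  point inherits every closed condition that holds eventually. Later limits of sequences are taken
  in this form.\<close>

lemma compact_space_cluster_point:
  fixes s :: "nat \<Rightarrow> 'a"
  assumes "compact_space T" "range s \<subseteq> topspace T"
  obtains z where "z \<in> topspace T" "\<And>F. \<lbrakk>closedin T F; eventually (\<lambda>j. s j \<in> F) sequentially\<rbrakk> \<Longrightarrow> z \<in> F"
proof -
  define C where "C n = T closure_of (s ` {n..})" for n
  have "(\<Inter>n. C n) \<noteq> {}"
  proof (rule compact_space_imp_nest[OF assms(1)])
    fix n
    have "s n \<in> C n" using assms(2) closure_of_subset[of "s ` {n..}" T] by (auto simp: C_def)
    then show "C n \<noteq> {}" by auto
    show "decseq C" unfolding C_def by (intro decseq_SucI closure_of_mono) auto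
  qed (simp add: C_def)
  then obtain z where z: "\<And>n. z \<in> C n" by auto
  show thesis
  proof (rule that)
    show "z \<in> topspace T" using z[of 0] closure_of_subset_topspace[of T] unfolding C_def by blast
    fix F assume "closedin T F" "eventually (\<lambda>j. s j \<in> F) sequentially"
    then obtain n where "s ` {n..} \<subseteq> F" by (auto simp: eventually_sequentially)
    then have "C n \<subseteq> F" unfolding C_def using \<open>closedin T F\<close> by (simp add: closure_of_minimal)
    then show "z \<in> F" using z by blast
  qed
qed

text \<open>The frequency vectors of all windows lie in a compact cube. That some frequency rejects
  a given bad \<open>g\<close> becomes a closed condition when written as cos \<le> 0, and so passes
  to a cluster point. This is why the cosines in the conclusion are required to be strictly
  positive.\<close>

lemma bogolyubov_int:
  fixes col :: "int \<Rightarrow> 'c"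
  assumes F: "finite F" "range col \<subseteq> F"
  obtains m and \<theta> :: "nat \<Rightarrow> real" where
    "\<And>g. (\<And>i. i < m \<Longrightarrow> cos (2 * pi * (of_int g * \<theta> i)) > 0) \<Longrightarrow>
       \<exists>a b c d. col a = col b \<and> col b = col c \<and> col c = col d \<and> g = a + b - c - d"
proof -
  define m where "m = 32 * (card F)\<^sup>2"
  define good where "good g \<longleftrightarrow> (\<exists>a b c d. col a = col b \<and> col b = col c \<and> col c = col d \<and> g = a + b - c - d)" for g
  have "\<exists>\<theta>::nat \<Rightarrow> real. (\<forall>i. \<theta> i \<in> {0..1}) \<and> (\<forall>g. \<bar>g\<bar> < int (Suc N) \<longrightarrow> \<not> good g \<longrightarrow>
      (\<exists>i<m. cos (2 * pi * (of_int g * \<theta> i)) \<le> 0))" for N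
  proof -
    obtain \<theta> :: "nat \<Rightarrow> real" where "\<And>i. \<theta> i \<in> {0..1}"
      "\<And>g. \<lbrakk>\<bar>g\<bar> < int (Suc N); \<And>i. i < m \<Longrightarrow> cos (2 * pi * (of_int g * \<theta> i)) \<ge> 0\<rbrakk> \<Longrightarrow> good g"
      unfolding m_def good_def by (rule bogolyubov_int_window[OF _ F, of "Suc N"]) blast+
    then show ?thesis by (intro exI[of _ \<theta>]) (meson less_imp_le linorder_le_cases)
  qed
  then obtain s :: "nat \<Rightarrow> nat \<Rightarrow> real" where s: "\<And>N i. s N i \<in> {0..1}"
    "\<And>N g. \<bar>g\<bar> < int (Suc N) \<Longrightarrow> \<not> good g \<Longrightarrow> \<exists>i<m. cos (2 * pi * (of_int g * s N i)) \<le> 0"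
    by metis
  define T where "T = product_topology (\<lambda>_::nat. top_of_set {0..1::real}) UNIV"
  have T: "compact_space T" unfolding T_def
    by (rule compact_space_product_topology[THEN iffD2]) (simp add: compact_space_subtopology)
  have topT: "topspace T = {x. \<forall>i. x i \<in> {0..1}}" by (auto simp: T_def PiE_def Pi_def)
  obtain z where z: "z \<in> topspace T"
    "\<And>C. \<lbrakk>closedin T C; eventually (\<lambda>j. s j \<in> C) sequentially\<rbrakk> \<Longrightarrow> z \<in> C"
    by (rule compact_space_cluster_point[OF T, of s]) (use s(1) topT in auto)
  show thesis
  proof (rule that[of m z])
    fix g :: int
    assume g: "\<And>i. i < m \<Longrightarrow> cos (2 * pi * (of_int g * z i)) > 0"
    have "good g"
    proof (rule ccontr)
      assume ng: "\<not> good g"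
      define C where "C = (\<Union>i<m. {x \<in> topspace T. cos (2 * pi * (of_int g * x i)) \<in> {..0}})"
      have "closedin T {x \<in> topspace T. cos (2 * pi * (of_int g * x i)) \<in> {..0}}" for i
      proof (rule closedin_continuous_map_preimage)
        have "continuous_map T (top_of_set {0..1::real}) (\<lambda>x. x i)"
          unfolding T_def by (rule continuous_map_product_projection) simp
        then have pr: "continuous_map T euclideanreal (\<lambda>x. x i)" by (simp add: continuous_map_in_subtopology)
        have "continuous_map T euclideanreal ((\<lambda>t. cos (2 * pi * (of_int g * t))) \<circ> (\<lambda>x. x i))"
          by (rule continuous_map_compose[OF pr]) (simp add: continuous_intros)
        then show "continuous_map T euclideanreal (\<lambda>x. cos (2 * pi * (of_int g * x i)))"
          by (simp add: o_def)
      qed simp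
      then have "closedin T C" unfolding C_def by (intro closedin_Union) auto
      moreover have "eventually (\<lambda>j. s j \<in> C) sequentially"
        unfolding eventually_sequentially
      proof (intro exI[of _ "nat \<bar>g\<bar>"] allI impI)
        fix j assume "nat \<bar>g\<bar> \<le> j"
        then have "\<bar>g\<bar> < int (Suc j)" by linarith
        then obtain i where "i < m" "cos (2 * pi * (of_int g * s j i)) \<le> 0" using s(2)[OF _ ng] by blast
        moreover have "s j \<in> topspace T" using s(1) by (simp add: topT)
        ultimately show "s j \<in> C" by (auto simp: C_def)
      qed
      ultimately have "z \<in> C" using z(2) by blast
      then obtain i where "i < m" "cos (2 * pi * (of_int g * z i)) \<le> 0" by (auto simp: C_def)
      then show False using g by force
    qed
    then show "\<exists>a b c d. col a = col b \<and> col b = col c \<and> col c = col d \<and> g = a + b - c - d"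
      by (simp add: good_def)
  qed
qed

section \<open>Subgroups of Abelian groups\<close>

context comm_group
begin

lemma quotient_cancel:
  assumes "x \<in> carrier G" "y \<in> carrier G" "z \<in> carrier G"
  shows "(x \<otimes> z) \<otimes> inv (y \<otimes> z) = x \<otimes> inv y"
proof -
  have "z \<otimes> (inv z \<otimes> inv y) = inv y" using assms by (simp add: m_assoc[symmetric])
  then show ?thesis using assms by (simp add: inv_mult_group m_assoc)
qed

lemma quotient_trans:
  assumes "subgroup H G" "x \<in> carrier G" "y \<in> carrier G" "z \<in> carrier G" "x \<otimes> inv y \<in> H" "y \<otimes> inv z \<in> H"
  shows "x \<otimes> inv z \<in> H"
proof -
  have "(x \<otimes> inv y) \<otimes> (y \<otimes> inv z) \<in> H" by (rule subgroup.m_closed[OF assms(1,5,6)])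
  moreover have "inv y \<otimes> (y \<otimes> inv z) = inv z" using assms(2-4) by (simp add: m_assoc[symmetric])
  then have "(x \<otimes> inv y) \<otimes> (y \<otimes> inv z) = x \<otimes> inv z" using assms(2-4) by (simp add: m_assoc)
  ultimately show ?thesis by simp
qed

lemma quotient_sym:
  assumes "subgroup H G" "x \<in> carrier G" "y \<in> carrier G" "x \<otimes> inv y \<in> H"
  shows "y \<otimes> inv x \<in> H"
proof -
  have "inv (x \<otimes> inv y) \<in> H" by (rule subgroup.m_inv_closed[OF assms(1,4)])
  then show ?thesis using assms(2,3) by (simp add: inv_mult_group)
qed

lemma int_pow_combination:
  assumes "y \<in> carrier G"
  shows "y [^] (a + b - c - d :: int) = y [^] a \<otimes> y [^] b \<otimes> inv (y [^] c) \<otimes> inv (y [^] d)"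
  using assms by (simp add: int_pow_diff int_pow_mult)

lemma subgroup_int_pow: "subgroup H G \<Longrightarrow> x \<in> H \<Longrightarrow> x [^] (n::int) \<in> H"
  using subgroup_int_pow_closed by blast

lemma subgroup_nat_pow: "subgroup H G \<Longrightarrow> x \<in> H \<Longrightarrow> x [^] (n::nat) \<in> H"
  using subgroup_int_pow[of H x "int n"] by (simp add: int_pow_int)

lemma subgroup_pow_preimage:
  assumes "subgroup H G"
  shows "subgroup {x \<in> carrier G. x [^] (n::nat) \<in> H} G"
  by (rule subgroupI)
     (use assms in \<open>auto simp: nat_pow_inv[symmetric] nat_pow_distrib subgroup_def exI[of _ \<one>]\<close>)

lemma finprod_in_subgroup:
  assumes "subgroup H G" "finite I" "\<And>i. i \<in> I \<Longrightarrow> f i \<in> H"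
  shows "finprod G f I \<in> H"
  using assms(2,3)
proof (induction I rule: finite_induct)
  case empty
  then show ?case using subgroup.one_closed[OF assms(1)] by simp
next
  case (insert i I)
  then have "f \<in> I \<rightarrow> carrier G" "f i \<in> carrier G" using subgroup.mem_carrier[OF assms(1)] by auto
  then have "finprod G f (insert i I) = f i \<otimes> finprod G f I" using insert by simp
  then show ?case using insert subgroup.m_closed[OF assms(1)] by auto
qed

lemma set_mult_memI: "a \<in> A \<Longrightarrow> b \<in> B \<Longrightarrow> a \<otimes> b \<in> A <#> B"
  by (auto simp: set_mult_def)

lemma subset_set_mult:
  assumes "subgroup A G" "subgroup B G"
  shows "A \<subseteq> A <#> B" "B \<subseteq> A <#> B"
proof -
  show "A \<subseteq> A <#> B"
  proof
    fix a assume "a \<in> A"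
    then show "a \<in> A <#> B"
      using set_mult_memI[of a A \<one> B] subgroup.one_closed[OF assms(2)] subgroup.mem_carrier[OF assms(1)] by simp
  qed
  show "B \<subseteq> A <#> B"
  proof
    fix b assume "b \<in> B"
    then show "b \<in> A <#> B"
      using set_mult_memI[of \<one> A b B] subgroup.one_closed[OF assms(1)] subgroup.mem_carrier[OF assms(2)] by simp
  qed
qed

lemma set_mult_subset_subgroup:
  assumes "subgroup H G" "A \<subseteq> H" "B \<subseteq> H"
  shows "A <#> B \<subseteq> H"
  using assms subgroup.m_closed[OF assms(1)] by (auto simp: set_mult_def)

definition powers :: "nat \<Rightarrow> 'a set \<Rightarrow> 'a set" where
  "powers n H = (\<lambda>x. x [^] n) ` H"

lemma powersI: "m \<in> M \<Longrightarrow> m [^] (n::nat) \<in> powers n M"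
  by (auto simp: powers_def)

lemma subgroup_powers:
  assumes "subgroup H G"
  shows "subgroup (powers n H) G" "powers n H \<subseteq> H"
proof -
  have H: "H \<subseteq> carrier G" using assms by (rule subgroup.subset)
  show s: "powers n H \<subseteq> H" using subgroup_nat_pow[OF assms] by (auto simp: powers_def)
  show "subgroup (powers n H) G"
  proof (rule subgroupI)
    show "powers n H \<subseteq> carrier G" using s H by blast
    show "powers n H \<noteq> {}" using subgroup.one_closed[OF assms] by (auto simp: powers_def)
  next
    fix a assume "a \<in> powers n H"
    then obtain h where h: "h \<in> H" "a = h [^] n" by (auto simp: powers_def)
    then have "inv a = (inv h) [^] n" using H by (simp add: nat_pow_inv subset_iff)
    then show "inv a \<in> powers n H" using h subgroup.m_inv_closed[OF assms] by (auto simp: powers_def)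
  next
    fix a b assume "a \<in> powers n H" "b \<in> powers n H"
    then obtain h k where h: "h \<in> H" "a = h [^] n" "k \<in> H" "b = k [^] n" by (auto simp: powers_def)
    then have "a \<otimes> b = (h \<otimes> k) [^] n" using H by (simp add: nat_pow_distrib subset_iff)
    then show "a \<otimes> b \<in> powers n H" using h subgroup.m_closed[OF assms] by (auto simp: powers_def)
  qed
qed

lemma powers_power_subset:
  assumes "subgroup M G"
  shows "powers (a * b) M \<subseteq> powers a M"
proof
  fix z assume "z \<in> powers (a * b) M"
  then obtain m where m: "m \<in> M" "z = m [^] (a * b)" by (auto simp: powers_def)
  then have "z = (m [^] b) [^] a"
    using subgroup.mem_carrier[OF assms] by (simp add: nat_pow_pow mult.commute)
  then show "z \<in> powers a M" using m subgroup_nat_pow[OF assms] by (auto simp: powers_def)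
qed

end

section \<open>Compact Abelian groups\<close>

locale abelian_topological_group = comm_group K for K :: "'a monoid" (structure) +
  fixes T :: "'a topology"
  assumes topspace_eq: "topspace T = carrier K"
    and hausdorff: "Hausdorff_space T"
    and continuous_mult: "continuous_map (prod_topology T T) T (\<lambda>(x, y). x \<otimes> y)"
    and continuous_inv: "continuous_map T T (\<lambda>x. inv x)"
begin

lemma closedin_carrier: "closedin T (carrier K)"
  using topspace_eq closedin_topspace by metis

lemma openin_carrier: "openin T (carrier K)"
  using topspace_eq openin_topspace by metis

lemma closedin_subset_carrier: "closedin T A \<Longrightarrow> A \<subseteq> carrier K"
  using closedin_subset topspace_eq by blast

lemma openin_subset_carrier: "openin T A \<Longrightarrow> A \<subseteq> carrier K"
  using openin_subset topspace_eq by blast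

lemma continuous_map_mult:
  assumes "continuous_map S T f" "continuous_map S T g"
  shows "continuous_map S T (\<lambda>x. f x \<otimes> g x)"
proof -
  have "continuous_map S T ((\<lambda>(x, y). x \<otimes> y) \<circ> (\<lambda>x. (f x, g x)))"
    by (rule continuous_map_compose[OF _ continuous_mult]) (simp add: continuous_map_pairwise o_def assms)
  then show ?thesis by (simp add: o_def)
qed

lemma continuous_map_inv:
  assumes "continuous_map S T f"
  shows "continuous_map S T (\<lambda>x. inv (f x))"
  using continuous_map_compose[OF assms continuous_inv] by (simp add: o_def)

lemma continuous_map_const_carrier: "c \<in> carrier K \<Longrightarrow> continuous_map S T (\<lambda>_. c)"
  by (simp add: topspace_eq)

lemma continuous_map_self: "continuous_map T T (\<lambda>x. x)"
  using continuous_map_id by (simp add: id_def)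

lemma continuous_map_nat_pow: "continuous_map T T (\<lambda>x. x [^] (n::nat))"
proof (induction n)
  case 0
  then show ?case by (simp add: topspace_eq)
next
  case (Suc n)
  then show ?case using continuous_map_mult[OF Suc continuous_map_self] by simp
qed

lemma continuous_map_int_pow: "continuous_map T T (\<lambda>x. x [^] (n::int))"
proof (cases "n < 0")
  case True
  then show ?thesis
    unfolding int_pow_def2 using continuous_map_inv[OF continuous_map_nat_pow[of "nat (- n)"]] by simp
next
  case False
  then show ?thesis
    unfolding int_pow_def2 using continuous_map_nat_pow[of "nat n"] by simp
qed

lemma closedin_preimage:
  "continuous_map T T f \<Longrightarrow> closedin T A \<Longrightarrow> closedin T {x \<in> carrier K. f x \<in> A}"
  using closedin_continuous_map_preimage[of T T f A] by (simp add: topspace_eq)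

lemma openin_preimage:
  "continuous_map T T f \<Longrightarrow> openin T A \<Longrightarrow> openin T {x \<in> carrier K. f x \<in> A}"
  using openin_continuous_map_preimage[of T T f A] by (simp add: topspace_eq)

lemma openin_translate:
  assumes "openin T U" "a \<in> carrier K"
  shows "openin T {x \<in> carrier K. x \<otimes> a \<in> U}"
  by (intro openin_preimage continuous_map_mult continuous_map_self continuous_map_const_carrier assms)

lemma closedin_translate:
  assumes "closedin T U" "a \<in> carrier K"
  shows "closedin T {x \<in> carrier K. x \<otimes> a \<in> U}"
  by (intro closedin_preimage continuous_map_mult continuous_map_self continuous_map_const_carrier assms)

lemma nbhd_mult:
  assumes "openin T U" "\<one> \<in> U"
  obtains V where "openin T V" "\<one> \<in> V" "\<And>x y. x \<in> V \<Longrightarrow> y \<in> V \<Longrightarrow> x \<otimes> y \<in> U"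
proof -
  have "openin (prod_topology T T) {z \<in> topspace (prod_topology T T). (case z of (x, y) \<Rightarrow> x \<otimes> y) \<in> U}"
    by (rule openin_continuous_map_preimage[OF continuous_mult assms(1)])
  moreover have "(\<one>, \<one>) \<in> {z \<in> topspace (prod_topology T T). (case z of (x, y) \<Rightarrow> x \<otimes> y) \<in> U}"
    using assms by (simp add: topspace_eq)
  ultimately obtain A B where AB: "openin T A" "openin T B" "\<one> \<in> A" "\<one> \<in> B"
    "A \<times> B \<subseteq> {z \<in> topspace (prod_topology T T). (case z of (x, y) \<Rightarrow> x \<otimes> y) \<in> U}"
    unfolding openin_prod_topology_alt by meson
  show thesis
  proof (rule that)
    show "openin T (A \<inter> B)" using AB by blast
    show "\<one> \<in> A \<inter> B" using AB by blast
    fix x y assume "x \<in> A \<inter> B" "y \<in> A \<inter> B"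
    then have "(x, y) \<in> A \<times> B" by blast
    then show "x \<otimes> y \<in> U" using AB(5) by auto
  qed
qed

lemma nbhd_inv:
  assumes "openin T U" "\<one> \<in> U"
  obtains V where "openin T V" "\<one> \<in> V" "V \<subseteq> U" "\<And>x. x \<in> V \<Longrightarrow> inv x \<in> U"
proof (rule that[of "U \<inter> {x \<in> carrier K. inv x \<in> U}"])
  show "openin T (U \<inter> {x \<in> carrier K. inv x \<in> U})"
    using assms openin_preimage[OF continuous_inv] by blast
qed (use assms in auto)

lemma nbhd_quotient:
  assumes "openin T U" "\<one> \<in> U"
  obtains V where "openin T V" "\<one> \<in> V" "\<And>x y. x \<in> V \<Longrightarrow> y \<in> V \<Longrightarrow> x \<otimes> inv y \<in> U"
proof -
  obtain V where V: "openin T V" "\<one> \<in> V" "\<And>x y. x \<in> V \<Longrightarrow> y \<in> V \<Longrightarrow> x \<otimes> y \<in> U"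
    using nbhd_mult[OF assms] by blast
  obtain W where "openin T W" "\<one> \<in> W" "W \<subseteq> V" "\<And>x. x \<in> W \<Longrightarrow> inv x \<in> V"
    using nbhd_inv[OF V(1,2)] by blast
  then show thesis using that[of W] V by blast
qed

lemma nbhd_nat_pow:
  assumes "openin T U" "\<one> \<in> U"
  obtains V where "openin T V" "\<one> \<in> V" "\<And>x i. x \<in> V \<Longrightarrow> i < (n::nat) \<Longrightarrow> x [^] i \<in> U"
proof (rule that[of "carrier K \<inter> (\<Inter>i\<in>{..<n}. {x \<in> carrier K. x [^] i \<in> U})"])
  show "openin T (carrier K \<inter> (\<Inter>i\<in>{..<n}. {x \<in> carrier K. x [^] i \<in> U}))"
    using openin_carrier openin_preimage[OF continuous_map_nat_pow assms(1)]
    by (cases "n = 0") (auto intro!: openin_Int openin_INT2)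
qed (use assms in auto)

lemma separate_one:
  assumes "x \<in> carrier K" "x \<noteq> \<one>"
  obtains U where "openin T U" "\<one> \<in> U" "x \<notin> U"
proof -
  have "\<one> \<in> topspace T" "x \<in> topspace T" by (simp_all add: topspace_eq assms)
  then obtain U V where "openin T U" "openin T V" "\<one> \<in> U" "x \<in> V" "disjnt U V"
    using hausdorff assms(2) unfolding Hausdorff_space_def by metis
  then show thesis using that[of U] by (auto simp: disjnt_def)
qed

end

locale compact_abelian_group = abelian_topological_group +
  assumes compact: "compact_space T"
begin

definition closed_subgroup :: "'a set \<Rightarrow> bool" where
  "closed_subgroup H \<longleftrightarrow> subgroup H K \<and> closedin T H"

definition open_subgroup :: "'a set \<Rightarrow> bool" where
  "open_subgroup H \<longleftrightarrow> subgroup H K \<and> openin T H"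

definition monothetic :: "'a \<Rightarrow> 'a set" where
  "monothetic y = T closure_of (range (\<lambda>i::int. y [^] i))"

lemma compactin_closedin: "closedin T A \<Longrightarrow> compactin T A"
  using compact closedin_compact_space by blast

lemma closedin_compactin: "compactin T A \<Longrightarrow> closedin T A"
  using hausdorff compactin_imp_closedin by blast

lemma closedin_image:
  "continuous_map T T f \<Longrightarrow> closedin T A \<Longrightarrow> closedin T (f ` A)"
  using closedin_compactin compactin_closedin image_compactin by blast

lemma closedin_set_mult:
  assumes "closedin T A" "closedin T B"
  shows "closedin T (A <#> B)"
proof -
  have "compactin (prod_topology T T) (A \<times> B)"
    using assms by (simp add: compactin_Times compactin_closedin)
  then have "compactin T ((\<lambda>(x, y). x \<otimes> y) ` (A \<times> B))"
    using continuous_mult image_compactin by blast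
  moreover have "(\<lambda>(x, y). x \<otimes> y) ` (A \<times> B) = A <#> B"
    by (auto simp: set_mult_def)
  ultimately show ?thesis using closedin_compactin by simp
qed

lemma closedin_singleton: "x \<in> carrier K \<Longrightarrow> closedin T {x}"
  using hausdorff topspace_eq by (simp add: closedin_compactin)

lemma nbhd_closure:
  assumes "openin T U" "\<one> \<in> U"
  obtains V where "openin T V" "\<one> \<in> V" "T closure_of V \<subseteq> U"
proof -
  have "regular_space T"
    using compact hausdorff compact_Hausdorff_imp_regular_space by blast
  then have "neighbourhood_base_of (closedin T) T" by (simp add: neighbourhood_base_of_closedin)
  then obtain V C where "openin T V" "closedin T C" "\<one> \<in> V" "V \<subseteq> C" "C \<subseteq> U"
    using assms unfolding neighbourhood_base_of by meson
  then show thesis using that[of V] closure_of_minimal[of V C T] by blast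
qed

lemma closed_subgroupD:
  assumes "closed_subgroup H"
  shows "subgroup H K" "closedin T H" "H \<subseteq> carrier K" "\<one> \<in> H"
    and "\<And>x y. x \<in> H \<Longrightarrow> y \<in> H \<Longrightarrow> x \<otimes> y \<in> H"
    and "\<And>x. x \<in> H \<Longrightarrow> inv x \<in> H"
    and "\<And>x n. x \<in> H \<Longrightarrow> x [^] (n::nat) \<in> H"
    and "\<And>x n. x \<in> H \<Longrightarrow> x [^] (n::int) \<in> H"
proof -
  show s: "subgroup H K" "closedin T H" using assms by (simp_all add: closed_subgroup_def)
  then show "H \<subseteq> carrier K" "\<one> \<in> H" "\<And>x y. x \<in> H \<Longrightarrow> y \<in> H \<Longrightarrow> x \<otimes> y \<in> H"
    "\<And>x. x \<in> H \<Longrightarrow> inv x \<in> H"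
    by (auto simp: subgroup_def)
  show p: "x [^] (n::nat) \<in> H" if "x \<in> H" for x n
    using s(1) that by (induction n) (auto simp: subgroup_def)
  show "x [^] (n::int) \<in> H" if "x \<in> H" for x n
    unfolding int_pow_def2 using p[OF that] subgroup.m_inv_closed[OF s(1)] by (simp del: pow_nat)
qed

lemma subgroup_closure:
  assumes "subgroup H K"
  shows "closed_subgroup (T closure_of H)"
proof -
  let ?C = "T closure_of H"
  have H: "H \<subseteq> carrier K" using assms by (rule subgroup.subset)
  have HC: "H \<subseteq> ?C" using H by (simp add: closure_of_subset topspace_eq)
  have Cc: "?C \<subseteq> carrier K" using closure_of_subset_topspace[of T H] topspace_eq by blast
  \<comment> \<open>Closure under sums is reached one variable at a time: with the second summand in
    \<open>H\<close>, then with both in the closure.\<close>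
  have m1: "x \<otimes> h \<in> ?C" if "x \<in> ?C" "h \<in> H" for x h
  proof -
    have "closedin T {x \<in> carrier K. x \<otimes> h \<in> ?C}"
      using that H by (intro closedin_translate) auto
    moreover have "H \<subseteq> {x \<in> carrier K. x \<otimes> h \<in> ?C}"
      using that(2) H HC subgroup.m_closed[OF assms] by blast
    ultimately have "?C \<subseteq> {x \<in> carrier K. x \<otimes> h \<in> ?C}" by (simp add: closure_of_minimal)
    then show ?thesis using that by blast
  qed
  have m2: "x \<otimes> y \<in> ?C" if "x \<in> ?C" "y \<in> ?C" for x y
  proof -
    have "closedin T {y \<in> carrier K. y \<otimes> x \<in> ?C}"
      using that Cc by (intro closedin_translate) auto
    moreover have "H \<subseteq> {y \<in> carrier K. y \<otimes> x \<in> ?C}"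
    proof
      fix y assume "y \<in> H"
      then have "y \<in> carrier K" "x \<in> carrier K" "x \<otimes> y \<in> ?C" using that(1) H m1 Cc by auto
      then show "y \<in> {y \<in> carrier K. y \<otimes> x \<in> ?C}" by (simp add: m_comm)
    qed
    ultimately have "?C \<subseteq> {y \<in> carrier K. y \<otimes> x \<in> ?C}" by (simp add: closure_of_minimal)
    then have "y \<otimes> x \<in> ?C" using that by blast
    then show ?thesis using m_comm that Cc by (metis subsetD)
  qed
  have "closedin T {y \<in> carrier K. inv y \<in> ?C}"
    by (intro closedin_preimage continuous_inv) simp
  moreover have "H \<subseteq> {y \<in> carrier K. inv y \<in> ?C}"
    using H HC subgroup.m_inv_closed[OF assms] by blast
  ultimately have i: "?C \<subseteq> {y \<in> carrier K. inv y \<in> ?C}" by (simp add: closure_of_minimal)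
  have "subgroup ?C K"
  proof (rule subgroup.intro)
    show "\<one> \<in> ?C" using HC subgroup.one_closed[OF assms] by blast
  qed (use Cc m2 i in auto)
  then show ?thesis by (simp add: closed_subgroup_def)
qed

lemma closed_subgroup_monothetic:
  assumes "y \<in> carrier K"
  shows "closed_subgroup (monothetic y)" "y \<in> monothetic y"
    and "\<And>H. closed_subgroup H \<Longrightarrow> y \<in> H \<Longrightarrow> monothetic y \<subseteq> H"
proof -
  have s: "subgroup (range (\<lambda>i::int. y [^] i)) K"
  proof (rule subgroupI)
    show "range (\<lambda>i::int. y [^] i) \<subseteq> carrier K" using assms by auto
    show "range (\<lambda>i::int. y [^] i) \<noteq> {}" by auto
  qed (use assms in \<open>auto simp: int_pow_mult[symmetric] int_pow_neg[symmetric]\<close>)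
  then show "closed_subgroup (monothetic y)" unfolding monothetic_def by (rule subgroup_closure)
  have "y [^] (1::int) \<in> range (\<lambda>i::int. y [^] i)" by blast
  then have "y \<in> range (\<lambda>i::int. y [^] i)" using assms by simp
  then show "y \<in> monothetic y" unfolding monothetic_def
    using closure_of_subset[of "range (\<lambda>i::int. y [^] i)" T] assms by (auto simp: topspace_eq)
  fix H assume H: "closed_subgroup H" "y \<in> H"
  then have "range (\<lambda>i::int. y [^] i) \<subseteq> H" using closed_subgroupD(8)[OF H(1) H(2)] by blast
  then show "monothetic y \<subseteq> H" unfolding monothetic_def
    using closed_subgroupD(2)[OF H(1)] by (simp add: closure_of_minimal)
qed

lemma closed_subgroup_set_mult: "closed_subgroup A \<Longrightarrow> closed_subgroup B \<Longrightarrow> closed_subgroup (A <#> B)"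
  by (simp add: closed_subgroup_def mult_subgroups closedin_set_mult)

lemma closed_subgroup_carrier: "closed_subgroup (carrier K)"
  by (simp add: closed_subgroup_def subgroup_self closedin_carrier)

lemma closed_subgroup_powers: "closed_subgroup H \<Longrightarrow> closed_subgroup (powers n H)"
  by (simp add: closed_subgroup_def subgroup_powers powers_def[of n H, symmetric])
     (simp add: powers_def closedin_image continuous_map_nat_pow)

lemma closed_subgroup_pow_preimage:
  assumes "closed_subgroup H"
  shows "closed_subgroup {x \<in> carrier K. x [^] (n::nat) \<in> H}"
  using assms subgroup_pow_preimage closedin_preimage[OF continuous_map_nat_pow]
  by (simp add: closed_subgroup_def)

lemma powers_monothetic_subset:
  assumes "y \<in> carrier K" "closed_subgroup H" "y [^] (n::nat) \<in> H"
  shows "powers n (monothetic y) \<subseteq> H"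
proof -
  have "monothetic y \<subseteq> {x \<in> carrier K. x [^] n \<in> H}"
    using assms closed_subgroup_pow_preimage by (intro closed_subgroup_monothetic(3)) auto
  then show ?thesis by (auto simp: powers_def)
qed

lemma finite_cover:
  assumes "openin T U" "\<one> \<in> U"
  obtains F where "finite F" "F \<subseteq> carrier K" "\<And>x. x \<in> carrier K \<Longrightarrow> \<exists>f\<in>F. x \<otimes> inv f \<in> U"
proof -
  have "compactin T (carrier K)" using compactin_closedin closedin_carrier by blast
  moreover have "openin T W" if "W \<in> (\<lambda>f. {x \<in> carrier K. x \<otimes> inv f \<in> U}) ` carrier K" for W
    using that assms(1) openin_translate by auto
  moreover have "carrier K \<subseteq> \<Union> ((\<lambda>f. {x \<in> carrier K. x \<otimes> inv f \<in> U}) ` carrier K)"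
    using assms(2) by (auto intro!: bexI)
  ultimately obtain \<F> where "finite \<F>" "\<F> \<subseteq> (\<lambda>f. {x \<in> carrier K. x \<otimes> inv f \<in> U}) ` carrier K"
    "carrier K \<subseteq> \<Union>\<F>"
    unfolding compactin_def by meson
  then obtain F where "finite F" "F \<subseteq> carrier K" "\<F> = (\<lambda>f. {x \<in> carrier K. x \<otimes> inv f \<in> U}) ` F"
    by (meson finite_subset_image)
  with \<open>carrier K \<subseteq> \<Union>\<F>\<close> show thesis using that[of F] by blast
qed

end

section \<open>Lifting p-adic integers\<close>

text \<open>If 1 and the frequencies are independent over the integers, Kronecker's theorem finds n
  in any residue class with every n \<open>\<theta> i\<close> so close to an integer that the same
  holds for all multiples of n up to \<open>R\<close>. Integer relations are removed beforehand at
  the price of the factor \<open>d\<close>, which therefore depends neither on the residue class nor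
  on \<open>R\<close>.\<close>

lemma bohr_set_kronecker:
  fixes \<theta> :: "nat \<Rightarrow> real" and P :: "int \<Rightarrow> bool"
  assumes P: "\<And>g. (\<And>i. i < m \<Longrightarrow> cos (2 * pi * (of_int g * \<theta> i)) > 0) \<Longrightarrow> P g"
  obtains d :: nat where "d > 0"
    "\<And>q a R. q > 0 \<Longrightarrow> \<exists>t. \<forall>k. \<bar>k\<bar> \<le> R \<longrightarrow> P (k * (a + q * t) * int d)"
proof -
  \<comment> \<open>For the least \<open>N\<close> with this property the surviving frequencies
    admit no integer relation with 1.\<close>
  define good where "good N \<longleftrightarrow> (\<exists>d \<delta> I. d > 0 \<and> \<delta> > 0 \<and> finite I \<and> card I = N \<and>
      (\<forall>n. (\<forall>i\<in>I. \<exists>h::int. \<bar>of_int n * \<theta> i - of_int h\<bar> < \<delta>) \<longrightarrow> P (n * int d)))" for N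
  have "good m"
    unfolding good_def
  \<comment> \<open>The cosine is positive strictly within a quarter turn of 0.\<close>
  proof (intro exI[of _ "1::nat"] exI[of _ "1/4::real"] exI[of _ "{..<m}"] conjI allI impI)
    fix n assume n: "\<forall>i\<in>{..<m}. \<exists>h::int. \<bar>of_int n * \<theta> i - of_int h\<bar> < 1/4"
    show "P (n * int 1)"
    proof (simp, rule P)
      fix i assume "i < m"
      then obtain h :: int where h: "\<bar>of_int n * \<theta> i - of_int h\<bar> < 1/4" using n by auto
      have "cos (2 * pi * (of_int n * \<theta> i - of_int h)) > 0"
      proof (rule cos_gt_zero_pi)
        have "\<bar>2 * pi * (of_int n * \<theta> i - of_int h)\<bar> < 2 * pi * (1/4)"
          unfolding abs_mult using h by simp
        then show "2 * pi * (of_int n * \<theta> i - of_int h) < pi / 2" "- (pi / 2) < 2 * pi * (of_int n * \<theta> i - of_int h)"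
          by linarith+
      qed
      also have "2 * pi * (of_int n * \<theta> i - of_int h) = 2 * pi * (of_int n * \<theta> i) - 2 * pi * of_int h"
        by (simp add: algebra_simps)
      also have "cos \<dots> = cos (2 * pi * (of_int n * \<theta> i))"
        unfolding cos_diff cos_int_2pin sin_int_2pin by simp
      finally show "cos (2 * pi * (of_int n * \<theta> i)) > 0" .
    qed
  qed auto
  define N where "N = (LEAST N. good N)"
  have gN: "good N" unfolding N_def by (rule LeastI) fact
  have least: "\<not> good k" if "k < N" for k using that not_less_Least unfolding N_def by blast
  obtain d \<delta> I where d: "d > 0" "\<delta> > 0" "finite I" "card I = N"
    and dP: "\<And>n. (\<And>i. i \<in> I \<Longrightarrow> \<exists>h::int. \<bar>of_int n * \<theta> i - of_int h\<bar> < \<delta>) \<Longrightarrow> P (n * int d)"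
  proof -
    obtain d \<delta> I where "d > 0 \<and> \<delta> > 0 \<and> finite I \<and> card I = N \<and>
      (\<forall>n. (\<forall>i\<in>I. \<exists>h::int. \<bar>of_int n * \<theta> i - of_int h\<bar> < \<delta>) \<longrightarrow> P (n * int d))"
      using gN unfolding good_def by (elim exE) (rule that)
    then show thesis by (intro that[of d \<delta> I]) simp_all
  qed
  \<comment> \<open>An integer relation between the frequencies and 1 would allow one frequency to be
    dropped at the price of enlarging the factor d.\<close>
  have no_pos_relation: False
    if j: "j \<in> I" "u j > 0" and rel: "(\<Sum>i\<in>I. of_int (u i) * \<theta> i) = of_int w" for j w and u :: "nat \<Rightarrow> int"
  proof -
    define s where "s = (\<Sum>i\<in>I. \<bar>real_of_int (u i)\<bar>)"
    have s0: "s \<ge> 0" unfolding s_def by (intro sum_nonneg) auto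
    \<comment> \<open>The errors at the remaining frequencies, weighted by the coefficients of the
      relation, then stay below \<open>\<delta>\<close> at the eliminated frequency; the same choice
      absorbs the multiplication by \<open>u j\<close> at the others.\<close>
    define \<delta>' where "\<delta>' = \<delta> / (1 + s)"
    have \<delta>': "\<delta>' > 0" using d(2) s0 by (simp add: \<delta>'_def)
    have s\<delta>: "s * \<delta>' < \<delta>" using d(2) s0 by (simp add: \<delta>'_def field_simps)
    have uj: "\<bar>real_of_int (u j)\<bar> \<le> s" unfolding s_def using j(1) d(3)
      by (intro member_le_sum) auto
    have "good (card (I - {j}))"
      unfolding good_def
    proof (intro exI[of _ "d * nat (u j)"] exI[of _ \<delta>'] exI[of _ "I - {j}"] conjI allI impI)
      show "d * nat (u j) > 0" using d(1) j(2) by simp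
      fix n assume "\<forall>i\<in>I - {j}. \<exists>h::int. \<bar>of_int n * \<theta> i - of_int h\<bar> < \<delta>'"
      then obtain h :: "nat \<Rightarrow> int" where h: "\<And>i. i \<in> I - {j} \<Longrightarrow> \<bar>of_int n * \<theta> i - of_int (h i)\<bar> < \<delta>'"
        by metis
      have "P (n * u j * int d)"
      proof (rule dP)
        fix i assume i: "i \<in> I"
        show "\<exists>h::int. \<bar>of_int (n * u j) * \<theta> i - of_int h\<bar> < \<delta>"
        proof (cases "i = j")
          case False
          have "\<bar>of_int (n * u j) * \<theta> i - of_int (u j * h i)\<bar> = \<bar>real_of_int (u j)\<bar> * \<bar>of_int n * \<theta> i - of_int (h i)\<bar>"
            by (simp add: abs_mult[symmetric] algebra_simps)
          also have "\<dots> \<le> s * \<delta>'" using h[of i] i False uj s0 by (intro mult_mono) auto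
          finally show ?thesis using s\<delta> by (intro exI[of _ "u j * h i"]) linarith
        next
          case True
          have "real_of_int (u j) * \<theta> j = of_int w - (\<Sum>i\<in>I-{j}. of_int (u i) * \<theta> i)"
            using rel j(1) d(3) by (simp add: sum.remove)
          then have "of_int (n * u j) * \<theta> j = of_int n * (of_int w - (\<Sum>i\<in>I-{j}. of_int (u i) * \<theta> i))"
            by (simp add: mult.assoc)
          also have "\<dots> = of_int (n * w) - (\<Sum>i\<in>I-{j}. of_int (u i) * (of_int n * \<theta> i))"
            by (simp add: right_diff_distrib sum_distrib_left mult_ac)
          finally have "of_int (n * u j) * \<theta> j - of_int (n * w - (\<Sum>i\<in>I-{j}. u i * h i)) =
              - (\<Sum>i\<in>I-{j}. of_int (u i) * (of_int n * \<theta> i - of_int (h i)))"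
            by (simp add: sum_subtractf right_diff_distrib)
          then have "\<bar>of_int (n * u j) * \<theta> j - of_int (n * w - (\<Sum>i\<in>I-{j}. u i * h i))\<bar> \<le>
              (\<Sum>i\<in>I-{j}. \<bar>of_int (u i) * (of_int n * \<theta> i - of_int (h i))\<bar>)"
            by (simp add: sum_abs)
          also have "\<dots> \<le> (\<Sum>i\<in>I-{j}. \<bar>of_int (u i)\<bar> * \<delta>')"
            unfolding abs_mult by (intro sum_mono mult_left_mono less_imp_le[OF h]) auto
          also have "\<dots> \<le> (\<Sum>i\<in>I. \<bar>of_int (u i)\<bar> * \<delta>')"
            using d(3) \<delta>' by (intro sum_mono2) auto
          also have "\<dots> = s * \<delta>'" by (simp add: s_def sum_distrib_right)
          finally show ?thesis unfolding True using s\<delta>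
            by (intro exI[of _ "n * w - (\<Sum>i\<in>I-{j}. u i * h i)"]) linarith
        qed
      qed
      then show "P (n * int (d * nat (u j)))" using j(2) by (simp add: mult_ac)
    qed (use \<delta>' d(3) in auto)
    moreover have "card (I - {j}) < N" using j(1) d(3,4) by (metis card_Diff1_less)
    ultimately show False using least by blast
  qed
  have no_relation: "u j = 0"
    if j: "j \<in> I" and rel: "(\<Sum>i\<in>I. of_int (u i) * \<theta> i) = of_int w" for j w and u :: "nat \<Rightarrow> int"
  proof (rule ccontr)
    assume "u j \<noteq> 0"
    then consider "u j > 0" | "- u j > 0" by linarith
    then show False
    proof cases
      case 1 then show False using no_pos_relation[OF j _ rel] by blast
    next
      case 2
      have "(\<Sum>i\<in>I. of_int (- u i) * \<theta> i) = of_int (- w)" using rel by (simp add: sum_negf)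
      then show False using no_pos_relation[OF j, of "\<lambda>i. - u i" "-w"] 2 by simp
    qed
  qed
  obtain b where b: "bij_betw b {..<N} I"
    using ex_bij_betw_nat_finite[OF d(3)] d(4) by (auto simp: atLeast0LessThan)
  show thesis
  proof (rule that[OF d(1)])
    fix q a R :: int assume q: "q > 0"
    \<comment> \<open>Kronecker's theorem modulo 1 asks for a family ending in the constant 1.
      Scaling by \<open>q\<close> makes the solution \<open>t\<close> move a + q t within its
      residue class.\<close>
    define \<phi> where "\<phi> i = (if i < N then of_int q * \<theta> (b i) else (1::real))" for i
    have rel0: "v i = 0" if "(\<Sum>i\<le>N. of_int (v i) * \<phi> i) = 0" "i \<le> N" for i and v :: "nat \<Rightarrow> int"
    proof -
      define u where "u x = v (inv_into {..<N} b x) * q" for x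
      have ub: "u (b i) = v i * q" if "i < N" for i
        using that b by (simp add: u_def bij_betw_def inv_into_f_f)
      have split: "(\<Sum>i\<le>N. of_int (v i) * \<phi> i) = (\<Sum>i<N. of_int (v i) * \<phi> i) + of_int (v N)"
        by (simp add: lessThan_Suc_atMost[symmetric] \<phi>_def)
      have "(\<Sum>i<N. of_int (v i) * \<phi> i) = (\<Sum>i<N. of_int (u (b i)) * \<theta> (b i))"
        by (intro sum.cong) (auto simp: \<phi>_def ub)
      also have "\<dots> = (\<Sum>x\<in>I. of_int (u x) * \<theta> x)" using b by (rule sum.reindex_bij_betw)
      finally have e: "(\<Sum>x\<in>I. of_int (u x) * \<theta> x) = of_int (- v N)" using that(1) split by simp
      have z: "v i = 0" if "i < N" for i
      proof -
        have "b i \<in> I" using b that by (auto simp: bij_betw_def)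
        then have "u (b i) = 0" using no_relation e by blast
        then show ?thesis using ub[OF that] q by simp
      qed
      then have "v N = 0" using that(1) split by simp
      then show ?thesis using z that(2) by (cases "i = N") auto
    qed
    have inj: "inj_on \<phi> {..N}"
    proof (rule inj_onI, rule ccontr)
      fix i j assume ij: "i \<in> {..N}" "j \<in> {..N}" "\<phi> i = \<phi> j" "i \<noteq> j"
      define v where "v k = (if k = i then 1 else if k = j then -1 else 0 :: int)" for k
      have "(\<Sum>k\<le>N. of_int (v k) * \<phi> k) = (\<Sum>k\<in>{i, j}. of_int (v k) * \<phi> k)"
        using ij by (intro sum.mono_neutral_right) (auto simp: v_def)
      also have "\<dots> = 0" using ij by (simp add: v_def)
      finally have "v i = 0" using rel0 ij by auto
      then show False by (simp add: v_def)
    qed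
    have indep: "module.independent (\<lambda>r x. real_of_int r * x) (\<phi> ` {..N})"
    proof -
      interpret Modules.module "\<lambda>r x. real_of_int r * x"
        by (simp add: Modules.module.intro distrib_left distrib_right mult.commute)
      show "independent (\<phi> ` {..N})"
      proof
      assume "dependent (\<phi> ` {..N})"
      then obtain u where u: "\<exists>x\<in>\<phi> ` {..N}. u x \<noteq> 0" "(\<Sum>x\<in>\<phi> ` {..N}. real_of_int (u x) * x) = 0"
        by (auto simp: dependent_finite)
      have "(\<Sum>i\<le>N. of_int (u (\<phi> i)) * \<phi> i) = 0"
        using u(2) by (simp add: sum.reindex[OF inj])
      then show False using rel0[of "\<lambda>i. u (\<phi> i)"] u(1) by auto
      qed
    qed
    \<comment> \<open>Small enough to survive multiplication by each \<open>k\<close> with |k| \<le>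
      R. The target of the approximation is -a \<open>\<theta>\<close>, so that (a + q t)
      \<open>\<theta>\<close> is nearly an integer.\<close>
    define \<epsilon> where "\<epsilon> = \<delta> / (\<bar>of_int R\<bar> + 1)"
    have \<epsilon>: "\<epsilon> > 0" unfolding \<epsilon>_def using d(2) by (intro divide_pos_pos) auto
    have \<phi>N: "\<phi> N = 1" by (simp add: \<phi>_def)
    obtain t h where th: "\<And>i. i < N \<Longrightarrow> \<bar>of_int t * \<phi> i - of_int (h i) - (- of_int a * \<theta> (b i))\<bar> < \<epsilon>"
      by (rule Kronecker_thm_2[OF indep inj \<phi>N \<epsilon>, of "\<lambda>i. - of_int a * \<theta> (b i)"]) (rule that, blast)
    show "\<exists>t. \<forall>k. \<bar>k\<bar> \<le> R \<longrightarrow> P (k * (a + q * t) * int d)"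
    proof (intro exI[of _ t] allI impI)
      fix k assume k: "\<bar>k\<bar> \<le> R"
      show "P (k * (a + q * t) * int d)"
      proof (rule dP)
        fix x assume "x \<in> I"
        then have "x \<in> b ` {..<N}" using b by (simp add: bij_betw_def)
        then obtain i where i: "i < N" "x = b i" by auto
        have "\<bar>of_int (a + q * t) * \<theta> x - of_int (h i)\<bar> < \<epsilon>"
        proof -
          have "of_int t * \<phi> i - of_int (h i) - (- of_int a * \<theta> (b i)) = of_int (a + q * t) * \<theta> x - of_int (h i)"
            using i by (simp add: \<phi>_def algebra_simps)
          then show ?thesis using th[OF i(1)] by simp
        qed
        moreover have "\<bar>of_int (k * (a + q * t)) * \<theta> x - of_int (k * h i)\<bar> =
            \<bar>real_of_int k\<bar> * \<bar>of_int (a + q * t) * \<theta> x - of_int (h i)\<bar>"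
        proof -
          have "of_int (k * (a + q * t)) * \<theta> x - of_int (k * h i) = real_of_int k * (of_int (a + q * t) * \<theta> x - of_int (h i))"
            by (simp add: right_diff_distrib)
          then show ?thesis by (simp only: abs_mult)
        qed
        moreover have "\<bar>real_of_int k\<bar> \<le> \<bar>of_int R\<bar>" using k by linarith
        ultimately have "\<bar>of_int (k * (a + q * t)) * \<theta> x - of_int (k * h i)\<bar> \<le> \<bar>of_int R\<bar> * \<epsilon>"
          by (simp add: mult_mono)
        also have "\<dots> < \<delta>" using d(2) by (simp add: \<epsilon>_def field_simps add_pos_nonneg)
        finally show "\<exists>h::int. \<bar>of_int (k * (a + q * t)) * \<theta> x - of_int h\<bar> < \<delta>" by blast
      qed
    qed
  qed
qed

context compact_abelian_group
begin

lemma cluster_point: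
  assumes "\<And>j::nat. s j \<in> carrier K"
  obtains z where "z \<in> carrier K"
    "\<And>A. \<lbrakk>closedin T A; eventually (\<lambda>j. s j \<in> A) sequentially\<rbrakk> \<Longrightarrow> z \<in> A"
proof -
  have "range s \<subseteq> topspace T" using assms by (auto simp: topspace_eq)
  from compact_space_cluster_point[OF compact this] show thesis
    using that by (metis topspace_eq)
qed

text \<open>A point is coloured by a translate of \<open>W\<close> that contains it, and four equal
  translates cancel in u + v - w - z. This converts Bogolyubov's statement about colourings into one
  about neighbourhoods.\<close>

lemma nbhd_colouring:
  assumes "openin T U" "\<one> \<in> U"
  obtains F and col :: "'a \<Rightarrow> 'a" where "finite F" "range col \<subseteq> F"
    "\<And>u v w z. \<lbrakk>u \<in> carrier K; v \<in> carrier K; w \<in> carrier K; z \<in> carrier K;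
       col u = col v; col v = col w; col w = col z\<rbrakk> \<Longrightarrow> u \<otimes> v \<otimes> inv w \<otimes> inv z \<in> U"
proof -
  obtain V where V: "openin T V" "\<one> \<in> V" "\<And>x y. x \<in> V \<Longrightarrow> y \<in> V \<Longrightarrow> x \<otimes> y \<in> U"
    using nbhd_mult[OF assms] by blast
  obtain W where W: "openin T W" "\<one> \<in> W" "\<And>x y. x \<in> W \<Longrightarrow> y \<in> W \<Longrightarrow> x \<otimes> inv y \<in> V"
    using nbhd_quotient[OF V(1,2)] by blast
  obtain F where F: "finite F" "F \<subseteq> carrier K" "\<And>x. x \<in> carrier K \<Longrightarrow> \<exists>f\<in>F. x \<otimes> inv f \<in> W"
    using finite_cover[OF W(1,2)] by blast
  then obtain c where c: "\<And>x. x \<in> carrier K \<Longrightarrow> c x \<in> F \<and> x \<otimes> inv (c x) \<in> W" by metis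
  define col where "col x = (if x \<in> carrier K then c x else c \<one>)" for x
  show thesis
  proof (rule that[OF F(1)])
    show "range col \<subseteq> F" using c by (auto simp: col_def)
    fix u v w z
    assume *: "u \<in> carrier K" "v \<in> carrier K" "w \<in> carrier K" "z \<in> carrier K"
      "col u = col v" "col v = col w" "col w = col z"
    define f where "f = col u"
    have f: "f \<in> carrier K" using c * F(2) by (auto simp: f_def col_def)
    have "x \<otimes> inv f \<in> W" if "x \<in> carrier K" "col x = f" for x
      using c[OF that(1)] that by (simp add: col_def)
    then have in_W: "u \<otimes> inv f \<in> W" "v \<otimes> inv f \<in> W" "w \<otimes> inv f \<in> W" "z \<otimes> inv f \<in> W"
      using * by (simp_all add: f_def)
    have "(u \<otimes> inv f) \<otimes> inv (w \<otimes> inv f) \<otimes> ((v \<otimes> inv f) \<otimes> inv (z \<otimes> inv f)) \<in> U"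
      by (intro V(3) W(3) in_W)
    also have "(x \<otimes> inv f) \<otimes> inv (y \<otimes> inv f) = x \<otimes> inv y" if "x \<in> carrier K" "y \<in> carrier K" for x y
    proof -
      have "inv f \<otimes> (f \<otimes> inv y) = inv y" using that f by (simp add: m_assoc[symmetric])
      then show ?thesis using that f by (simp add: inv_mult_group m_assoc)
    qed
    then have "(u \<otimes> inv f) \<otimes> inv (w \<otimes> inv f) \<otimes> ((v \<otimes> inv f) \<otimes> inv (z \<otimes> inv f)) = (u \<otimes> inv w) \<otimes> (v \<otimes> inv z)"
      using * by simp
    also have "\<dots> = u \<otimes> v \<otimes> inv w \<otimes> inv z" using * by (simp add: m_ac)
    finally show "u \<otimes> v \<otimes> inv w \<otimes> inv z \<in> U" .
  qed
qed

text \<open>The exponents n with n y in \<open>V\<close> contain a Bohr set. With d = p^a r, r prime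
  to p, Kronecker's theorem supplies n_j such that n_j r = 1 modulo p^j and k n_j d y is in
  \<open>V\<close> for |k| \<le> j. A cluster point \<open>l\<close> of n_j d y is p-adically
  indistinguishable from p^a y, yet all its multiples lie in \<open>U\<close>.\<close>

lemma small_monothetic_element:
  fixes p :: nat
  assumes y: "y \<in> carrier K" and U: "openin T U" "\<one> \<in> U" and p: "Factorial_Ring.prime p"
  obtains a l where "l \<in> carrier K" "\<And>i::int. l [^] i \<in> U"
    "\<And>j. \<exists>m\<in>monothetic y. l = y [^] (p ^ a) \<otimes> m [^] (p ^ j)"
proof -
  obtain V where V: "openin T V" "\<one> \<in> V" "T closure_of V \<subseteq> U" using nbhd_closure[OF U] by blast
  have VcV: "V \<subseteq> T closure_of V" using V(1) by (simp add: closure_of_subset openin_subset)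
  obtain F and col :: "'a \<Rightarrow> 'a" where F: "finite F" "range col \<subseteq> F"
    and col: "\<And>u v w z. \<lbrakk>u \<in> carrier K; v \<in> carrier K; w \<in> carrier K; z \<in> carrier K;
       col u = col v; col v = col w; col w = col z\<rbrakk> \<Longrightarrow> u \<otimes> v \<otimes> inv w \<otimes> inv z \<in> V"
    using nbhd_colouring[OF V(1,2)] by blast
  have F': "range (\<lambda>g::int. col (y [^] g)) \<subseteq> F" using F(2) by blast
  obtain m and \<theta> :: "nat \<Rightarrow> real" where *: "\<And>g. (\<And>i. i < m \<Longrightarrow> cos (2 * pi * (of_int g * \<theta> i)) > 0) \<Longrightarrow>
       \<exists>a b c d. col (y [^] a) = col (y [^] b) \<and> col (y [^] b) = col (y [^] c) \<and> col (y [^] c) = col (y [^] d) \<and> g = a + b - c - d"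
    using bogolyubov_int[OF F(1) F'] by blast
  have "y [^] g \<in> V" if "\<And>i. i < m \<Longrightarrow> cos (2 * pi * (of_int g * \<theta> i)) > 0" for g :: int
  proof -
    obtain a b c d where "col (y [^] a) = col (y [^] b)" "col (y [^] b) = col (y [^] c)" "col (y [^] c) = col (y [^] d)" "g = a + b - c - d"
      using *[of g] \<open>\<And>i. i < m \<Longrightarrow> cos (2 * pi * (of_int g * \<theta> i)) > 0\<close> by blast
    then show ?thesis using y by (simp add: int_pow_combination col)
  qed
  then obtain d :: nat where d: "d > 0"
    "\<And>q a R. q > 0 \<Longrightarrow> \<exists>t. \<forall>k. \<bar>k\<bar> \<le> R \<longrightarrow> y [^] (k * (a + q * t) * int d) \<in> V"
    using bohr_set_kronecker[of m \<theta> "\<lambda>g. y [^] g \<in> V"] by metis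
  obtain a r where ar: "d = p ^ a * r" "\<not> p dvd r"
    using multiplicity_decompose'[of d p] d(1) p by (metis not_prime_unit not_gr_zero)
  have "\<exists>n u. n * int r = 1 + int p ^ j * u \<and> (\<forall>k. \<bar>k\<bar> \<le> int j \<longrightarrow> y [^] (k * n * int d) \<in> V)" for j
  proof -
    have "coprime (int r) (int p ^ j)"
      using p ar(2) by (simp add: prime_imp_coprime coprime_commute)
    then obtain e w where "e * int r + w * int p ^ j = 1"
      using bezout_int[of "int r" "int p ^ j"] by (metis coprime_imp_gcd_eq_1)
    then obtain u where u: "int r * e = 1 + int p ^ j * u"
      by (intro that[of "- w"]) (simp add: algebra_simps)
    have "int p ^ j > 0" using p by (simp add: prime_gt_0_nat)
    then obtain t where t: "\<forall>k. \<bar>k\<bar> \<le> int j \<longrightarrow> y [^] (k * (e + int p ^ j * t) * int d) \<in> V"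
      using d(2) by blast
    show ?thesis
      by (rule exI[of _ "e + int p ^ j * t"], rule exI[of _ "u + t * int r"]) (use u t in \<open>simp add: algebra_simps\<close>)
  qed
  then obtain n u where n: "\<And>j. n j * int r = 1 + int p ^ j * u j"
    "\<And>j k. \<bar>k\<bar> \<le> int j \<Longrightarrow> y [^] (k * n j * int d) \<in> V"
    by metis
  obtain l where l: "l \<in> carrier K"
    "\<And>A. \<lbrakk>closedin T A; eventually (\<lambda>j. y [^] (n j * int d) \<in> A) sequentially\<rbrakk> \<Longrightarrow> l \<in> A"
    by (rule cluster_point[of "\<lambda>j. y [^] (n j * int d)"]) (use y in auto)
  show thesis
  proof (rule that[OF l(1)])
    fix i :: int
    have "l \<in> {x \<in> carrier K. x [^] i \<in> T closure_of V}"
    proof (rule l(2))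
      show "closedin T {x \<in> carrier K. x [^] i \<in> T closure_of V}"
        by (intro closedin_preimage continuous_map_int_pow) simp
      show "eventually (\<lambda>j. y [^] (n j * int d) \<in> {x \<in> carrier K. x [^] i \<in> T closure_of V}) sequentially"
        unfolding eventually_sequentially
      proof (intro exI[of _ "nat \<bar>i\<bar>"] allI impI)
        fix j assume "nat \<bar>i\<bar> \<le> j"
        then have "y [^] (i * n j * int d) \<in> V" by (intro n(2)) linarith
        then show "y [^] (n j * int d) \<in> {x \<in> carrier K. x [^] i \<in> T closure_of V}"
          using y VcV by (auto simp: int_pow_pow mult_ac)
      qed
    qed
    then show "l [^] i \<in> U" using V(3) by blast
  next
    fix j
    let ?M = "monothetic y"
    have M: "closed_subgroup ?M" "y \<in> ?M" using closed_subgroup_monothetic[OF y] by auto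
    have "l \<in> {y [^] (p ^ a)} <#> powers (p ^ j) ?M"
    proof (rule l(2))
      show "closedin T ({y [^] (p ^ a)} <#> powers (p ^ j) ?M)"
        using y closed_subgroupD(2)[OF closed_subgroup_powers[OF M(1)]]
        by (intro closedin_set_mult closedin_singleton) auto
      show "eventually (\<lambda>i. y [^] (n i * int d) \<in> {y [^] (p ^ a)} <#> powers (p ^ j) ?M) sequentially"
        unfolding eventually_sequentially
      proof (intro exI[of _ j] allI impI)
        fix i assume "j \<le> i"
        then have pi: "int p ^ i = int p ^ j * int p ^ (i - j)" by (simp flip: power_add)
        have "n i * int d = int p ^ a * (n i * int r)" by (simp add: ar(1))
        also have "\<dots> = int (p ^ a) + (int p ^ a * int p ^ (i - j) * u i) * int (p ^ j)"
          unfolding n(1) pi by (simp add: algebra_simps)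
        finally have "y [^] (n i * int d) = y [^] (p ^ a) \<otimes> (y [^] (int p ^ a * int p ^ (i - j) * u i)) [^] (p ^ j)"
          using y by (simp only: int_pow_mult int_pow_pow[symmetric] int_pow_int)
        then show "y [^] (n i * int d) \<in> {y [^] (p ^ a)} <#> powers (p ^ j) ?M"
          using closed_subgroupD(8)[OF M] by (auto intro!: set_mult_memI simp: powers_def)
      qed
    qed
    then show "\<exists>m\<in>?M. l = y [^] (p ^ a) \<otimes> m [^] (p ^ j)"
      by (auto simp: set_mult_def powers_def)
  qed
qed

text \<open>The finitely many cosets i y + n M, with M = \<open>monothetic y\<close>, form a closed
  set that contains all multiples of \<open>y\<close>, hence M. So M / n M has at most n
  elements.\<close>

lemma monothetic_coset_cover:
  fixes n :: nat
  assumes y: "y \<in> carrier K" and n: "n > 0" and m: "m \<in> monothetic y"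
  obtains i m' where "i < n" "m' \<in> monothetic y" "m = y [^] i \<otimes> m' [^] n"
proof -
  let ?M = "monothetic y"
  have M: "closed_subgroup ?M" "y \<in> ?M" using closed_subgroup_monothetic[OF y] by auto
  define A where "A = (\<Union>i<n. {y [^] i} <#> powers n ?M)"
  have "closedin T A" unfolding A_def
    using y closed_subgroupD(2)[OF closed_subgroup_powers[OF M(1)]]
    by (intro closedin_Union) (auto intro!: closedin_set_mult closedin_singleton)
  moreover have "range (\<lambda>i::int. y [^] i) \<subseteq> A"
  proof
    fix x assume "x \<in> range (\<lambda>i::int. y [^] i)"
    then obtain k :: int where k: "x = y [^] k" by blast
    have "k = int (nat (k mod int n)) + (k div int n) * int n" using n by simp
    then have "x = y [^] (nat (k mod int n)) \<otimes> (y [^] (k div int n)) [^] n"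
      unfolding k using y by (metis int_pow_closed int_pow_int int_pow_mult int_pow_pow)
    moreover have "nat (k mod int n) < n" using n by (simp add: nat_less_iff)
    ultimately show "x \<in> A"
      using closed_subgroupD(8)[OF M] unfolding A_def powers_def
      by (auto intro!: bexI[of _ "nat (k mod int n)"] set_mult_memI)
  qed
  ultimately have "?M \<subseteq> A" unfolding monothetic_def by (simp add: closure_of_minimal)
  with m have "m \<in> A" by blast
  then show thesis using that by (auto simp: A_def set_mult_def powers_def)
qed

lemma open_subgroupD:
  assumes "open_subgroup H"
  shows "closed_subgroup H" "openin T H"
proof -
  have H: "subgroup H K" "openin T H" using assms by (simp_all add: open_subgroup_def)
  show "openin T H" by fact
  have "openin T (carrier K - H)"
  proof (subst openin_subopen, intro ballI)
    fix x assume x: "x \<in> carrier K - H"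
    show "\<exists>W. openin T W \<and> x \<in> W \<and> W \<subseteq> carrier K - H"
    proof (intro exI conjI)
      show "openin T {z \<in> carrier K. z \<otimes> inv x \<in> H}" using x H(2) by (intro openin_translate) auto
      show "x \<in> {z \<in> carrier K. z \<otimes> inv x \<in> H}" using x subgroup.one_closed[OF H(1)] by simp
      show "{z \<in> carrier K. z \<otimes> inv x \<in> H} \<subseteq> carrier K - H"
      proof (intro subsetI DiffI)
        fix z assume z: "z \<in> {z \<in> carrier K. z \<otimes> inv x \<in> H}"
        then show "z \<in> carrier K" by simp
        show "z \<notin> H"
        proof
          assume zH: "z \<in> H"
          then have "inv (z \<otimes> inv x) \<otimes> z \<in> H"
            using z subgroup.m_inv_closed[OF H(1)] subgroup.m_closed[OF H(1)] by simp
          moreover have "inv (z \<otimes> inv x) \<otimes> z = x"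
            using x z by (simp add: inv_mult_group m_assoc)
          ultimately show False using x by simp
        qed
      qed
    qed
  qed
  then have "closedin T H"
    using openin_subset_carrier[OF H(2)] by (simp add: closedin_def topspace_eq)
  then show "closed_subgroup H" using H by (simp add: closed_subgroup_def)
qed

text \<open>This does the work of projectivity of the p-adic integers: by minimality no element of
  \<open>M\<close> in the coset generates less than \<open>M\<close>, so a generator can later be
  corrected inside \<open>C\<close> at no cost. Compactness of x + C keeps the intersection of a
  chain from losing the coset.\<close>

lemma minimal_closed_subgroup:
  assumes C: "closed_subgroup C" and x: "x \<in> carrier K"
  obtains M c where "closed_subgroup M" "c \<in> C" "x \<otimes> c \<in> M"
    "\<And>c. c \<in> C \<Longrightarrow> x \<otimes> c \<in> M \<Longrightarrow> monothetic (x \<otimes> c) = M"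
proof -
  define A where "A = {M. closed_subgroup M \<and> (\<exists>c\<in>C. x \<otimes> c \<in> M)}"
  have Cc: "C \<subseteq> carrier K" and C1: "\<one> \<in> C" using closed_subgroupD[OF C] by auto
  have coset: "closedin T ({x} <#> C)"
    by (intro closedin_set_mult closedin_singleton x closed_subgroupD(2)[OF C])
  have "\<exists>M\<in>A. \<forall>H\<in>A. H \<subseteq> M \<longrightarrow> H = M"
  proof (rule predicate_Zorn)
    show "partial_order_on A (relation_of (\<lambda>M H. H \<subseteq> M) A)"
      by (rule partial_order_on_relation_ofI) auto
    fix \<C> assume ch: "\<C> \<in> Chains (relation_of (\<lambda>M H. H \<subseteq> M) A)"
    have CA: "\<C> \<subseteq> A" using ch by (auto simp: Chains_def relation_of_def)
    have tot: "M \<subseteq> H \<or> H \<subseteq> M" if "M \<in> \<C>" "H \<in> \<C>" for M H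
      using ch that by (auto simp: Chains_def relation_of_def)
    show "\<exists>u\<in>A. \<forall>a\<in>\<C>. u \<subseteq> a"
    proof (cases "\<C> = {}")
      case True
      have "carrier K \<in> A" using closed_subgroup_carrier C1 x by (auto simp: A_def)
      then show ?thesis using True by blast
    next
      case False
      have "\<Inter> ((\<lambda>M. M \<inter> ({x} <#> C)) ` \<C>) \<noteq> {}"
      proof (rule compact[unfolded compact_space_fip, rule_format], intro conjI ballI allI impI)
        fix S assume "S \<in> (\<lambda>M. M \<inter> ({x} <#> C)) ` \<C>"
        then show "closedin T S"
          using CA coset closed_subgroupD(2) by (auto simp: A_def)
      next
        fix \<F> assume F: "finite \<F> \<and> \<F> \<subseteq> (\<lambda>M. M \<inter> ({x} <#> C)) ` \<C>"
        then obtain \<G> where G: "finite \<G>" "\<G> \<subseteq> \<C>" "\<F> = (\<lambda>M. M \<inter> ({x} <#> C)) ` \<G>"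
          by (meson finite_subset_image)
        show "\<Inter>\<F> \<noteq> {}"
        proof (cases "\<G> = {}")
          case True then show ?thesis using G(3) by simp
        next
          case False
          have "subset.chain \<C> \<G>" using G(2) tot by (auto simp: subset_chain_def)
          then have "\<Inter>\<G> \<in> \<G>" using Inter_in_chain[OF G(1) False] by blast
          then have "\<Inter>\<G> \<in> A" using G(2) CA by blast
          then obtain c where "c \<in> C" "x \<otimes> c \<in> \<Inter>\<G>" by (auto simp: A_def)
          then have "x \<otimes> c \<in> \<Inter>\<F>" unfolding G(3) by (auto intro: set_mult_memI)
          then show ?thesis by blast
        qed
      qed
      then obtain z where z: "\<And>M. M \<in> \<C> \<Longrightarrow> z \<in> M" "z \<in> {x} <#> C" using False by blast
      obtain c where "c \<in> C" "z = x \<otimes> c" using z(2) by (auto simp: set_mult_def)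
      moreover have "closed_subgroup (\<Inter>\<C>)"
        unfolding closed_subgroup_def
      proof
        show "subgroup (\<Inter>\<C>) K"
          using False CA closed_subgroupD(1) by (intro subgroups_Inter) (auto simp: A_def)
        show "closedin T (\<Inter>\<C>)"
          using False CA closed_subgroupD(2) by (intro closedin_Inter) (auto simp: A_def)
      qed
      ultimately have "\<Inter>\<C> \<in> A" using z(1) by (auto simp: A_def)
      then show ?thesis by blast
    qed
  qed
  then obtain M where M: "M \<in> A" "\<And>H. H \<in> A \<Longrightarrow> H \<subseteq> M \<Longrightarrow> H = M" by blast
  then obtain c where c: "c \<in> C" "x \<otimes> c \<in> M" by (auto simp: A_def)
  have Mc: "closed_subgroup M" using M(1) by (simp add: A_def)
  show thesis
  proof (rule that[OF Mc c])
    fix c assume c: "c \<in> C" "x \<otimes> c \<in> M"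
    have xc: "x \<otimes> c \<in> carrier K" using c(1) Cc x by auto
    show "monothetic (x \<otimes> c) = M"
      by (rule M(2)) (use closed_subgroup_monothetic[OF xc] c Mc in \<open>auto simp: A_def\<close>)
  qed
qed

text \<open>By \<open>sep\<close>, \<open>C\<close> is an intersection of open subgroups; by
  \<open>top\<close> and \<open>nt\<close>, \<open>x\<close> is topologically p-torsion modulo
  \<open>C\<close> but not p-power torsion. The subgroup found is p^a M for a minimal closed M
  meeting x + C, and the work lies in proving that M \<inter> C is trivial.\<close>

lemma small_subgroup_avoiding:
  fixes p :: nat
  assumes C: "closed_subgroup C"
    and sep: "\<And>x. x \<in> carrier K \<Longrightarrow> (\<And>H. open_subgroup H \<Longrightarrow> C \<subseteq> H \<Longrightarrow> x \<in> H) \<Longrightarrow> x \<in> C"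
    and p: "Factorial_Ring.prime p" and x: "x \<in> carrier K"
    and top: "\<And>H. open_subgroup H \<Longrightarrow> C \<subseteq> H \<Longrightarrow> \<exists>n. x [^] (p ^ n) \<in> H"
    and nt: "\<And>n. x [^] (p ^ n) \<notin> C"
    and U: "openin T U" "\<one> \<in> U"
  obtains N where "closed_subgroup N" "N \<subseteq> U" "N \<noteq> {\<one>}" "C \<inter> N = {\<one>}"
proof -
  obtain M c where M: "closed_subgroup M" and c: "c \<in> C" "x \<otimes> c \<in> M"
    and min: "\<And>c. c \<in> C \<Longrightarrow> x \<otimes> c \<in> M \<Longrightarrow> monothetic (x \<otimes> c) = M"
    using minimal_closed_subgroup[OF C x] by blast
  have p0: "p > 0" using p by (simp add: prime_gt_0_nat)
  have Cc: "\<And>c. c \<in> C \<Longrightarrow> c \<in> carrier K" and Mc: "\<And>m. m \<in> M \<Longrightarrow> m \<in> carrier K"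
    using closed_subgroupD(3)[OF C] closed_subgroupD(3)[OF M] by auto
  have Ms: "subgroup M K" and Cs: "subgroup C K"
    using closed_subgroupD(1)[OF M] closed_subgroupD(1)[OF C] by auto
  define y where "y = x \<otimes> c"
  have yM: "y \<in> M" and y: "y \<in> carrier K" using c Mc by (auto simp: y_def)
  have My: "monothetic y = M" using min[OF c] by (simp add: y_def)
  have ypow: "y [^] n = x [^] n \<otimes> c [^] n" for n :: nat
    unfolding y_def using x Cc[OF c(1)] by (simp add: nat_pow_distrib)
  have small: "\<exists>n. powers (p ^ n) M \<subseteq> H" if H: "open_subgroup H" "C \<subseteq> H" for H
  proof -
    obtain n where "x [^] (p ^ n) \<in> H" using top[OF H] by blast
    moreover have "c [^] (p ^ n) \<in> H" using H(2) c(1) closed_subgroupD(7)[OF C] by blast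
    ultimately have "y [^] (p ^ n) \<in> H"
      unfolding ypow using closed_subgroupD(5)[OF open_subgroupD(1)[OF H(1)]] by blast
    then show ?thesis using powers_monothetic_subset[OF y open_subgroupD(1)[OF H(1)]] My by auto
  qed
  have ynt: "y [^] (p ^ n) \<notin> C" for n
  proof
    assume "y [^] (p ^ n) \<in> C"
    then have "y [^] (p ^ n) \<otimes> inv (c [^] (p ^ n)) \<in> C"
      using closed_subgroupD(5,6,7)[OF C] c(1) by blast
    then show False using nt[of n] x Cc[OF c(1)] by (simp add: ypow m_assoc)
  qed
  \<comment> \<open>The right side is a closed subgroup and y generates M, so the assumption extends
    from y to all of M. Iterating it pushes p^s y into p^(s+k) M + C for every k, hence into every
    open subgroup above \<open>C\<close>, hence into \<open>C\<close>.\<close>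
  have no_p_root: False if "y [^] (p ^ s) \<in> powers (p ^ Suc s) M <#> C" for s
  proof -
    let ?Q = "{v \<in> carrier K. v [^] (p ^ s) \<in> powers (p ^ Suc s) M <#> C}"
    have "closed_subgroup ?Q"
      by (intro closed_subgroup_pow_preimage closed_subgroup_set_mult closed_subgroup_powers M C)
    then have "M \<subseteq> ?Q" using closed_subgroup_monothetic(3)[OF y, of ?Q] that y My by auto
    then have step: "v [^] (p ^ s) \<in> powers (p ^ Suc s) M <#> C" if "v \<in> M" for v using that by blast
    have deep: "y [^] (p ^ s) \<in> powers (p ^ (s + k)) M <#> C" for k
    proof (induction k)
      case 0
      have "powers (p ^ s) M \<subseteq> powers (p ^ s) M <#> C"
        by (rule subset_set_mult) (simp_all add: subgroup_powers Ms Cs)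
      then show ?case using powersI[OF yM, of "p ^ s"] by auto
    next
      case (Suc k)
      then obtain u d where u: "u \<in> M" "d \<in> C" "y [^] (p ^ s) = u [^] (p ^ (s + k)) \<otimes> d"
        by (auto simp: set_mult_def powers_def)
      obtain w e where w: "w \<in> M" "e \<in> C" "u [^] (p ^ s) = w [^] (p ^ Suc s) \<otimes> e"
        using step[OF u(1)] by (auto simp: set_mult_def powers_def)
      have "u [^] (p ^ (s + k)) = (u [^] (p ^ s)) [^] (p ^ k)"
        using Mc[OF u(1)] by (simp add: nat_pow_pow power_add)
      also have "\<dots> = (w [^] (p ^ Suc s)) [^] (p ^ k) \<otimes> e [^] (p ^ k)"
        unfolding w(3) using Mc[OF w(1)] Cc[OF w(2)] by (simp add: nat_pow_distrib)
      also have "(w [^] (p ^ Suc s)) [^] (p ^ k) = w [^] (p ^ (s + Suc k))"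
        using Mc[OF w(1)] by (simp add: nat_pow_pow power_add mult_ac)
      finally have "y [^] (p ^ s) = w [^] (p ^ (s + Suc k)) \<otimes> (e [^] (p ^ k) \<otimes> d)"
        unfolding u(3) using Mc[OF w(1)] Cc[OF w(2)] Cc[OF u(2)] by (simp add: m_assoc)
      then show ?case
        using w(1,2) u(2) closed_subgroupD(5,7)[OF C] powersI[of w M]
        by (metis set_mult_memI)
    qed
    have "y [^] (p ^ s) \<in> C"
    proof (rule sep)
      fix H assume H: "open_subgroup H" "C \<subseteq> H"
      obtain n where n: "powers (p ^ n) M \<subseteq> H" using small[OF H] by blast
      have "powers (p ^ (s + n)) M \<subseteq> H"
        using powers_power_subset[OF Ms, of "p ^ n" "p ^ s"] n by (simp add: power_add mult.commute)
      then have "powers (p ^ (s + n)) M <#> C \<subseteq> H"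
        using H closed_subgroupD(1)[OF open_subgroupD(1)[OF H(1)]] by (intro set_mult_subset_subgroup)
      then show "y [^] (p ^ s) \<in> H" using deep[of n] by blast
    qed (use y in auto)
    then show False using ynt by blast
  qed
  \<comment> \<open>By Bezout a counterexample \<open>j\<close> may be replaced by p^v with v < s,
    and p^v y is not even in p^(v+1) M + C. So y has order exactly p^s modulo p^s M + C.\<close>
  have index: "p ^ s dvd j" if j: "y [^] j \<in> powers (p ^ s) M <#> C" for s j :: nat
  proof (rule ccontr)
    assume nd: "\<not> p ^ s dvd j"
    let ?H = "powers (p ^ s) M <#> C"
    obtain v where v: "gcd j (p ^ s) = p ^ v" "v \<le> s"
      using divides_primepow_nat[OF p, of "gcd j (p ^ s)" s] by auto
    have "v \<noteq> s" using nd v(1) by (metis gcd_dvd1)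
    then have vs: "s = Suc v + (s - Suc v)" using v(2) by simp
    have Hs: "subgroup ?H K" by (intro mult_subgroups subgroup_powers Ms Cs)
    have "powers (p ^ s) M \<subseteq> ?H" by (intro subset_set_mult subgroup_powers Ms Cs)
    then have "y [^] (p ^ s) \<in> ?H" using powersI[OF yM] by blast
    moreover obtain a b where ab: "a * int j + b * int (p ^ s) = int (p ^ v)"
      using bezout_int[of "int j" "int (p ^ s)"] v(1) by (metis gcd_int_int_eq)
    ultimately have "(y [^] j) [^] a \<otimes> (y [^] (p ^ s)) [^] b \<in> ?H"
      using subgroup_int_pow[OF Hs] subgroup.m_closed[OF Hs] j by blast
    moreover have "(y [^] j) [^] a \<otimes> (y [^] (p ^ s)) [^] b = y [^] (p ^ v)"
    proof -
      have "y [^] (p ^ v) = y [^] (int j * a + int (p ^ s) * b)"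
        using ab by (metis int_pow_int mult.commute)
      then show ?thesis using y by (simp only: int_pow_mult int_pow_pow[symmetric] int_pow_int)
    qed
    moreover have "?H \<subseteq> powers (p ^ Suc v) M <#> C"
    proof (intro mono_set_mult order_refl)
      have "p ^ s = p ^ Suc v * p ^ (s - Suc v)" using vs by (metis power_add)
      then show "powers (p ^ s) M \<subseteq> powers (p ^ Suc v) M"
        using powers_power_subset[OF Ms, of "p ^ Suc v" "p ^ (s - Suc v)"] by metis
    qed
    ultimately show False using no_p_root by auto
  qed
  have cover: "\<exists>i<p ^ s. \<exists>u\<in>M. m = y [^] i \<otimes> u [^] (p ^ s)" if "m \<in> M" for m s
    using monothetic_coset_cover[OF y, of "p ^ s" m] that p0 My by (metis zero_less_power)
  \<comment> \<open>Write d = i y + p u with i < p; \<open>index\<close> forces i = 0. The same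
    comparison one level above p^n puts u into p^n M for every n that occurs, hence into every open
    subgroup above \<open>C\<close> and so into \<open>C\<close>.\<close>
  have div_p: "\<exists>e\<in>M \<inter> C. d = e [^] p" if d: "d \<in> M \<inter> C" for d
  proof -
    obtain i u where iu: "i < p ^ 1" "u \<in> M" "d = y [^] i \<otimes> u [^] (p ^ 1)" using cover[of d 1] d by blast
    have uc: "u \<in> carrier K" by (rule Mc[OF iu(2)])
    have "y [^] i = (inv u) [^] (p ^ 1) \<otimes> d"
      unfolding iu(3) using y uc by (simp add: m_lcomm nat_pow_inv)
    then have "y [^] i \<in> powers (p ^ 1) M <#> C"
      using d closed_subgroupD(6)[OF M iu(2)] by (metis IntD2 powersI set_mult_memI)
    then have "i = 0" using index[of i 1] iu(1) by (auto dest: dvd_imp_le)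
    then have du: "d = u [^] p" using iu uc by simp
    have "u \<in> C"
    proof (rule sep[OF uc])
      fix H assume H: "open_subgroup H" "C \<subseteq> H"
      obtain n where n: "powers (p ^ n) M \<subseteq> H" using small[OF H] by blast
      obtain k w where kw: "k < p ^ n" "w \<in> M" "u = y [^] k \<otimes> w [^] (p ^ n)"
        using cover[OF iu(2)] by blast
      have wc: "w \<in> carrier K" by (rule Mc[OF kw(2)])
      have "d = y [^] (k * p) \<otimes> w [^] (p ^ Suc n)"
        unfolding du kw(3) using y wc by (simp add: nat_pow_distrib nat_pow_pow mult.commute)
      then have "y [^] (k * p) = (inv w) [^] (p ^ Suc n) \<otimes> d"
        using y wc by (simp add: m_lcomm nat_pow_inv)
      then have "y [^] (k * p) \<in> powers (p ^ Suc n) M <#> C"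
        using d closed_subgroupD(6)[OF M kw(2)] by (metis IntD2 powersI set_mult_memI)
      then have "p ^ Suc n dvd k * p" by (rule index)
      then have "p ^ n dvd k" using p0 by simp
      then have "k = 0" using kw(1) by (auto dest: dvd_imp_le)
      then have "u = w [^] (p ^ n)" using kw(3) wc by simp
      then show "u \<in> H" using n powersI[OF kw(2)] by blast
    qed
    then show ?thesis using du iu(2) by blast
  qed
  have div_pa: "\<exists>e\<in>M \<inter> C. d = e [^] (p ^ a)" if d: "d \<in> M \<inter> C" for d a
  proof (induction a)
    case 0 then show ?case using d Mc by (intro bexI[of _ d]) auto
  next
    case (Suc a)
    then obtain e where e: "e \<in> M \<inter> C" "d = e [^] (p ^ a)" by blast
    obtain f where f: "f \<in> M \<inter> C" "e = f [^] p" using div_p[OF e(1)] by blast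
    have "d = f [^] (p ^ Suc a)" using e f Mc by (simp add: nat_pow_pow)
    then show ?case using f by blast
  qed
  have inside: "\<exists>a. powers (p ^ a) M \<subseteq> V" if V: "openin T V" "\<one> \<in> V" for V
  proof -
    obtain W where W: "openin T W" "\<one> \<in> W" "T closure_of W \<subseteq> V" using nbhd_closure[OF V] by blast
    obtain a l where l: "l \<in> carrier K" "\<And>i::int. l [^] i \<in> W"
      "\<And>j. \<exists>m\<in>monothetic y. l = y [^] (p ^ a) \<otimes> m [^] (p ^ j)"
      by (rule small_monothetic_element[OF y W(1,2) p]) (rule that, assumption, blast, blast)
    have "monothetic l \<subseteq> T closure_of W"
      unfolding monothetic_def using l(2) by (intro closure_of_mono) auto
    then have lV: "monothetic l \<subseteq> V" using W(3) by blast
    \<comment> \<open>\<open>l\<close> agrees with p^a y modulo every p^n M, which places the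
      difference in \<open>C\<close>. Dividing it by p^a inside M \<inter> C gives e, and y + e is
      again a generator by minimality, now with p^a (y + e) = l.\<close>
    define d where "d = inv (y [^] (p ^ a)) \<otimes> l"
    have lM: "l \<in> M"
    proof -
      obtain m where "m \<in> M" "l = y [^] (p ^ a) \<otimes> m [^] (p ^ 0)" using l(3)[of 0] My by blast
      then show ?thesis using closed_subgroupD(5)[OF M] closed_subgroupD(7)[OF M] yM by blast
    qed
    have dM: "d \<in> M" unfolding d_def using lM closed_subgroupD(5,6,7)[OF M] yM by blast
    have "d \<in> C"
    proof (rule sep)
      show "d \<in> carrier K" using dM Mc by blast
      fix H assume H: "open_subgroup H" "C \<subseteq> H"
      obtain n where n: "powers (p ^ n) M \<subseteq> H" using small[OF H] by blast
      obtain m where m: "m \<in> M" "l = y [^] (p ^ a) \<otimes> m [^] (p ^ n)" using l(3)[of n] My by auto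
      then have "d = m [^] (p ^ n)" unfolding d_def using y Mc by (simp add: m_assoc[symmetric])
      then show "d \<in> H" using n powersI[OF m(1)] by blast
    qed
    then obtain e where e: "e \<in> M \<inter> C" "d = e [^] (p ^ a)" using div_pa dM by blast
    have ec: "e \<in> carrier K" using e Mc by blast
    have z: "y \<otimes> e = x \<otimes> (c \<otimes> e)" unfolding y_def using x ec Cc[OF c(1)] by (simp add: m_assoc)
    have "c \<otimes> e \<in> C" "x \<otimes> (c \<otimes> e) \<in> M"
      using c(1) e(1) closed_subgroupD(5)[OF C] closed_subgroupD(5)[OF M] yM unfolding z[symmetric] by auto
    then have "monothetic (y \<otimes> e) = M" unfolding z by (rule min)
    moreover have "(y \<otimes> e) [^] (p ^ a) = l"
    proof -
      have "(y \<otimes> e) [^] (p ^ a) = y [^] (p ^ a) \<otimes> d" unfolding e(2) using y ec by (simp add: nat_pow_distrib)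
      also have "\<dots> = l" unfolding d_def using y l(1) by (simp add: m_assoc[symmetric])
      finally show ?thesis .
    qed
    ultimately have "powers (p ^ a) M \<subseteq> monothetic l"
      using powers_monothetic_subset[of "y \<otimes> e" "monothetic l" "p ^ a"] closed_subgroup_monothetic[OF l(1)] y ec by auto
    then show ?thesis using lV by blast
  qed
  \<comment> \<open>An element of M \<inter> C is divisible there by every p^a, so it lies in every
    neighbourhood of 0.\<close>
  have D1: "d = \<one>" if d: "d \<in> M \<inter> C" for d
  proof (rule ccontr)
    assume "d \<noteq> \<one>"
    then obtain V where V: "openin T V" "\<one> \<in> V" "d \<notin> V" using separate_one[of d] d Mc by blast
    obtain a where a: "powers (p ^ a) M \<subseteq> V" using inside[OF V(1,2)] by blast
    obtain e where "e \<in> M \<inter> C" "d = e [^] (p ^ a)" using div_pa[OF d] by blast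
    then show False using a V(3) by (auto simp: powers_def)
  qed
  obtain a where a: "powers (p ^ a) M \<subseteq> U" using inside[OF U] by blast
  show thesis
  proof (rule that)
    show N: "closed_subgroup (powers (p ^ a) M)" by (intro closed_subgroup_powers M)
    show "powers (p ^ a) M \<subseteq> U" by fact
    have "y [^] (p ^ a) \<noteq> \<one>" using ynt[of a] closed_subgroupD(4)[OF C] by metis
    then show "powers (p ^ a) M \<noteq> {\<one>}" using powersI[OF yM, of "p ^ a"] by blast
    show "C \<inter> powers (p ^ a) M = {\<one>}"
      using D1 subgroup_powers(2)[OF Ms] closed_subgroupD(4)[OF N] closed_subgroupD(4)[OF C] by blast
  qed
qed

section \<open>The component as an intersection of open subgroups\<close>

lemma closed_subgroup_component: "closed_subgroup (conn_comp K T)"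
proof -
  let ?C = "conn_comp K T"
  have Cc: "?C \<subseteq> carrier K"
    using connected_component_of_subset_topspace[of T \<one>] by (simp add: conn_comp_def topspace_eq)
  have C1: "\<one> \<in> ?C" by (simp add: conn_comp_def connected_component_of_refl topspace_eq)
  have quo: "a \<otimes> inv b \<in> ?C" if ab: "a \<in> ?C" "b \<in> ?C" for a b
  proof -
    have cont: "continuous_map T T (\<lambda>x. x \<otimes> inv b)"
      using ab Cc by (intro continuous_map_mult continuous_map_self continuous_map_const_carrier) auto
    have "connectedin T ((\<lambda>x. x \<otimes> inv b) ` ?C)"
      by (rule connectedin_continuous_map_image[OF cont])
         (simp add: conn_comp_def connectedin_connected_component_of)
    moreover have "\<one> \<in> (\<lambda>x. x \<otimes> inv b) ` ?C" using ab Cc by (intro image_eqI[of _ _ b]) auto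
    ultimately have "(\<lambda>x. x \<otimes> inv b) ` ?C \<subseteq> ?C"
      unfolding conn_comp_def by (intro connected_component_of_maximal) auto
    then show ?thesis using ab by blast
  qed
  have "subgroup ?C K"
  proof (rule subgroupI)
    show i: "inv a \<in> ?C" if "a \<in> ?C" for a using quo[OF C1 that] that Cc by auto
    show "a \<otimes> b \<in> ?C" if "a \<in> ?C" "b \<in> ?C" for a b
      using quo[OF that(1) i[OF that(2)]] that Cc by auto
  qed (use Cc C1 in auto)
  moreover have "closedin T ?C" unfolding conn_comp_def by (rule closedin_connected_component_of)
  ultimately show ?thesis by (simp add: closed_subgroup_def)
qed

lemma component_subset_open_subgroup:
  assumes "open_subgroup H"
  shows "conn_comp K T \<subseteq> H"
proof -
  have "closedin T H" "openin T H" "\<one> \<in> H"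
    using open_subgroupD[OF assms] closed_subgroupD(2,4) by auto
  then show ?thesis
    using connected_component_subset_quasi_component_of[of T \<one>]
    unfolding conn_comp_def by (auto simp: quasi_component_of)
qed

text \<open>Components of a compact Hausdorff space are quasi-components, so a clopen
  \<open>Q\<close> separates. The g with g + Q inside \<open>Q\<close> form an open set, because the
  others form the sum of two compact sets; requiring the same of -g gives an open subgroup inside
  \<open>Q\<close>.\<close>

lemma separate_component:
  assumes x: "x \<in> carrier K" "x \<notin> conn_comp K T"
  obtains H where "open_subgroup H" "x \<notin> H"
proof -
  have "connected_component_of_set T \<one> = quasi_component_of_set T \<one>"
    using quasi_eq_connected_component_of[of T \<one>] compact hausdorff compact_Hausdorff_imp_regular_space
      compact_imp_locally_compact_space
    by (metis compact_quasi_eq_connected_components_of connected_component_of_set quasi_component_of_set quasi_eq_connected_component_of_eq)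
  then have "\<not> quasi_component_of T \<one> x" using x(2) by (auto simp: conn_comp_def)
  then obtain Q where Q: "\<one> \<in> Q" "closedin T Q" "openin T Q" "x \<notin> Q"
    using x(1) by (auto simp: quasi_component_of topspace_eq)
  have Qc: "Q \<subseteq> carrier K" by (rule closedin_subset_carrier[OF Q(2)])
  define A where "A = {g \<in> carrier K. \<forall>q\<in>Q. g \<otimes> q \<in> Q}"
  have "A = carrier K - ((carrier K - Q) <#> (\<lambda>q. inv q) ` Q)"
  proof (intro Set.set_eqI iffI)
    fix g assume g: "g \<in> A"
    have "g \<notin> (carrier K - Q) <#> (\<lambda>q. inv q) ` Q"
    proof
      assume "g \<in> (carrier K - Q) <#> (\<lambda>q. inv q) ` Q"
      then obtain r q where r: "r \<in> carrier K" "r \<notin> Q" "q \<in> Q" "g = r \<otimes> inv q"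
        by (auto simp: set_mult_def)
      then have "g \<otimes> q = r" using Qc by (auto simp: m_assoc)
      then show False using g r by (auto simp: A_def)
    qed
    then show "g \<in> carrier K - ((carrier K - Q) <#> (\<lambda>q. inv q) ` Q)" using g by (simp add: A_def)
  next
    fix g assume g: "g \<in> carrier K - ((carrier K - Q) <#> (\<lambda>q. inv q) ` Q)"
    have "g \<otimes> q \<in> Q" if q: "q \<in> Q" for q
    proof (rule ccontr)
      assume "g \<otimes> q \<notin> Q"
      then have "(g \<otimes> q) \<otimes> inv q \<in> (carrier K - Q) <#> (\<lambda>q. inv q) ` Q"
        using g q Qc by (intro set_mult_memI) auto
      moreover have "(g \<otimes> q) \<otimes> inv q = g" using g q Qc by (auto simp: m_assoc)
      ultimately show False using g by simp
    qed
    then show "g \<in> A" using g by (simp add: A_def)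
  qed
  moreover have "closedin T ((carrier K - Q) <#> (\<lambda>q. inv q) ` Q)"
  proof (rule closedin_set_mult)
    show "closedin T (carrier K - Q)" using Q(3) closedin_carrier by blast
    show "closedin T ((\<lambda>q. inv q) ` Q)" by (rule closedin_image[OF continuous_inv Q(2)])
  qed
  ultimately have "openin T A" using openin_carrier by (simp add: openin_diff)
  then have "openin T (A \<inter> {g \<in> carrier K. inv g \<in> A})"
    using openin_preimage[OF continuous_inv] by blast
  moreover have "subgroup (A \<inter> {g \<in> carrier K. inv g \<in> A}) K"
  proof (rule subgroupI)
    have "\<one> \<in> A" using Qc by (auto simp: A_def)
    then show "A \<inter> {g \<in> carrier K. inv g \<in> A} \<noteq> {}" by (auto intro!: exI[of _ \<one>])
  next
    fix a b assume a: "a \<in> A \<inter> {g \<in> carrier K. inv g \<in> A}" and b: "b \<in> A \<inter> {g \<in> carrier K. inv g \<in> A}"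
    have prod: "u \<otimes> v \<in> A" if "u \<in> A" "v \<in> A" for u v
      using that Qc by (auto simp: A_def m_assoc subset_iff)
    show "a \<otimes> b \<in> A \<inter> {g \<in> carrier K. inv g \<in> A}"
      using prod[of a b] prod[of "inv a" "inv b"] a b by (auto simp: inv_mult)
  qed (auto simp: A_def)
  ultimately have "open_subgroup (A \<inter> {g \<in> carrier K. inv g \<in> A})" by (simp add: open_subgroup_def)
  moreover have "A \<subseteq> Q"
  proof
    fix g assume "g \<in> A"
    then have "g \<otimes> \<one> \<in> Q" "g \<in> carrier K" using Q(1) unfolding A_def by blast+
    then show "g \<in> Q" by simp
  qed
  ultimately show thesis using that Q(4) by blast
qed

lemma open_subgroup_Inter:
  assumes "finite \<G>" "\<And>H. H \<in> \<G> \<Longrightarrow> open_subgroup H"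
  shows "open_subgroup (carrier K \<inter> \<Inter>\<G>)"
  using assms
proof (induction \<G> rule: finite_induct)
  case empty
  then show ?case using subgroup_self openin_carrier by (simp add: open_subgroup_def)
next
  case (insert H \<G>)
  have "carrier K \<inter> \<Inter> (insert H \<G>) = H \<inter> (carrier K \<inter> \<Inter>\<G>)" by blast
  moreover have "open_subgroup H" "open_subgroup (carrier K \<inter> \<Inter>\<G>)" using insert by auto
  ultimately show ?case
    by (simp add: open_subgroup_def subgroups_Inter_pair openin_Int)
qed

text \<open>Otherwise the closed remainders H - U of the open subgroups have the finite intersection
  property. A common point would lie in every open subgroup and yet outside the component.\<close>

lemma open_subgroup_inside:
  assumes U: "openin T U" "conn_comp K T \<subseteq> U"
  shows "\<exists>H. open_subgroup H \<and> H \<subseteq> U"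
proof (rule ccontr)
  assume *: "\<nexists>H. open_subgroup H \<and> H \<subseteq> U"
  then have no: "H - U \<noteq> {}" if "open_subgroup H" for H using that by blast
  have "\<Inter> ((\<lambda>H. H - U) ` Collect open_subgroup) \<noteq> {}"
  proof (rule compact[unfolded compact_space_fip, rule_format], intro conjI ballI allI impI)
    fix S assume "S \<in> (\<lambda>H. H - U) ` Collect open_subgroup"
    then show "closedin T S"
      using U(1) open_subgroupD(1) closed_subgroupD(2) closedin_diff by (auto simp: image_iff)
  next
    fix \<F> assume F: "finite \<F> \<and> \<F> \<subseteq> (\<lambda>H. H - U) ` Collect open_subgroup"
    then obtain \<G> where G: "finite \<G>" "\<G> \<subseteq> Collect open_subgroup" "\<F> = (\<lambda>H. H - U) ` \<G>"
      by (meson finite_subset_image)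
    have "(carrier K \<inter> \<Inter>\<G>) - U \<noteq> {}"
      using G(2) by (intro no open_subgroup_Inter[OF G(1)]) auto
    then show "\<Inter>\<F> \<noteq> {}" unfolding G(3) by auto
  qed
  then obtain z where "z \<in> \<Inter> ((\<lambda>H. H - U) ` Collect open_subgroup)" by (auto simp only: ex_in_conv[symmetric])
  then have z: "z \<in> H - U" if "open_subgroup H" for H using that by blast
  have "open_subgroup (carrier K)" using subgroup_self openin_carrier by (simp add: open_subgroup_def)
  then have "z \<in> carrier K" "z \<notin> U" using z by auto
  then have "z \<notin> conn_comp K T" using U(2) by blast
  with \<open>z \<in> carrier K\<close> obtain H where "open_subgroup H" "z \<notin> H" by (rule separate_component)
  then show False using z by blast
qed

lemma open_subgroup_avoiding_finite:
  assumes "finite A" "A \<subseteq> carrier K" "A \<inter> conn_comp K T = {}"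
  obtains H where "open_subgroup H" "H \<inter> A = {}"
proof -
  have "closedin T A"
    using assms(1,2)
  proof (induction A rule: finite_induct)
    case (insert a A)
    then have "closedin T ({a} \<union> A)" by (intro closedin_Un closedin_singleton) auto
    then show ?case by simp
  qed simp
  then have "openin T (carrier K - A)" using openin_carrier by blast
  moreover have "conn_comp K T \<subseteq> carrier K - A"
    using assms(3) closed_subgroupD(3)[OF closed_subgroup_component] by blast
  ultimately obtain H where "open_subgroup H" "H \<subseteq> carrier K - A" using open_subgroup_inside by blast
  then show thesis by (intro that[of H]) auto
qed

end

section \<open>Divisibility of the component\<close>

text \<open>Tychonoff's theorem for characteristic functions, applied to the net of the
  \<open>h S\<close>. Properties that concern finitely many elements at a time, such as being a
  subgroup or having bounded index, pass from the \<open>h S\<close> to \<open>H\<close>.\<close>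

lemma limit_of_finite_approximations:
  fixes h :: "'a set \<Rightarrow> 'a set"
  obtains H where "\<And>Q. finite Q \<Longrightarrow> \<exists>S. finite S \<and> Q \<subseteq> S \<and> H \<inter> Q = h S \<inter> Q"
proof -
  define P where "P = product_topology (\<lambda>_::'a. discrete_topology (UNIV :: bool set)) UNIV"
  have P: "compact_space P" unfolding P_def
    by (rule compact_space_product_topology[THEN iffD2]) (simp add: compact_space_discrete_topology)
  have topP: "topspace P = UNIV" by (simp add: P_def)
  define E where "E Q = {(\<lambda>x. x \<in> h S) | S. finite S \<and> Q \<subseteq> S}" for Q
  have "\<Inter> ((\<lambda>Q. P closure_of (E Q)) ` Collect finite) \<noteq> {}"
  proof (rule P[unfolded compact_space_fip, rule_format], intro conjI ballI allI impI)
    fix A assume "A \<in> (\<lambda>Q. P closure_of (E Q)) ` Collect finite"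
    then show "closedin P A" by auto
  next
    fix \<F> assume "finite \<F> \<and> \<F> \<subseteq> (\<lambda>Q. P closure_of (E Q)) ` Collect finite"
    then obtain \<G> where G: "finite \<G>" "\<G> \<subseteq> Collect finite" "\<F> = (\<lambda>Q. P closure_of (E Q)) ` \<G>"
      by (meson finite_subset_image)
    have "(\<lambda>x. x \<in> h (\<Union>\<G>)) \<in> E Q" if "Q \<in> \<G>" for Q
      unfolding E_def using G that by (auto intro!: exI[of _ "\<Union>\<G>"])
    moreover have "E Q \<subseteq> P closure_of (E Q)" for Q by (simp add: closure_of_subset topP)
    ultimately have "(\<lambda>x. x \<in> h (\<Union>\<G>)) \<in> \<Inter>\<F>" unfolding G(3) by blast
    then show "\<Inter>\<F> \<noteq> {}" by blast
  qed
  then obtain f where "f \<in> \<Inter> ((\<lambda>Q. P closure_of (E Q)) ` Collect finite)" by (auto simp only: ex_in_conv[symmetric])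
  then have f: "f \<in> P closure_of (E Q)" if "finite Q" for Q using that by blast
  show thesis
  proof (rule that[of "{x. f x}"])
    fix Q :: "'a set" assume Q: "finite Q"
    define N where "N = {g \<in> topspace P. \<forall>x\<in>Q. g x = f x}"
    have "openin P N"
    proof -
      have "openin P {g \<in> topspace P. g x \<in> {f x}}" for x
        unfolding P_def by (rule openin_continuous_map_preimage[OF continuous_map_product_projection]) auto
      then have "openin P (topspace P \<inter> (\<Inter>x\<in>Q. {g \<in> topspace P. g x \<in> {f x}}))"
        using Q by (cases "Q = {}") (auto intro!: openin_Int openin_INT2)
      moreover have "topspace P \<inter> (\<Inter>x\<in>Q. {g \<in> topspace P. g x \<in> {f x}}) = N" by (auto simp: N_def)
      ultimately show ?thesis by simp
    qed
    moreover have "f \<in> N" by (simp add: N_def topP)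
    ultimately obtain g where g: "g \<in> E Q" "g \<in> N" using f[OF Q] by (auto simp: in_closure_of)
    then obtain S where S: "finite S" "Q \<subseteq> S" "g = (\<lambda>x. x \<in> h S)" by (auto simp: E_def)
    then have "{x. f x} \<inter> Q = h S \<inter> Q" using g(2) by (auto simp: N_def)
    then show "\<exists>S. finite S \<and> Q \<subseteq> S \<and> {x. f x} \<inter> Q = h S \<inter> Q" using S by blast
  qed
qed

context compact_abelian_group
begin

text \<open>A homomorphism \<open>\<phi>\<close> from Z^k sends unit vectors to the elements of
  \<open>S\<close>. A vector killed by Bogolyubov's forms is a + b - c - d up to multiples of p, and
  these multiples land in pC. Elements of \<open>S\<close> whose unit vectors have the same values
  under all forms differ by an element of \<open>H\<close>, which bounds the index independently of
  \<open>S\<close>.\<close>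

lemma finite_stage_subgroup:
  fixes p :: nat and F :: "'a set" and col :: "'a \<Rightarrow> 'a"
  assumes S: "finite S" "S \<subseteq> C" and C: "subgroup C K" and p: "p > 0"
    and F: "finite F" "range col \<subseteq> F"
    and col: "\<And>u v w z. \<lbrakk>u \<in> carrier K; v \<in> carrier K; w \<in> carrier K; z \<in> carrier K;
       col u = col v; col v = col w; col w = col z\<rbrakk> \<Longrightarrow> u \<otimes> v \<otimes> inv w \<otimes> inv z \<in> W"
  obtains H where "subgroup H K" "H \<subseteq> W <#> powers p C"
    "\<And>Z. \<lbrakk>Z \<subseteq> S; p ^ (2 * (card F)\<^sup>2) < card Z\<rbrakk> \<Longrightarrow> \<exists>x\<in>Z. \<exists>y\<in>Z. x \<noteq> y \<and> x \<otimes> inv y \<in> H"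
proof -
  define k where "k = card S"
  obtain g where g: "bij_betw g {..<k} S"
    using ex_bij_betw_nat_finite[OF S(1)] by (auto simp: atLeast0LessThan k_def)
  have Cc: "C \<subseteq> carrier K" using C by (rule subgroup.subset)
  have gC: "g i \<in> C" if "i < k" for i using g S(2) that by (auto simp: bij_betw_def)
  define \<phi> where "\<phi> v = finprod K (\<lambda>i. g i [^] (v i :: int)) {..<k}" for v
  have g0: "g i \<in> carrier K" if "i < k" for i using gC[OF that] Cc by blast
  have gc: "g i [^] (n::int) \<in> carrier K" if "i < k" for i n using g0[OF that] by simp
  have \<phi>c: "\<phi> v \<in> carrier K" for v unfolding \<phi>_def using gc by (intro finprod_closed) auto
  have \<phi>add: "\<phi> (\<lambda>i. u i + v i) = \<phi> u \<otimes> \<phi> v" for u v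
  proof -
    have "\<phi> (\<lambda>i. u i + v i) = finprod K (\<lambda>i. g i [^] u i \<otimes> g i [^] v i) {..<k}"
      unfolding \<phi>_def using g0 by (intro finprod_cong') (auto simp: int_pow_mult)
    also have "\<dots> = \<phi> u \<otimes> \<phi> v" unfolding \<phi>_def using gc by (intro finprod_multf) auto
    finally show ?thesis .
  qed
  have \<phi>diff: "\<phi> (\<lambda>i. u i - v i) = \<phi> u \<otimes> inv (\<phi> v)" for u v
  proof -
    have "\<phi> (\<lambda>i. u i - v i) \<otimes> \<phi> v = \<phi> u" unfolding \<phi>add[symmetric] by simp
    then show ?thesis using \<phi>c inv_solve_right by metis
  qed
  have \<phi>unit: "\<phi> (\<lambda>j. if j = i then 1 else 0) = g i" if i: "i < k" for i
  proof -
    have "\<phi> (\<lambda>j. if j = i then 1 else 0) = finprod K (\<lambda>j. if i = j then g j else \<one>) {..<k}"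
      unfolding \<phi>_def using g0 by (intro finprod_cong') auto
    also have "\<dots> = g i" using i g0 by (intro finprod_singleton) auto
    finally show ?thesis .
  qed
  have \<phi>p: "\<phi> r \<in> powers p C" if r: "\<And>i. i < k \<Longrightarrow> int p dvd r i" for r
    unfolding \<phi>_def
  proof (rule finprod_in_subgroup)
    show "subgroup (powers p C) K" by (rule subgroup_powers[OF C])
    fix i assume "i \<in> {..<k}"
    then obtain q where q: "r i = q * int p" using r[of i] by (auto simp: dvd_def mult.commute)
    have "g i [^] r i = (g i [^] q) [^] p"
      using gC[of i] Cc \<open>i \<in> {..<k}\<close> unfolding q by (metis int_pow_int int_pow_pow lessThan_iff subsetD)
    then show "g i [^] r i \<in> powers p C"
      using gC[of i] \<open>i \<in> {..<k}\<close> subgroup_int_pow[OF C] by (auto simp: powers_def)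
  qed simp
  have "range (\<lambda>v. col (\<phi> v)) \<subseteq> F" using F(2) by blast
  then obtain L where L: "finite L" "card L \<le> 2 * (card F)\<^sup>2"
    "\<And>v. (\<And>y. y \<in> L \<Longrightarrow> int p dvd (\<Sum>i<k. y i * v i)) \<Longrightarrow>
       \<exists>a b c d. col (\<phi> a) = col (\<phi> b) \<and> col (\<phi> b) = col (\<phi> c) \<and> col (\<phi> c) = col (\<phi> d) \<and>
         (\<forall>i<k. int p dvd a i + b i - c i - d i - v i)"
    by (rule bogolyubov_torsion[OF p F(1)]) (rule that, assumption, assumption, blast)
  define A where "A = {v. \<forall>y\<in>L. int p dvd (\<Sum>i<k. y i * v i)}"
  define H where "H = \<phi> ` A"
  have A0: "(\<lambda>_. 0) \<in> A" by (simp add: A_def)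
  have Adiff: "(\<lambda>i. u i - v i) \<in> A" if "u \<in> A" "v \<in> A" for u v
    using that by (auto simp: A_def right_diff_distrib sum_subtractf)
  have H1: "\<one> \<in> H"
  proof -
    have "\<phi> (\<lambda>_. 0 - 0) = \<one>" using \<phi>diff[of "\<lambda>_. 0" "\<lambda>_. 0"] \<phi>c by simp
    then show ?thesis using A0 by (auto simp: H_def intro!: image_eqI[of _ _ "\<lambda>_. 0"])
  qed
  have Hdiff: "x \<otimes> inv y \<in> H" if "x \<in> H" "y \<in> H" for x y
  proof -
    obtain u v where "u \<in> A" "x = \<phi> u" "v \<in> A" "y = \<phi> v" using \<open>x \<in> H\<close> \<open>y \<in> H\<close> by (auto simp: H_def)
    then have "x \<otimes> inv y = \<phi> (\<lambda>i. u i - v i)" "(\<lambda>i. u i - v i) \<in> A" using Adiff \<phi>diff by simp_all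
    then show ?thesis unfolding H_def by (rule image_eqI)
  qed
  have Hc: "H \<subseteq> carrier K" using \<phi>c by (auto simp: H_def)
  show thesis
  proof (rule that)
    show "subgroup H K"
    proof (rule subgroupI)
      show i: "inv a \<in> H" if "a \<in> H" for a using Hdiff[OF H1 that] that Hc by auto
      show "a \<otimes> b \<in> H" if "a \<in> H" "b \<in> H" for a b
        using Hdiff[OF that(1) i[OF that(2)]] that Hc by auto
    qed (use Hc H1 in auto)
    show "H \<subseteq> W <#> powers p C"
    proof
      fix x assume "x \<in> H"
      then obtain v where v: "v \<in> A" "x = \<phi> v" by (auto simp: H_def)
      obtain a b c d where *: "col (\<phi> a) = col (\<phi> b)" "col (\<phi> b) = col (\<phi> c)" "col (\<phi> c) = col (\<phi> d)"
         "\<forall>i<k. int p dvd a i + b i - c i - d i - v i"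
        using L(3)[of v] v(1) by (auto simp: A_def)
      define r where "r = (\<lambda>i. v i - (a i + b i - c i - d i))"
      have "int p dvd r i" if "i < k" for i
      proof -
        have "r i = - (a i + b i - c i - d i - v i)" by (simp add: r_def)
        then show ?thesis using *(4) that by (metis dvd_minus_iff)
      qed
      then have "\<phi> r \<in> powers p C" by (rule \<phi>p)
      moreover have "\<phi> v = (\<phi> a \<otimes> \<phi> b \<otimes> inv (\<phi> c) \<otimes> inv (\<phi> d)) \<otimes> \<phi> r"
      proof -
        have "v = (\<lambda>i. (a i + b i - c i - d i) + r i)" by (simp add: r_def)
        then have "\<phi> v = \<phi> (\<lambda>i. (a i + b i - c i - d i) + r i)" by simp
        then show ?thesis by (simp only: \<phi>add \<phi>diff)
      qed
      ultimately show "x \<in> W <#> powers p C"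
        unfolding v(2) using col[OF \<phi>c \<phi>c \<phi>c \<phi>c *(1-3)] by (auto intro: set_mult_memI)
    qed
    fix Z assume Z: "Z \<subseteq> S" "p ^ (2 * (card F)\<^sup>2) < card Z"
    define idx where "idx = inv_into {..<k} g"
    have idx: "idx x < k" "g (idx x) = x" if "x \<in> Z" for x
    proof -
      have "x \<in> g ` {..<k}" using that Z(1) g by (auto simp: bij_betw_def)
      then show "idx x < k" "g (idx x) = x"
        unfolding idx_def using inv_into_into[of x g "{..<k}"] f_inv_into_f[of x g "{..<k}"] by auto
    qed
    \<comment> \<open>The values modulo p of all forms on the unit vector of \<open>x\<close>; there
      are at most p^|L| such tuples.\<close>
    define f where "f x = (\<lambda>y\<in>L. y (idx x) mod int p)" for x
    have "f ` Z \<subseteq> PiE L (\<lambda>_. {0..<int p})" using p by (auto simp: f_def)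
    moreover have finP: "finite (PiE L (\<lambda>_. {0..<int p}))" using L(1) by (intro finite_PiE) auto
    ultimately have "card (f ` Z) \<le> card (PiE L (\<lambda>_. {0..<int p}))" by (simp add: card_mono)
    also have "\<dots> = p ^ card L" using L(1) by (simp add: card_PiE)
    also have "\<dots> \<le> p ^ (2 * (card F)\<^sup>2)" using L(2) p by (intro power_increasing) auto
    also have "\<dots> < card Z" by (rule Z(2))
    finally have "\<not> inj_on f Z" by (metis card_image nat_neq_iff)
    then obtain x y where xy: "x \<in> Z" "y \<in> Z" "x \<noteq> y" "f x = f y" by (auto simp: inj_on_def)
    define v where "v j = (if j = idx x then 1 else 0) - (if j = idx y then 1 else 0 :: int)" for j
    have "v \<in> A"
      unfolding A_def
    proof (intro CollectI ballI)
      fix l assume l: "l \<in> L"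
      have "(\<Sum>i<k. l i * v i) = (\<Sum>i<k. if i = idx x then l i else 0) - (\<Sum>i<k. if i = idx y then l i else 0)"
        unfolding v_def sum_subtractf[symmetric] by (intro sum.cong) auto
      also have "\<dots> = l (idx x) - l (idx y)" using idx xy by simp
      finally have e: "(\<Sum>i<k. l i * v i) = l (idx x) - l (idx y)" .
      have "l (idx x) mod int p = l (idx y) mod int p"
        using fun_cong[OF xy(4), of l] l by (simp add: f_def)
      then show "int p dvd (\<Sum>i<k. l i * v i)" unfolding e by (simp add: mod_eq_dvd_iff)
    qed
    moreover have "\<phi> v = x \<otimes> inv y"
    proof -
      have "\<phi> v = \<phi> (\<lambda>j. (if j = idx x then 1 else 0) - (if j = idx y then 1 else 0))"
        by (simp add: v_def[abs_def])
      then show ?thesis unfolding \<phi>diff using idx xy \<phi>unit by simp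
    qed
    ultimately have "x \<otimes> inv y \<in> H" unfolding H_def by (metis image_eqI)
    then show "\<exists>x\<in>Z. \<exists>y\<in>Z. x \<noteq> y \<and> x \<otimes> inv y \<in> H" using xy by blast
  qed
qed

text \<open>The cosets other than \<open>B\<close> make up a closed set, being finitely many, and
  together with \<open>B\<close> they would disconnect \<open>C\<close>.\<close>

lemma connected_closed_finite_index:
  assumes C: "closed_subgroup C" "connectedin T C" and B: "closed_subgroup B" "B \<subseteq> C"
    and Z: "finite Z" "Z \<subseteq> C" "\<And>x. x \<in> C \<Longrightarrow> \<exists>z\<in>Z. x \<otimes> inv z \<in> B"
  shows "B = C"
proof (rule ccontr)
  assume ne: "B \<noteq> C"
  define E where "E = (\<Union>z\<in>Z - B. {x \<in> carrier K. x \<otimes> inv z \<in> B})"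
  have Cc: "C \<subseteq> carrier K" using closed_subgroupD(3)[OF C(1)] .
  have "closedin T E"
    unfolding E_def using Z(1,2) Cc closed_subgroupD(2)[OF B(1)]
    by (intro closedin_Union) (auto intro!: closedin_translate)
  moreover have "closedin T B" by (rule closed_subgroupD(2)[OF B(1)])
  moreover have cov: "C \<subseteq> B \<union> E"
  proof
    fix x assume x: "x \<in> C"
    then obtain z where z: "z \<in> Z" "x \<otimes> inv z \<in> B" using Z(3) by blast
    show "x \<in> B \<union> E"
    proof (cases "z \<in> B")
      case True
      then have "(x \<otimes> inv z) \<otimes> z \<in> B" using z(2) closed_subgroupD(5)[OF B(1)] by blast
      moreover have "x \<in> carrier K" "z \<in> carrier K" using x z(1) Z(2) Cc by blast+
      then have "(x \<otimes> inv z) \<otimes> z = x" by (simp add: m_assoc)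
      ultimately show ?thesis by simp
    next
      case False then show ?thesis using z x Cc by (auto simp: E_def)
    qed
  qed
  moreover have disj: "B \<inter> E \<inter> C = {}"
  proof -
    have False if "x \<in> B" "x \<in> E" for x
    proof -
      obtain z where z: "z \<in> Z" "z \<notin> B" "x \<in> carrier K" "x \<otimes> inv z \<in> B" using \<open>x \<in> E\<close> by (auto simp: E_def)
      then have zc: "z \<in> carrier K" using Z(2) Cc by blast
      have "inv (x \<otimes> inv z) \<otimes> x \<in> B" using z \<open>x \<in> B\<close> closed_subgroupD(5,6)[OF B(1)] by blast
      moreover have "inv (x \<otimes> inv z) \<otimes> x = z" using z(3) zc by (simp add: inv_mult_group m_assoc)
      ultimately show False using z(2) by simp
    qed
    then show ?thesis by blast
  qed
  moreover have "B \<inter> C \<noteq> {}" using closed_subgroupD(4)[OF B(1)] closed_subgroupD(4)[OF C(1)] by blast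
  moreover have "E \<inter> C \<noteq> {}" using ne B(2) cov by blast
  ultimately show False using C(2) unfolding connectedin_closedin by blast
qed

text \<open>If \<open>c\<close> is not in pC, it stays outside cl W + pC for some neighbourhood W of
  0. The finite stages have as limit a subgroup of finite index in the component that lies in W +
  pC. By connectedness its closure is the whole component, so \<open>c\<close> would be in cl W + pC
  after all.\<close>

lemma component_divisible:
  fixes p :: nat
  assumes p: "p > 0" and c: "c \<in> conn_comp K T"
  shows "\<exists>e\<in>conn_comp K T. c = e [^] p"
proof (rule ccontr)
  let ?C = "conn_comp K T"
  assume no: "\<not> ?thesis"
  let ?P = "powers p ?C"
  have C: "closed_subgroup ?C" by (rule closed_subgroup_component)
  have Cs: "subgroup ?C K" by (rule closed_subgroupD(1)[OF C])
  have Cc: "?C \<subseteq> carrier K" by (rule closed_subgroupD(3)[OF C])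
  have P: "closed_subgroup ?P" by (rule closed_subgroup_powers[OF C])
  have cP: "c \<notin> ?P" using no by (auto simp: powers_def)
  have cc: "c \<in> carrier K" using c Cc by blast
  define U where "U = {u \<in> carrier K. c \<otimes> inv u \<in> carrier K - ?P}"
  have U: "openin T U" unfolding U_def
    using cc closed_subgroupD(2)[OF P] openin_carrier
    by (intro openin_preimage continuous_map_mult continuous_map_const_carrier continuous_inv) auto
  have "\<one> \<in> U" using cP cc by (simp add: U_def)
  then obtain W where W: "openin T W" "\<one> \<in> W" "T closure_of W \<subseteq> U" using nbhd_closure[OF U] by blast
  have cD: "c \<notin> T closure_of W <#> ?P"
  proof
    assume "c \<in> T closure_of W <#> ?P"
    then obtain u q where uq: "u \<in> U" "q \<in> ?P" "c = u \<otimes> q" using W(3) by (auto simp: set_mult_def)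
    then have "u \<in> carrier K" "q \<in> carrier K" using closed_subgroupD(3)[OF P] by (auto simp: U_def)
    then have "c \<otimes> inv u = q" unfolding uq(3) by (simp add: m_comm[of u q] m_assoc)
    then show False using uq by (auto simp: U_def)
  qed
  obtain F and col :: "'a \<Rightarrow> 'a" where F: "finite F" "range col \<subseteq> F"
    and col: "\<And>u v w z. \<lbrakk>u \<in> carrier K; v \<in> carrier K; w \<in> carrier K; z \<in> carrier K;
       col u = col v; col v = col w; col w = col z\<rbrakk> \<Longrightarrow> u \<otimes> v \<otimes> inv w \<otimes> inv z \<in> W"
    using nbhd_colouring[OF W(1,2)] by blast
  \<comment> \<open>The index bound depends on \<open>p\<close> and the number of colours but not on
    the finite set, which is what lets it survive in the limit.\<close>
  define N where "N = p ^ (2 * (card F)\<^sup>2)"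
  have "\<exists>H. finite S \<longrightarrow> subgroup H K \<and> H \<subseteq> W <#> ?P \<and>
      (\<forall>Z. Z \<subseteq> S \<inter> ?C \<longrightarrow> N < card Z \<longrightarrow> (\<exists>x\<in>Z. \<exists>y\<in>Z. x \<noteq> y \<and> x \<otimes> inv y \<in> H))" for S
  proof (cases "finite S")
    case True
    then have fS: "finite (S \<inter> ?C)" by simp
    obtain H where "subgroup H K" "H \<subseteq> W <#> ?P"
      "\<And>Z. \<lbrakk>Z \<subseteq> S \<inter> ?C; p ^ (2 * (card F)\<^sup>2) < card Z\<rbrakk> \<Longrightarrow> \<exists>x\<in>Z. \<exists>y\<in>Z. x \<noteq> y \<and> x \<otimes> inv y \<in> H"
      by (rule finite_stage_subgroup[OF fS Int_lower2 Cs p F col]) (assumption+, rule that, assumption, assumption, blast)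
    then show ?thesis unfolding N_def by blast
  qed simp
  then obtain h where h: "\<And>S. finite S \<Longrightarrow> subgroup (h S) K" "\<And>S. finite S \<Longrightarrow> h S \<subseteq> W <#> ?P"
    "\<And>S Z. finite S \<Longrightarrow> Z \<subseteq> S \<inter> ?C \<Longrightarrow> N < card Z \<Longrightarrow> \<exists>x\<in>Z. \<exists>y\<in>Z. x \<noteq> y \<and> x \<otimes> inv y \<in> h S"
    by metis
  obtain H where H: "\<And>Q. finite Q \<Longrightarrow> \<exists>S. finite S \<and> Q \<subseteq> S \<and> H \<inter> Q = h S \<inter> Q"
    using limit_of_finite_approximations[of h] by blast
  define H0 where "H0 = H \<inter> ?C"
  have H0diff: "x \<otimes> inv y \<in> H0" if xy: "x \<in> H0" "y \<in> H0" for x y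
  proof -
    let ?Q = "{x, y, x \<otimes> inv y}"
    obtain S where S: "finite S" "?Q \<subseteq> S" "H \<inter> ?Q = h S \<inter> ?Q" using H[of ?Q] by blast
    have "x \<in> h S" "y \<in> h S" using S(3) xy by (auto simp: H0_def)
    then have "x \<otimes> inv y \<in> h S" using h(1)[OF S(1)] by (simp add: subgroup_def)
    then have "x \<otimes> inv y \<in> H" using S(3) by blast
    moreover have "x \<otimes> inv y \<in> ?C" using xy Cs by (simp add: H0_def subgroup_def)
    ultimately show ?thesis by (simp add: H0_def)
  qed
  have H01: "\<one> \<in> H0"
  proof -
    obtain S where S: "finite S" "H \<inter> {\<one>} = h S \<inter> {\<one>}" using H[of "{\<one>}"] by blast
    then show ?thesis using subgroup.one_closed[OF h(1)[OF S(1)]] closed_subgroupD(4)[OF C] by (auto simp: H0_def)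
  qed
  have H0c: "H0 \<subseteq> carrier K" using Cc by (auto simp: H0_def)
  have H0s: "subgroup H0 K"
  proof (rule subgroupI)
    show i: "inv a \<in> H0" if "a \<in> H0" for a using H0diff[OF H01 that] that H0c by auto
    show "a \<otimes> b \<in> H0" if "a \<in> H0" "b \<in> H0" for a b
      using H0diff[OF that(1) i[OF that(2)]] that H0c by auto
  qed (use H0c H01 in auto)
  have H0W: "H0 \<subseteq> W <#> ?P"
  proof
    fix x assume x: "x \<in> H0"
    obtain S where S: "finite S" "H \<inter> {x} = h S \<inter> {x}" using H[of "{x}"] by blast
    then have "x \<in> h S" using x by (auto simp: H0_def)
    then show "x \<in> W <#> ?P" using h(2)[OF S(1)] by blast
  qed
  have index: "card Z \<le> N" if Z: "finite Z" "Z \<subseteq> ?C" "\<And>x y. x \<in> Z \<Longrightarrow> y \<in> Z \<Longrightarrow> x \<noteq> y \<Longrightarrow> x \<otimes> inv y \<notin> H0" for Z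
  proof (rule ccontr)
    assume "\<not> card Z \<le> N"
    let ?Q = "Z \<union> (\<lambda>(x, y). x \<otimes> inv y) ` (Z \<times> Z)"
    have "finite ?Q" using Z(1) by simp
    then obtain S where S: "finite S" "?Q \<subseteq> S" "H \<inter> ?Q = h S \<inter> ?Q" using H[of ?Q] by blast
    obtain x y where xy: "x \<in> Z" "y \<in> Z" "x \<noteq> y" "x \<otimes> inv y \<in> h S"
      using h(3)[OF S(1), of Z] S(2) Z(2) \<open>\<not> card Z \<le> N\<close> by auto
    have "x \<otimes> inv y \<in> ?Q" using xy by auto
    then have "x \<otimes> inv y \<in> H" using S(3) xy(4) by blast
    moreover have "x \<otimes> inv y \<in> ?C"
      using xy Z(2) subgroup.m_closed[OF Cs] subgroup.m_inv_closed[OF Cs] by blast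
    ultimately show False using Z(3)[OF xy(1-3)] by (simp add: H0_def)
  qed
  define good where "good Z \<longleftrightarrow> finite Z \<and> Z \<subseteq> ?C \<and> (\<forall>x\<in>Z. \<forall>y\<in>Z. x \<noteq> y \<longrightarrow> x \<otimes> inv y \<notin> H0)" for Z
  have "good {}" by (simp add: good_def)
  moreover have "\<forall>Z. good Z \<longrightarrow> card Z < Suc N" using index by (auto simp: good_def less_Suc_eq_le)
  \<comment> \<open>A largest set of pairwise incongruent elements exists by the bound, and
    maximality makes it a set of coset representatives.\<close>
  ultimately obtain Z where Z: "good Z" "\<And>Z'. good Z' \<Longrightarrow> card Z' \<le> card Z"
    using ex_has_greatest_nat[of good "{}" card "Suc N"] by blast
  have cover: "\<exists>z\<in>Z. x \<otimes> inv z \<in> H0" if x: "x \<in> ?C" for x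
  proof (rule ccontr)
    assume no: "\<not> ?thesis"
    have xc: "x \<in> carrier K" using x Cc by blast
    have "x \<notin> Z" using no H01 xc by (metis r_inv)
    have "z \<otimes> inv x \<notin> H0" if z: "z \<in> Z" for z
    proof
      assume "z \<otimes> inv x \<in> H0"
      then have "inv (z \<otimes> inv x) \<in> H0" using H0s by (simp add: subgroup_def)
      moreover have "z \<in> carrier K" using z Z(1) Cc by (auto simp: good_def)
      ultimately have "x \<otimes> inv z \<in> H0" using xc by (simp add: inv_mult_group)
      then show False using no z by blast
    qed
    then have "good (insert x Z)" using Z(1) x no by (auto simp: good_def)
    then have "card (insert x Z) \<le> card Z" by (rule Z(2))
    then show False using \<open>x \<notin> Z\<close> Z(1) by (simp add: good_def)
  qed
  let ?B = "T closure_of H0"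
  have H0B: "H0 \<subseteq> ?B" using H0c by (simp add: closure_of_subset topspace_eq)
  have "?B = ?C"
  proof (rule connected_closed_finite_index[OF C])
    show "connectedin T ?C" by (simp add: conn_comp_def connectedin_connected_component_of)
    show "closed_subgroup ?B" by (rule subgroup_closure[OF H0s])
    show "?B \<subseteq> ?C" using closed_subgroupD(2)[OF C] by (intro closure_of_minimal) (auto simp: H0_def)
    show "finite Z" "Z \<subseteq> ?C" using Z(1) by (auto simp: good_def)
    show "\<exists>z\<in>Z. x \<otimes> inv z \<in> ?B" if "x \<in> ?C" for x using cover[OF that] H0B by blast
  qed
  moreover have "?B \<subseteq> T closure_of W <#> ?P"
  proof (rule closure_of_minimal)
    show "closedin T (T closure_of W <#> ?P)" by (intro closedin_set_mult closed_subgroupD(2)[OF P]) simp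
    have "W <#> ?P \<subseteq> T closure_of W <#> ?P"
      using W(1) by (intro mono_set_mult order_refl closure_of_subset openin_subset)
    then show "H0 \<subseteq> T closure_of W <#> ?P" using H0W by blast
  qed
  ultimately show False using c cD by blast
qed

section \<open>Topological p-torsion and subgroups of finite index\<close>

definition topologically_torsion :: "nat \<Rightarrow> 'a \<Rightarrow> bool" where
  "topologically_torsion p z \<longleftrightarrow> z \<in> carrier K \<and> (\<forall>H. open_subgroup H \<longrightarrow> (\<exists>n. z [^] (p ^ n) \<in> H))"

definition finite_index :: "'a set \<Rightarrow> bool" where
  "finite_index H \<longleftrightarrow> (\<exists>F. finite F \<and> F \<subseteq> carrier K \<and> (\<forall>x\<in>carrier K. \<exists>f\<in>F. x \<otimes> inv f \<in> H))"

lemma finite_index_mono: "finite_index A \<Longrightarrow> A \<subseteq> B \<Longrightarrow> finite_index B"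
  unfolding finite_index_def by (meson subsetD)

lemma finite_index_open_subgroup:
  assumes "open_subgroup H"
  shows "finite_index H"
proof -
  have "openin T H" "\<one> \<in> H" using open_subgroupD[OF assms] closed_subgroupD(4) by auto
  then show ?thesis unfolding finite_index_def using finite_cover[of H] by metis
qed

lemma open_subgroup_finite_index:
  assumes H: "closed_subgroup H" and fin: "finite_index H"
  shows "open_subgroup H"
proof -
  obtain F where F: "finite F" "F \<subseteq> carrier K" "\<And>x. x \<in> carrier K \<Longrightarrow> \<exists>f\<in>F. x \<otimes> inv f \<in> H"
    using fin unfolding finite_index_def by blast
  define E where "E = (\<Union>f\<in>F - H. {x \<in> carrier K. x \<otimes> inv f \<in> H})"
  have "closedin T E"
    unfolding E_def using F(1,2) closed_subgroupD(2)[OF H]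
    by (intro closedin_Union) (auto intro!: closedin_translate)
  moreover have "carrier K - E = H"
  proof (intro equalityI subsetI)
    fix x assume x: "x \<in> carrier K - E"
    then obtain f where f: "f \<in> F" "x \<otimes> inv f \<in> H" using F(3) by blast
    then have "f \<in> H" using x by (auto simp: E_def)
    then have "(x \<otimes> inv f) \<otimes> f \<in> H" using f(2) closed_subgroupD(5)[OF H] by blast
    moreover have "f \<in> carrier K" "x \<in> carrier K" using f(1) F(2) x by blast+
    then have "(x \<otimes> inv f) \<otimes> f = x" by (simp add: m_assoc)
    ultimately show "x \<in> H" by simp
  next
    fix x assume x: "x \<in> H"
    then have xc: "x \<in> carrier K" using closed_subgroupD(3)[OF H] by blast
    have "x \<notin> E"
    proof
      assume "x \<in> E"
      then obtain f where f: "f \<in> F" "f \<notin> H" "x \<otimes> inv f \<in> H" by (auto simp: E_def)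
      then have fc: "f \<in> carrier K" using F(2) by blast
      have "inv (x \<otimes> inv f) \<otimes> x \<in> H" using f(3) x closed_subgroupD(5,6)[OF H] by blast
      moreover have "inv (x \<otimes> inv f) \<otimes> x = f" using xc fc by (simp add: inv_mult_group m_assoc)
      ultimately show False using f(2) by simp
    qed
    then show "x \<in> carrier K - E" using xc by blast
  qed
  ultimately have "openin T H" using openin_carrier openin_diff by metis
  then show ?thesis using closed_subgroupD(1)[OF H] by (simp add: open_subgroup_def)
qed

lemma finite_index_order:
  assumes H: "subgroup H K" and fin: "finite_index H" and x: "x \<in> carrier K"
  obtains n :: nat where "n > 0" "x [^] n \<in> H"
proof -
  obtain F where F: "finite F" "F \<subseteq> carrier K" "\<And>x. x \<in> carrier K \<Longrightarrow> \<exists>f\<in>F. x \<otimes> inv f \<in> H"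
    using fin unfolding finite_index_def by blast
  have "\<forall>n::nat. \<exists>f. f \<in> F \<and> x [^] n \<otimes> inv f \<in> H" using F(3) x by blast
  then obtain c where c: "\<And>n::nat. c n \<in> F \<and> x [^] n \<otimes> inv (c n) \<in> H" by metis
  have "\<not> inj c"
  proof
    assume "inj c"
    then have "infinite (range c)" by (rule range_inj_infinite)
    moreover have "range c \<subseteq> F" using c by blast
    ultimately show False using F(1) finite_subset by blast
  qed
  then obtain i j where "c i = c j" "i \<noteq> j" by (auto simp: inj_on_def)
  then obtain i j where ij: "c i = c j" "i < j" by (metis linorder_neqE_nat)
  have cc: "c j \<in> carrier K" using c F(2) by blast
  have "inv (x [^] i \<otimes> inv (c j)) \<otimes> (x [^] j \<otimes> inv (c j)) \<in> H"
    using c[of i] c[of j] ij(1) subgroup.m_closed[OF H] subgroup.m_inv_closed[OF H] by simp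
  also have "x [^] j = x [^] i \<otimes> x [^] (j - i)" using x ij(2) by (simp add: nat_pow_mult)
  also have "inv (x [^] i \<otimes> inv (c j)) \<otimes> (x [^] i \<otimes> x [^] (j - i) \<otimes> inv (c j)) = x [^] (j - i)"
  proof -
    define u where "u = x [^] i \<otimes> inv (c j)"
    have u: "u \<in> carrier K" using x cc by (simp add: u_def)
    have "x [^] i \<otimes> x [^] (j - i) \<otimes> inv (c j) = u \<otimes> x [^] (j - i)"
      unfolding u_def using x cc by (simp add: m_ac)
    then show ?thesis unfolding u_def[symmetric] using x u by (simp add: m_assoc[symmetric])
  qed
  finally show thesis using that[of "j - i"] ij(2) by simp
qed

text \<open>An analogue of the p-primary part. The exponent e_j m_j is divisible by every number up
  to j prime to p, which removes the part of order prime to p in each finite quotient once j is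
  large. It is also 1 modulo p, so nothing changes modulo a closed subgroup that contains p
  x.\<close>

lemma topologically_torsion_part:
  fixes p :: nat
  assumes x: "x \<in> carrier K" and p: "Factorial_Ring.prime p"
  obtains z where "topologically_torsion p z"
    "\<And>H. closed_subgroup H \<Longrightarrow> x \<in> H \<Longrightarrow> z \<in> H"
    "\<And>H. closed_subgroup H \<Longrightarrow> x [^] p \<in> H \<Longrightarrow> x \<otimes> inv z \<in> H"
proof -
  define m where "m j = (\<Prod>t\<in>{t\<in>{1..j}. \<not> p dvd t}. int t)" for j :: nat
  have "coprime (m j) (int p)" for j
  proof -
    have "coprime (int t) (int p)" if "\<not> p dvd t" for t
      using prime_imp_coprime[OF p that] by (simp add: coprime_commute)
    then show ?thesis unfolding m_def by (intro prod_coprime_left) auto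
  qed
  then have "\<exists>e w. e * m j + w * int p = 1" for j
    using bezout_int[of "m j" "int p"] by (metis coprime_imp_gcd_eq_1)
  then obtain e w where ew: "\<And>j. e j * m j + w j * int p = 1" by metis
  define s where "s j = x [^] (e j * m j)" for j
  obtain z where z: "z \<in> carrier K"
    "\<And>A. \<lbrakk>closedin T A; eventually (\<lambda>j. s j \<in> A) sequentially\<rbrakk> \<Longrightarrow> z \<in> A"
    by (rule cluster_point[of s]) (use x in \<open>auto simp: s_def\<close>)
  show thesis
  proof (rule that)
    fix H assume H: "closed_subgroup H" "x \<in> H"
    show "z \<in> H"
      by (rule z(2)[OF closed_subgroupD(2)[OF H(1)]]) (simp add: s_def closed_subgroupD(8)[OF H])
  next
    fix H assume H: "closed_subgroup H" "x [^] p \<in> H"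
    have "z \<in> {u \<in> carrier K. x \<otimes> inv u \<in> H}"
    proof (rule z(2))
      show "closedin T {u \<in> carrier K. x \<otimes> inv u \<in> H}"
        using x closed_subgroupD(2)[OF H(1)]
        by (intro closedin_preimage continuous_map_mult continuous_map_const_carrier continuous_inv)
      have "x \<otimes> inv (s j) = (x [^] p) [^] w j" for j
      proof -
        have "x \<otimes> inv (s j) = x [^] (1 - e j * m j)"
          unfolding s_def using x int_pow_diff[OF x, of 1 "e j * m j"] by simp
        also have "1 - e j * m j = int p * w j" using ew[of j] by (simp add: algebra_simps)
        finally show ?thesis using x by (simp only: int_pow_pow[symmetric] int_pow_int)
      qed
      then have "s j \<in> {u \<in> carrier K. x \<otimes> inv u \<in> H}" for j
        using closed_subgroupD(8)[OF H] x by (simp add: s_def)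
      then show "eventually (\<lambda>j. s j \<in> {u \<in> carrier K. x \<otimes> inv u \<in> H}) sequentially" by simp
    qed
    then show "x \<otimes> inv z \<in> H" by simp
  next
    show "topologically_torsion p z"
      unfolding topologically_torsion_def
    proof (intro conjI allI impI z(1))
      fix H assume H: "open_subgroup H"
      have cH: "closed_subgroup H" by (rule open_subgroupD(1)[OF H])
      obtain n :: nat where n: "n > 0" "x [^] n \<in> H"
        using finite_index_order[OF closed_subgroupD(1)[OF cH] finite_index_open_subgroup[OF H] x] by blast
      obtain a t where at: "n = p ^ a * t" "\<not> p dvd t"
        using multiplicity_decompose'[of n p] n(1) p by (metis not_prime_unit not_gr_zero)
      have "z \<in> {u \<in> carrier K. u [^] (p ^ a) \<in> H}"
      proof (rule z(2))
        show "closedin T {u \<in> carrier K. u [^] (p ^ a) \<in> H}"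
          using closed_subgroupD(2)[OF cH] by (intro closedin_preimage continuous_map_nat_pow)
        show "eventually (\<lambda>j. s j \<in> {u \<in> carrier K. u [^] (p ^ a) \<in> H}) sequentially"
          unfolding eventually_sequentially
        proof (intro exI[of _ t] allI impI)
          fix j assume "t \<le> j"
          then have "int t dvd m j"
            unfolding m_def using at n(1) by (intro dvd_prodI) (auto simp: Suc_le_eq intro: Nat.gr0I)
          then obtain q where q: "m j = int t * q" ..
          have "s j [^] (p ^ a) = x [^] (e j * m j * int (p ^ a))"
            unfolding s_def using x by (simp only: int_pow_pow[symmetric] int_pow_int)
          also have "e j * m j * int (p ^ a) = int n * (e j * q)" by (simp add: q at(1))
          also have "x [^] \<dots> = (x [^] n) [^] (e j * q)"
            using x by (simp only: int_pow_pow[symmetric] int_pow_int)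
          finally have "s j [^] (p ^ a) \<in> H" using closed_subgroupD(8)[OF cH n(2)] by simp
          then show "s j \<in> {u \<in> carrier K. u [^] (p ^ a) \<in> H}" using x by (simp add: s_def)
        qed
      qed
      then show "\<exists>n. z [^] (p ^ n) \<in> H" by blast
    qed
  qed
qed

end

section \<open>Torsion modulo a locally essential component\<close>

locale component_locally_essential = compact_abelian_group +
  assumes loc_ess: "locally_essential K T (conn_comp K T)"
begin

abbreviation C :: "'a set" where "C \<equiv> conn_comp K T"

lemma essential_nbhd:
  obtains U where "openin T U" "\<one> \<in> U"
    "\<And>N. closed_subgroup N \<Longrightarrow> N \<subseteq> U \<Longrightarrow> C \<inter> N = {\<one>} \<Longrightarrow> N = {\<one>}"
proof -
  obtain V where V: "nbhd T \<one> V" "\<forall>N. subgroup N K \<and> closedin T N \<and> N \<subseteq> V \<and> N \<noteq> {\<one>} \<longrightarrow> C \<inter> N \<noteq> {\<one>}"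
    using loc_ess unfolding locally_essential_def by blast
  then obtain U where U: "openin T U" "\<one> \<in> U" "U \<subseteq> V" unfolding nbhd_def by blast
  show thesis
  proof (rule that[OF U(1,2)])
    fix N assume "closed_subgroup N" "N \<subseteq> U" "C \<inter> N = {\<one>}"
    then show "N = {\<one>}" using V(2)[rule_format, of N] U(3) unfolding closed_subgroup_def by auto
  qed
qed

lemma C_facts:
  shows "closed_subgroup C" "subgroup C K" "C \<subseteq> carrier K" "\<one> \<in> C"
  using closed_subgroup_component closed_subgroupD by blast+

text \<open>Otherwise \<open>small_subgroup_avoiding\<close> produces, inside the neighbourhood
  given by local essentiality, a nontrivial closed subgroup that meets \<open>C\<close>
  trivially.\<close>

lemma topologically_torsion_imp_torsion:
  fixes p :: nat
  assumes p: "Factorial_Ring.prime p" and z: "topologically_torsion p z"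
  obtains n where "z [^] (p ^ n) \<in> C"
proof (rule ccontr)
  assume "\<not> thesis"
  with that have nt: "z [^] (p ^ n) \<notin> C" for n by blast
  obtain U where U: "openin T U" "\<one> \<in> U"
    "\<And>N. closed_subgroup N \<Longrightarrow> N \<subseteq> U \<Longrightarrow> C \<inter> N = {\<one>} \<Longrightarrow> N = {\<one>}"
    using essential_nbhd by blast
  have sep: "x \<in> C" if x: "x \<in> carrier K" and all: "\<And>H. open_subgroup H \<Longrightarrow> C \<subseteq> H \<Longrightarrow> x \<in> H" for x
  proof (rule ccontr)
    assume "x \<notin> C"
    with x obtain H where "open_subgroup H" "x \<notin> H" by (rule separate_component)
    then show False using all[of H] component_subset_open_subgroup[of H] by simp
  qed
  have zc: "z \<in> carrier K" and top: "\<And>H. open_subgroup H \<Longrightarrow> C \<subseteq> H \<Longrightarrow> \<exists>n. z [^] (p ^ n) \<in> H"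
    using z by (auto simp: topologically_torsion_def)
  obtain N where "closed_subgroup N" "N \<subseteq> U" "N \<noteq> {\<one>}" "C \<inter> N = {\<one>}"
    by (rule small_subgroup_avoiding[OF C_facts(1) sep p zc top nt U(1,2)]) (assumption | blast)+
  then show False using U(3) by blast
qed

lemma first_power_in_component:
  fixes p :: nat
  assumes "z \<in> carrier K" "z \<notin> C" "z [^] (p ^ n) \<in> C"
  obtains k where "z [^] (p ^ k) \<notin> C" "(z [^] (p ^ k)) [^] p \<in> C"
proof -
  define n0 where "n0 = (LEAST n. z [^] (p ^ n) \<in> C)"
  have n0: "z [^] (p ^ n0) \<in> C" unfolding n0_def using assms(3) by (rule LeastI)
  have least: "z [^] (p ^ k) \<notin> C" if "k < n0" for k using that not_less_Least unfolding n0_def by blast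
  have "n0 \<noteq> 0" using n0 assms(1,2) by (metis nat_pow_eone power_0)
  then obtain k where k: "n0 = Suc k" using not0_implies_Suc by blast
  show thesis
    using that[of k] least[of k] n0 assms(1) unfolding k by (simp add: nat_pow_pow mult.commute)
qed

text \<open>If the multiples of z below p stay in \<open>U\<close>, the cyclic group of z is finite,
  hence closed, and inside \<open>U\<close>. Unless it is trivial it meets \<open>C\<close> in a
  nonzero element, which generates it because p is prime.\<close>

lemma small_prime_torsion:
  fixes p :: nat
  assumes p: "Factorial_Ring.prime p"
  obtains U where "openin T U" "\<one> \<in> U" "\<And>z. z \<in> U \<Longrightarrow> z [^] p = \<one> \<Longrightarrow> z \<in> C"
proof -
  obtain U where U: "openin T U" "\<one> \<in> U"
    "\<And>N. closed_subgroup N \<Longrightarrow> N \<subseteq> U \<Longrightarrow> C \<inter> N = {\<one>} \<Longrightarrow> N = {\<one>}"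
    using essential_nbhd by blast
  have p0: "p > 0" using p by (simp add: prime_gt_0_nat)
  obtain W where W: "openin T W" "\<one> \<in> W" "\<And>x i. x \<in> W \<Longrightarrow> i < p \<Longrightarrow> x [^] i \<in> U"
    using nbhd_nat_pow[OF U(1,2)] by blast
  show thesis
  proof (rule that[OF W(1,2)])
    fix z assume z: "z \<in> W" "z [^] p = \<one>"
    have zc: "z \<in> carrier K" using z(1) openin_subset_carrier[OF W(1)] by blast
    define N where "N = (\<lambda>i. z [^] i) ` {..<p}"
    have pow_mod: "z [^] (k::int) \<in> N" for k
    proof -
      have "k = int p * (k div int p) + int (nat (k mod int p))" using p0 by simp
      then have "z [^] k = (z [^] p) [^] (k div int p) \<otimes> z [^] nat (k mod int p)"
        using zc by (metis int_pow_int int_pow_mult int_pow_pow)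
      then have "z [^] k = z [^] nat (k mod int p)" using z(2) zc by (simp del: pow_nat)
      moreover have "nat (k mod int p) < p" using p0 by (simp add: nat_less_iff)
      ultimately show ?thesis unfolding N_def by blast
    qed
    have N: "N = range (\<lambda>i::int. z [^] i)"
    proof
      show "N \<subseteq> range (\<lambda>i::int. z [^] i)" unfolding N_def by (auto intro!: image_eqI[of _ _ "int _"] simp: int_pow_int)
    qed (use pow_mod in auto)
    have "closedin T N"
    proof -
      have "N = (\<Union>i<p. {z [^] i})" by (auto simp: N_def)
      moreover have "closedin T (\<Union>i<p. {z [^] i})"
        using zc by (intro closedin_Union) (auto intro: closedin_singleton)
      ultimately show ?thesis by simp
    qed
    then have "N = monothetic z" unfolding monothetic_def N by (simp add: closure_of_closedin)
    then have Ncs: "closed_subgroup N" "z \<in> N" using closed_subgroup_monothetic[OF zc] by simp_all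
    have NU: "N \<subseteq> U" using W(3)[OF z(1)] by (auto simp: N_def)
    show "z \<in> C"
    proof (cases "N = {\<one>}")
      case True
      then show ?thesis using Ncs(2) C_facts(4) by auto
    next
      case False
      then have "C \<inter> N \<noteq> {\<one>}" using U(3)[OF Ncs(1) NU] by blast
      then obtain w where w: "w \<in> C" "w \<in> N" "w \<noteq> \<one>"
        using C_facts(4) closed_subgroupD(4)[OF Ncs(1)] by blast
      then obtain i where i: "i < p" "w = z [^] i" by (auto simp: N_def)
      have "i > 0" using i w(3) by (cases "i = 0") auto
      then have "\<not> p dvd i" using i(1) by (auto dest: dvd_imp_le)
      then have "coprime (int i) (int p)" using prime_imp_coprime[OF p, of i] by (simp add: coprime_commute)
      then obtain a b where "a * int i + b * int p = 1"
        using bezout_int[of "int i" "int p"] by (metis coprime_imp_gcd_eq_1)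
      then have "z [^] (int i * a + int p * b) = z" using zc by (simp add: mult.commute)
      then have "z = (z [^] i) [^] a \<otimes> (z [^] p) [^] b"
        using zc by (metis int_pow_int int_pow_mult int_pow_pow)
      then have "z = w [^] a" using z(2) zc i(2) by simp
      then show ?thesis using closed_subgroupD(8)[OF C_facts(1) w(1)] by metis
    qed
  qed
qed

text \<open>Divisibility of \<open>C\<close> lets each class be represented by some z with p z = 0.
  Two such elements in the same small translate differ by p-torsion close to 0, which lies in
  \<open>C\<close>, so one representative for each translate of a finite cover is enough.\<close>

lemma prime_torsion_finite:
  fixes p :: nat
  assumes p: "Factorial_Ring.prime p"
  obtains A where "finite A" "A \<subseteq> carrier K" "\<And>x. x \<in> carrier K \<Longrightarrow> x [^] p \<in> C \<Longrightarrow> \<exists>a\<in>A. x \<otimes> inv a \<in> C"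
proof -
  obtain U where U: "openin T U" "\<one> \<in> U" "\<And>z. z \<in> U \<Longrightarrow> z [^] p = \<one> \<Longrightarrow> z \<in> C"
    using small_prime_torsion[OF p] by blast
  obtain W where W: "openin T W" "\<one> \<in> W" "\<And>x y. x \<in> W \<Longrightarrow> y \<in> W \<Longrightarrow> x \<otimes> inv y \<in> U"
    using nbhd_quotient[OF U(1,2)] by blast
  obtain F where F: "finite F" "F \<subseteq> carrier K" "\<And>x. x \<in> carrier K \<Longrightarrow> \<exists>f\<in>F. x \<otimes> inv f \<in> W"
    using finite_cover[OF W(1,2)] by blast
  define P where "P f z \<longleftrightarrow> z \<in> carrier K \<and> z [^] p = \<one> \<and> z \<otimes> inv f \<in> W" for f z
  define A where "A = (\<lambda>f. SOME z. P f z) ` {f \<in> F. \<exists>z. P f z}"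
  have A: "P f (SOME z. P f z)" if "\<exists>z. P f z" for f using that by (rule someI_ex)
  show thesis
  proof (rule that)
    show "finite A" using F(1) by (simp add: A_def)
    show "A \<subseteq> carrier K" using A by (auto simp: A_def P_def)
    fix x assume x: "x \<in> carrier K" "x [^] p \<in> C"
    obtain e where e: "e \<in> C" "x [^] p = e [^] p"
      using component_divisible[OF prime_gt_0_nat[OF p] x(2)] by blast
    have ec: "e \<in> carrier K" using e(1) C_facts(3) by blast
    define z where "z = x \<otimes> inv e"
    have zc: "z \<in> carrier K" using x ec by (simp add: z_def)
    have zp: "z [^] p = \<one>" unfolding z_def using x ec e(2) by (simp add: nat_pow_distrib nat_pow_inv)
    obtain f where f: "f \<in> F" "z \<otimes> inv f \<in> W" using F(3)[OF zc] by blast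
    have fc: "f \<in> carrier K" using f(1) F(2) by blast
    have ex: "\<exists>z. P f z" using zc zp f(2) by (auto simp: P_def)
    define a where "a = (SOME z. P f z)"
    have a: "a \<in> carrier K" "a [^] p = \<one>" "a \<otimes> inv f \<in> W" using A[OF ex] by (auto simp: a_def P_def)
    have "(z \<otimes> inv f) \<otimes> inv (a \<otimes> inv f) \<in> U" using W(3) f(2) a(3) by blast
    moreover have "(z \<otimes> inv f) \<otimes> inv (a \<otimes> inv f) = z \<otimes> inv a"
    proof -
      have "inv f \<otimes> (f \<otimes> inv a) = inv a" using a fc by (simp add: m_assoc[symmetric])
      then show ?thesis using a fc zc by (simp add: inv_mult_group m_assoc)
    qed
    moreover have "(z \<otimes> inv a) [^] p = \<one>" using a zc zp by (simp add: nat_pow_distrib nat_pow_inv)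
    ultimately have "z \<otimes> inv a \<in> C" using U(3) by simp
    then have "e \<otimes> (z \<otimes> inv a) \<in> C" using e(1) closed_subgroupD(5)[OF C_facts(1)] by blast
    moreover have "e \<otimes> (z \<otimes> inv a) = x \<otimes> inv a"
    proof -
      have "z \<otimes> inv a = inv e \<otimes> (x \<otimes> inv a)" unfolding z_def using x ec a by (simp add: m_ac)
      then show ?thesis using x ec a by (simp add: m_assoc[symmetric])
    qed
    ultimately have "x \<otimes> inv a \<in> C" by simp
    moreover have "a \<in> A" using f(1) ex by (auto simp: A_def a_def)
    ultimately show "\<exists>a\<in>A. x \<otimes> inv a \<in> C" by blast
  qed
qed

text \<open>For finitely many primes the nontrivial torsion classes are finite in number, and an
  open subgroup can avoid a finite set of points off the component.\<close>

lemma open_subgroup_without_torsion: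
  fixes R :: "nat set"
  assumes R: "finite R" "\<And>p. p \<in> R \<Longrightarrow> Factorial_Ring.prime p"
  obtains H where "open_subgroup H" "\<And>p x. p \<in> R \<Longrightarrow> x \<in> H \<Longrightarrow> x [^] p \<in> C \<Longrightarrow> x \<in> C"
proof -
  have "\<forall>p. \<exists>A. p \<in> R \<longrightarrow> finite A \<and> A \<subseteq> carrier K \<and> (\<forall>x\<in>carrier K. x [^] p \<in> C \<longrightarrow> (\<exists>a\<in>A. x \<otimes> inv a \<in> C))"
    using prime_torsion_finite R(2) by metis
  then obtain A where A: "\<And>p. p \<in> R \<Longrightarrow> finite (A p) \<and> A p \<subseteq> carrier K \<and>
      (\<forall>x\<in>carrier K. x [^] p \<in> C \<longrightarrow> (\<exists>a\<in>A p. x \<otimes> inv a \<in> C))" by metis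
  define B where "B = (\<Union>p\<in>R. A p) - C"
  have "finite B" "B \<subseteq> carrier K" "B \<inter> C = {}" using A R(1) by (auto simp: B_def)
  then obtain H where H: "open_subgroup H" "H \<inter> B = {}" using open_subgroup_avoiding_finite by blast
  have cH: "closed_subgroup H" by (rule open_subgroupD(1)[OF H(1)])
  show thesis
  proof (rule that[OF H(1)])
    fix p x assume px: "p \<in> R" "x \<in> H" "x [^] p \<in> C"
    have xc: "x \<in> carrier K" using px(2) closed_subgroupD(3)[OF cH] by blast
    obtain a where a: "a \<in> A p" "x \<otimes> inv a \<in> C" using A[OF px(1)] xc px(3) by blast
    have ac: "a \<in> carrier K" using a(1) A[OF px(1)] by blast
    have inv_H: "inv (x \<otimes> inv a) \<otimes> x \<in> H"
      using a(2) px(2) component_subset_open_subgroup[OF H(1)] closed_subgroupD(5,6)[OF cH] by blast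
    have eq: "inv (x \<otimes> inv a) \<otimes> x = a" using xc ac by (simp add: inv_mult_group m_assoc)
    have "a \<in> C" using inv_H eq H(2) a(1) px(1) unfolding B_def by auto
    then have "(x \<otimes> inv a) \<otimes> a \<in> C" using a(2) closed_subgroupD(5)[OF C_facts(1)] by blast
    then show "x \<in> C" using xc ac by (simp add: m_assoc)
  qed
qed

text \<open>A point w of \<open>H\<close> outside \<open>C\<close> is nonzero in some finite
  quotient K/G. A multiple u of w has prime order p there, and its topological p-part is congruent
  to u modulo G, hence outside \<open>C\<close>. Local essentiality makes that part p-power torsion
  modulo \<open>C\<close>, and its last multiple by a power of p outside \<open>C\<close> has order
  p.\<close>

lemma prime_torsion_in_open_subgroup:
  assumes H: "open_subgroup H" "H \<noteq> C"
  obtains p :: nat and b where "Factorial_Ring.prime p" "b \<in> H" "b \<notin> C" "b [^] p \<in> C"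
proof -
  have cH: "closed_subgroup H" by (rule open_subgroupD(1)[OF H(1)])
  obtain w where w: "w \<in> H" "w \<notin> C" using H component_subset_open_subgroup by blast
  have wc: "w \<in> carrier K" using w(1) closed_subgroupD(3)[OF cH] by blast
  obtain G where G: "open_subgroup G" "w \<notin> G" using separate_component[OF wc w(2)] by blast
  have cG: "closed_subgroup G" by (rule open_subgroupD(1)[OF G(1)])
  have ex: "\<exists>n::nat. n > 0 \<and> w [^] n \<in> G"
    by (rule finite_index_order[OF closed_subgroupD(1)[OF cG] finite_index_open_subgroup[OF G(1)] wc]) auto
  define n where "n = (LEAST n::nat. n > 0 \<and> w [^] n \<in> G)"
  have n: "n > 0" "w [^] n \<in> G" using LeastI_ex[OF ex] by (simp_all add: n_def)
  have least: "w [^] k \<notin> G" if "k > 0" "k < n" for k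
    using not_less_Least[of k "\<lambda>n. n > 0 \<and> w [^] n \<in> G"] that by (auto simp: n_def)
  have "n \<noteq> 1" using n(2) G(2) wc by auto
  then obtain p where p: "Factorial_Ring.prime p" "p dvd n" using prime_factor_nat by blast
  then obtain k where k: "n = p * k" by blast
  have p1: "p > 1" using p(1) by (rule prime_gt_1_nat)
  have kn: "k > 0" "k < n" using n(1) k p1 by auto
  define u where "u = w [^] k"
  have uc: "u \<in> carrier K" and uH: "u \<in> H" using wc closed_subgroupD(7)[OF cH w(1)] by (auto simp: u_def)
  have uG: "u \<notin> G" "u [^] p \<in> G" using least[OF kn] n(2) wc by (auto simp: u_def k nat_pow_pow mult.commute)
  obtain z where z: "topologically_torsion p z" "z \<in> H" "u \<otimes> inv z \<in> G"
    using topologically_torsion_part[OF uc p(1)] cH uH cG uG(2) by metis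
  have zc: "z \<in> carrier K" using z(1) by (simp add: topologically_torsion_def)
  have "z \<notin> G"
  proof
    assume "z \<in> G"
    then have "(u \<otimes> inv z) \<otimes> z \<in> G" using z(3) closed_subgroupD(5)[OF cG] by blast
    then show False using uG(1) uc zc by (simp add: m_assoc)
  qed
  then have zC: "z \<notin> C" using component_subset_open_subgroup[OF G(1)] by blast
  obtain m where "z [^] (p ^ m) \<in> C" using topologically_torsion_imp_torsion[OF p(1) z(1)] by blast
  then obtain j where "z [^] (p ^ j) \<notin> C" "(z [^] (p ^ j)) [^] p \<in> C"
    using first_power_in_component[OF zc zC] by blast
  then show thesis using that[of p "z [^] (p ^ j)"] p(1) closed_subgroupD(7)[OF cH z(2)] by blast
qed

text \<open>Take an open H without p-torsion modulo \<open>C\<close>. The topological p-part z of x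
  in H is p-power torsion modulo \<open>C\<close>, hence in \<open>C\<close>, while x - z is in pK.
  So H is contained in pK + C.\<close>

lemma prime_powers_finite_index:
  fixes p :: nat
  assumes p: "Factorial_Ring.prime p"
  shows "finite_index (powers p (carrier K) <#> C)"
proof -
  have "finite {p}" "\<And>q. q \<in> {p} \<Longrightarrow> Factorial_Ring.prime q" using p by auto
  then obtain H where H: "open_subgroup H" "\<And>q x. q \<in> {p} \<Longrightarrow> x \<in> H \<Longrightarrow> x [^] q \<in> C \<Longrightarrow> x \<in> C"
    using open_subgroup_without_torsion by blast
  have cH: "closed_subgroup H" by (rule open_subgroupD(1)[OF H(1)])
  have "H \<subseteq> powers p (carrier K) <#> C"
  proof
    fix x assume x: "x \<in> H"
    have xc: "x \<in> carrier K" using x closed_subgroupD(3)[OF cH] by blast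
    have "x [^] p \<in> powers p (carrier K)" using xc by (rule powersI)
    then obtain z where z: "topologically_torsion p z" "z \<in> H" "x \<otimes> inv z \<in> powers p (carrier K)"
      using topologically_torsion_part[OF xc p] cH x closed_subgroup_powers[OF closed_subgroup_carrier] by metis
    have zc: "z \<in> carrier K" using z(1) by (simp add: topologically_torsion_def)
    have "z \<in> C"
    proof (rule ccontr)
      assume zC: "z \<notin> C"
      obtain m where "z [^] (p ^ m) \<in> C" using topologically_torsion_imp_torsion[OF p z(1)] by blast
      then obtain j where "z [^] (p ^ j) \<notin> C" "(z [^] (p ^ j)) [^] p \<in> C"
        using first_power_in_component[OF zc zC] by blast
      then show False using H(2) closed_subgroupD(7)[OF cH z(2)] by blast
    qed
    then have "(x \<otimes> inv z) \<otimes> z \<in> powers p (carrier K) <#> C" using z(3) by (intro set_mult_memI)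
    then show "x \<in> powers p (carrier K) <#> C" using xc zc by (simp add: m_assoc)
  qed
  then show ?thesis using finite_index_mono[OF finite_index_open_subgroup[OF H(1)]] by blast
qed

text \<open>If f represents x modulo aK + C with x - f = a u + c, and g represents u modulo bK + C,
  then f + a g represents x modulo abK + C.\<close>

lemma finite_index_powers_mult:
  fixes a b :: nat
  assumes a: "finite_index (powers a (carrier K) <#> C)" and b: "finite_index (powers b (carrier K) <#> C)"
  shows "finite_index (powers (a * b) (carrier K) <#> C)"
proof -
  obtain A where A: "finite A" "A \<subseteq> carrier K" "\<And>x. x \<in> carrier K \<Longrightarrow> \<exists>f\<in>A. x \<otimes> inv f \<in> powers a (carrier K) <#> C"
    using a unfolding finite_index_def by blast
  obtain B where B: "finite B" "B \<subseteq> carrier K" "\<And>x. x \<in> carrier K \<Longrightarrow> \<exists>f\<in>B. x \<otimes> inv f \<in> powers b (carrier K) <#> C"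
    using b unfolding finite_index_def by blast
  define D where "D = (\<lambda>(f, g). f \<otimes> g [^] a) ` (A \<times> B)"
  show ?thesis
    unfolding finite_index_def
  proof (intro exI[of _ D] conjI ballI)
    show "finite D" using A(1) B(1) by (simp add: D_def)
    show "D \<subseteq> carrier K" using A(2) B(2) by (auto simp: D_def)
    fix x assume x: "x \<in> carrier K"
    obtain f u c where f: "f \<in> A" "u \<in> carrier K" "c \<in> C" "x \<otimes> inv f = u [^] a \<otimes> c"
      using A(3)[OF x] by (auto simp: set_mult_def powers_def)
    obtain g v d where g: "g \<in> B" "v \<in> carrier K" "d \<in> C" "u \<otimes> inv g = v [^] b \<otimes> d"
      using B(3)[OF f(2)] by (auto simp: set_mult_def powers_def)
    have car: "f \<in> carrier K" "g \<in> carrier K" "c \<in> carrier K" "d \<in> carrier K"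
      using f(1,3) g(1,3) A(2) B(2) C_facts(3) by auto
    have "u [^] a \<otimes> inv (g [^] a) = (u \<otimes> inv g) [^] a" using f(2) car by (simp add: nat_pow_distrib nat_pow_inv)
    also have "\<dots> = v [^] (a * b) \<otimes> d [^] a"
      unfolding g(4) using g(2) car by (simp add: nat_pow_distrib nat_pow_pow mult.commute)
    finally have ua: "u [^] a \<otimes> inv (g [^] a) = v [^] (a * b) \<otimes> d [^] a" .
    have "x \<otimes> inv (f \<otimes> g [^] a) = (x \<otimes> inv f) \<otimes> inv (g [^] a)" using x car by (simp add: inv_mult m_assoc)
    also have "\<dots> = (u [^] a \<otimes> inv (g [^] a)) \<otimes> c" unfolding f(4) using f(2) car by (simp add: m_ac)
    also have "\<dots> = v [^] (a * b) \<otimes> (d [^] a \<otimes> c)" unfolding ua using g(2) car by (simp add: m_assoc)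
    finally have "x \<otimes> inv (f \<otimes> g [^] a) \<in> powers (a * b) (carrier K) <#> C"
      using powersI[OF g(2)] closed_subgroupD(5,7)[OF C_facts(1)] f(3) g(3) by (metis set_mult_memI)
    then show "\<exists>f\<in>D. x \<otimes> inv f \<in> powers (a * b) (carrier K) <#> C"
      using f(1) g(1) unfolding D_def by (intro bexI[of _ "f \<otimes> g [^] a"]) auto
  qed
qed

lemma powers_open_subgroup:
  fixes m :: nat
  assumes "m > 0"
  shows "open_subgroup (powers m (carrier K) <#> C)"
proof (rule open_subgroup_finite_index)
  show "closed_subgroup (powers m (carrier K) <#> C)"
    by (intro closed_subgroup_set_mult closed_subgroup_powers closed_subgroup_carrier C_facts)
  show "finite_index (powers m (carrier K) <#> C)"
    using assms
  proof (induction m rule: less_induct)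
    case (less m)
    show ?case
    proof (cases "m = 1")
      case True
      have "powers 1 (carrier K) = carrier K" by (auto simp: powers_def image_iff)
      moreover have "carrier K \<subseteq> carrier K <#> C"
        using subset_set_mult(1)[OF subgroup_self C_facts(2)] .
      moreover have "finite_index (carrier K)"
        unfolding finite_index_def by (intro exI[of _ "{\<one>}"]) auto
      ultimately show ?thesis using True finite_index_mono by metis
    next
      case False
      then obtain p where p: "Factorial_Ring.prime p" "p dvd m" using prime_factor_nat by blast
      then obtain k where k: "m = p * k" by blast
      have "k > 0" "k < m" using less.prems k prime_gt_1_nat[OF p(1)] by auto
      then have "finite_index (powers k (carrier K) <#> C)" by (intro less.IH) auto
      then show ?thesis
        unfolding k by (rule finite_index_powers_mult[OF prime_powers_finite_index[OF p(1)]])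
    qed
  qed
qed

text \<open>A common multiple m of the orders in K/H of finitely many representatives sends K into
  \<open>H\<close>. Together with the openness of mK + C this makes a countable family cofinal among
  the open subgroups.\<close>

lemma powers_subset_open_subgroup:
  assumes H: "open_subgroup H"
  obtains m :: nat where "m > 0" "powers m (carrier K) <#> C \<subseteq> H"
proof -
  have cH: "closed_subgroup H" by (rule open_subgroupD(1)[OF H])
  obtain F where F: "finite F" "F \<subseteq> carrier K" "\<And>x. x \<in> carrier K \<Longrightarrow> \<exists>f\<in>F. x \<otimes> inv f \<in> H"
    using finite_index_open_subgroup[OF H] unfolding finite_index_def by blast
  have "\<forall>f. \<exists>n::nat. f \<in> F \<longrightarrow> n > 0 \<and> f [^] n \<in> H"
    using finite_index_order[OF closed_subgroupD(1)[OF cH] finite_index_open_subgroup[OF H]] F(2) by (metis subsetD)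
  then obtain n :: "'a \<Rightarrow> nat" where n: "\<And>f. f \<in> F \<Longrightarrow> n f > 0 \<and> f [^] n f \<in> H" by metis
  define m where "m = prod n F"
  have m0: "m > 0" unfolding m_def using n by (intro prod_pos) auto
  have fm: "f [^] m \<in> H" if f: "f \<in> F" for f
  proof -
    have "n f dvd m" unfolding m_def using f F(1) by (intro dvd_prodI)
    then obtain q where q: "m = n f * q" ..
    have "f [^] m = (f [^] n f) [^] q" using f F(2) unfolding q by (auto simp: nat_pow_pow)
    then show ?thesis using n[OF f] closed_subgroupD(7)[OF cH] by simp
  qed
  have "powers m (carrier K) \<subseteq> H"
  proof
    fix z assume "z \<in> powers m (carrier K)"
    then obtain x where x: "x \<in> carrier K" "z = x [^] m" by (auto simp: powers_def)
    obtain f where f: "f \<in> F" "x \<otimes> inv f \<in> H" using F(3)[OF x(1)] by blast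
    have fc: "f \<in> carrier K" using f(1) F(2) by blast
    have "z = ((x \<otimes> inv f) \<otimes> f) [^] m" unfolding x(2) using x(1) fc by (simp add: m_assoc)
    also have "\<dots> = (x \<otimes> inv f) [^] m \<otimes> f [^] m" using x(1) fc by (intro nat_pow_distrib) auto
    finally show "z \<in> H" using closed_subgroupD(5,7)[OF cH] f(2) fm[OF f(1)] by metis
  qed
  then have "powers m (carrier K) <#> C \<subseteq> H"
    using component_subset_open_subgroup[OF H] closed_subgroupD(1)[OF cH] by (intro set_mult_subset_subgroup)
  then show thesis using that m0 by blast
qed

section \<open>A dense subgroup with torsion-free quotient by C\<close>

lemma open_subgroup_neq_component:
  assumes "\<not> finite_index C" "open_subgroup H"
  shows "H \<noteq> C"
  using assms finite_index_open_subgroup by blast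

text \<open>A Cantor argument with decreasing cosets x_n + U_n inside t + H, one for each s_n to be
  missed. Since K/C is infinite, an open U contains some w outside \<open>C\<close>; a smaller open
  subgroup separates x from x + w, and s_n lies in the coset of at most one of them. Compactness
  provides a point of all the cosets.\<close>

lemma avoid_countable:
  assumes inf: "\<not> finite_index C" and H: "open_subgroup H" and t: "t \<in> carrier K" and S: "countable S" "S \<subseteq> carrier K"
  obtains g where "g \<in> carrier K" "g \<otimes> inv t \<in> H" "\<And>s. s \<in> S \<Longrightarrow> g \<otimes> inv s \<notin> C"
proof (cases "S = {}")
  case True
  have "t \<otimes> inv t \<in> H" using t closed_subgroupD(4)[OF open_subgroupD(1)[OF H]] by simp
  then show thesis using that[OF t] True by blast
next
  case False
  define s where "s = from_nat_into S"
  have s: "range s = S" unfolding s_def using False S(1) by (rule range_from_nat_into)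
  have sc: "s n \<in> carrier K" for n using s S(2) by blast
  \<comment> \<open>A state (x, U) stands for the coset x + U. A transition \<open>Q\<close> shrinks
    it to a coset that misses \<open>s n\<close>.\<close>
  define P where "P (n::nat) z \<longleftrightarrow> fst z \<in> carrier K \<and> open_subgroup (snd z) \<and> fst z \<otimes> inv t \<in> H" for n and z :: "'a \<times> 'a set"
  define Q where "Q n z z' \<longleftrightarrow> snd z' \<subseteq> snd z \<and> fst z' \<otimes> inv (fst z) \<in> snd z \<and> s n \<otimes> inv (fst z') \<notin> snd z'" for n and z z' :: "'a \<times> 'a set"
  have step: "\<exists>z'. (P (Suc n) z' \<and> snd z' \<subseteq> H) \<and> Q n z z'" if z: "P n z \<and> snd z \<subseteq> H" for n z
  proof -
    obtain x U where xU: "z = (x, U)" by (cases z)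
    have x: "x \<in> carrier K" and U: "open_subgroup U" "U \<subseteq> H" and xt: "x \<otimes> inv t \<in> H"
      using z by (auto simp: P_def xU)
    have Us: "subgroup U K" using U(1) by (simp add: open_subgroup_def)
    have Hs: "subgroup H K" using H by (simp add: open_subgroup_def)
    obtain w where w: "w \<in> U" "w \<notin> C"
      using open_subgroup_neq_component[OF inf U(1)] component_subset_open_subgroup[OF U(1)] by blast
    have wc: "w \<in> carrier K" using w(1) subgroup.mem_carrier[OF Us] by blast
    obtain V where V: "open_subgroup V" "w \<notin> V" using separate_component[OF wc w(2)] by blast
    have Vs: "subgroup V K" using V(1) by (simp add: open_subgroup_def)
    have UV: "open_subgroup (U \<inter> V)"
      using U(1) V(1) by (simp add: open_subgroup_def subgroups_Inter_pair openin_Int)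
    show ?thesis
    proof (cases "s n \<otimes> inv x \<in> U \<inter> V")
      case False
      then show ?thesis
        using x U UV xt subgroup.one_closed[OF Us]
        by (intro exI[of _ "(x, U \<inter> V)"]) (auto simp: P_def Q_def xU)
    next
      case True
      have xw: "x \<otimes> w \<in> carrier K" using x wc by simp
      have cancel: "(x \<otimes> w) \<otimes> inv x = w" using x wc by (simp add: m_comm[of x w] m_assoc)
      have "s n \<otimes> inv (x \<otimes> w) \<notin> V"
      proof
        assume "s n \<otimes> inv (x \<otimes> w) \<in> V"
        then have "(x \<otimes> w) \<otimes> inv (s n) \<in> V" using quotient_sym[OF Vs sc xw] by blast
        then have "(x \<otimes> w) \<otimes> inv x \<in> V" using quotient_trans[OF Vs xw sc x] True by blast
        then show False using cancel V(2) by simp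
      qed
      moreover have "(x \<otimes> w) \<otimes> inv t \<in> H"
        using quotient_trans[OF Hs xw x t _ xt] cancel w(1) U(2) by auto
      ultimately show ?thesis
        using xw U UV w(1) cancel by (intro exI[of _ "(x \<otimes> w, U \<inter> V)"]) (auto simp: P_def Q_def xU)
    qed
  qed
  have Hs: "subgroup H K" using H by (simp add: open_subgroup_def)
  have init: "P 0 (t, H) \<and> snd (t, H) \<subseteq> H" using t H subgroup.one_closed[OF Hs] by (auto simp: P_def)
  obtain z where z: "\<And>n. P n (z n) \<and> snd (z n) \<subseteq> H" "\<And>n. Q n (z n) (z (Suc n))"
    using dependent_nat_choice[of "\<lambda>n z. P n z \<and> snd z \<subseteq> H" Q] init step by metis
  define x where "x n = fst (z n)" for n
  define U where "U n = snd (z n)" for n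
  have xc: "x n \<in> carrier K" and U: "open_subgroup (U n)" and UH: "U n \<subseteq> H" and xt: "x n \<otimes> inv t \<in> H" for n
    using z(1)[of n] by (auto simp: P_def x_def U_def)
  have dec: "U (Suc n) \<subseteq> U n" and nxt: "x (Suc n) \<otimes> inv (x n) \<in> U n" and av: "s n \<otimes> inv (x (Suc n)) \<notin> U (Suc n)" for n
    using z(2)[of n] by (auto simp: Q_def x_def U_def)
  have Us: "subgroup (U n) K" for n using U[of n] by (simp add: open_subgroup_def)
  have dec': "U j \<subseteq> U n" if "n \<le> j" for n j by (rule lift_Suc_antimono_le[of U, OF dec that])
  have later: "x j \<otimes> inv (x n) \<in> U n" if "n \<le> j" for n j
    using that
  proof (induction j rule: dec_induct)
    case base then show ?case using xc subgroup.one_closed[OF Us] by simp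
  next
    case (step j)
    then show ?case using quotient_trans[OF Us xc xc xc _ step.IH] nxt[of j] dec'[of n j] by blast
  qed
  obtain g where g: "g \<in> carrier K"
    "\<And>A. \<lbrakk>closedin T A; eventually (\<lambda>j. x j \<in> A) sequentially\<rbrakk> \<Longrightarrow> g \<in> A"
    using cluster_point[of x] xc by blast
  have gx: "g \<otimes> inv (x n) \<in> U n" for n
  proof -
    have "g \<in> {y \<in> carrier K. y \<otimes> inv (x n) \<in> U n}"
    proof (rule g(2))
      show "closedin T {y \<in> carrier K. y \<otimes> inv (x n) \<in> U n}"
        using closed_subgroupD(2)[OF open_subgroupD(1)[OF U]] xc by (intro closedin_translate) auto
      show "eventually (\<lambda>j. x j \<in> {y \<in> carrier K. y \<otimes> inv (x n) \<in> U n}) sequentially"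
        unfolding eventually_sequentially using later xc by blast
    qed
    then show ?thesis by simp
  qed
  show thesis
  proof (rule that[OF g(1)])
    show "g \<otimes> inv t \<in> H" using quotient_trans[OF Hs g(1) xc[of 0] t] gx[of 0] UH[of 0] xt[of 0] by blast
    fix y assume "y \<in> S"
    then obtain n where n: "y = s n" using s by blast
    show "g \<otimes> inv y \<notin> C"
    proof
      assume "g \<otimes> inv y \<in> C"
      then have "g \<otimes> inv (s n) \<in> U (Suc n)" using component_subset_open_subgroup[OF U] n by blast
      then have "s n \<otimes> inv g \<in> U (Suc n)" using quotient_sym[OF Us g(1) sc] by blast
      then have "s n \<otimes> inv (x (Suc n)) \<in> U (Suc n)" using quotient_trans[OF Us sc g(1) xc] gx by blast
      then show False using av by blast
    qed
  qed
qed

text \<open>An open subgroup without torsion for the prime factors of \<open>k\<close> will do: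
  prime factors are stripped off one at a time, by induction over the divisors of
  \<open>k\<close>.\<close>

lemma open_subgroup_without_exponent:
  fixes k :: nat
  assumes k: "k > 0"
  obtains H where "open_subgroup H" "\<And>x. x \<in> H \<Longrightarrow> x [^] k \<in> C \<Longrightarrow> x \<in> C"
proof -
  obtain H where H: "open_subgroup H" "\<And>p x. p \<in> prime_factors k \<Longrightarrow> x \<in> H \<Longrightarrow> x [^] p \<in> C \<Longrightarrow> x \<in> C"
    using open_subgroup_without_torsion[of "prime_factors k"] by auto
  have cH: "closed_subgroup H" by (rule open_subgroupD(1)[OF H(1)])
  have main: "j dvd k \<longrightarrow> (\<forall>x\<in>H. x [^] j \<in> C \<longrightarrow> x \<in> C)" for j :: nat
  proof (induction j rule: less_induct)
    case (less j)
    show ?case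
    proof (intro impI ballI)
      fix x assume j: "j dvd k" and x: "x \<in> H" "x [^] j \<in> C"
      have xc: "x \<in> carrier K" using x(1) closed_subgroupD(3)[OF cH] by blast
      show "x \<in> C"
      proof (cases "j = 1")
        case True then show ?thesis using x(2) xc by simp
      next
        case False
        then obtain p where p: "Factorial_Ring.prime p" "p dvd j" using prime_factor_nat by blast
        then obtain i where i: "j = i * p" by (metis dvd_def mult.commute)
        have pk: "p \<in> prime_factors k" using p j k by (auto simp: in_prime_factors_iff intro: dvd_trans)
        have "j > 0" using j k by (rule dvd_pos_nat[rotated])
        then have ij: "i < j" "i dvd k" using i j prime_gt_1_nat[OF p(1)] dvd_trans by auto
        have "(x [^] i) [^] p \<in> C" using x(2) xc by (simp add: nat_pow_pow i)
        then have "x [^] i \<in> C" using H(2)[OF pk] closed_subgroupD(7)[OF cH x(1)] by blast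
        then show ?thesis using less ij x(1) by blast
      qed
    qed
  qed
  have all: "\<forall>x\<in>H. x [^] k \<in> C \<longrightarrow> x \<in> C" using main[of k] by simp
  show thesis by (rule that[OF H(1)]) (use all in simp)
qed

text \<open>Two solutions in the same coset of an open subgroup without k-torsion modulo
  \<open>C\<close> agree modulo \<open>C\<close>, and there are finitely many cosets.\<close>

lemma roots_finite_mod_component:
  fixes k :: nat
  assumes k: "k > 0"
  obtains A where "finite A" "A \<subseteq> carrier K" "\<And>g. g \<in> carrier K \<Longrightarrow> g [^] k \<otimes> inv s \<in> C \<Longrightarrow> s \<in> carrier K \<Longrightarrow> \<exists>a\<in>A. g \<otimes> inv a \<in> C"
proof -
  obtain H where H: "open_subgroup H" "\<And>x. x \<in> H \<Longrightarrow> x [^] k \<in> C \<Longrightarrow> x \<in> C"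
    using open_subgroup_without_exponent[OF k] by blast
  have Hs: "subgroup H K" using H(1) by (simp add: open_subgroup_def)
  obtain F where F: "finite F" "F \<subseteq> carrier K" "\<And>x. x \<in> carrier K \<Longrightarrow> \<exists>f\<in>F. x \<otimes> inv f \<in> H"
    using finite_index_open_subgroup[OF H(1)] unfolding finite_index_def by blast
  define P where "P f g \<longleftrightarrow> g \<in> carrier K \<and> g [^] k \<otimes> inv s \<in> C \<and> g \<otimes> inv f \<in> H" for f g
  define A where "A = (\<lambda>f. SOME g. P f g) ` {f \<in> F. \<exists>g. P f g}"
  have A: "P f (SOME g. P f g)" if "\<exists>g. P f g" for f using that by (rule someI_ex)
  show thesis
  proof (rule that)
    show "finite A" using F(1) by (simp add: A_def)
    show "A \<subseteq> carrier K" using A by (auto simp: A_def P_def)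
    fix g assume g: "g \<in> carrier K" "g [^] k \<otimes> inv s \<in> C" "s \<in> carrier K"
    obtain f where f: "f \<in> F" "g \<otimes> inv f \<in> H" using F(3)[OF g(1)] by blast
    have fc: "f \<in> carrier K" using f(1) F(2) by blast
    have ex: "\<exists>g. P f g" using g f by (auto simp: P_def)
    define a where "a = (SOME g. P f g)"
    have a: "a \<in> carrier K" "a [^] k \<otimes> inv s \<in> C" "a \<otimes> inv f \<in> H" using A[OF ex] by (auto simp: a_def P_def)
    have "g \<otimes> inv a \<in> H" using quotient_trans[OF Hs g(1) fc a(1) f(2)] quotient_sym[OF Hs a(1) fc a(3)] by blast
    moreover have "(g \<otimes> inv a) [^] k \<in> C"
    proof -
      have "g [^] k \<otimes> inv (a [^] k) \<in> C"
        using quotient_trans[OF C_facts(2) _ g(3) _ g(2)] quotient_sym[OF C_facts(2) _ g(3) a(2)] g(1) a(1) by simp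
      then show ?thesis using g(1) a(1) by (simp add: nat_pow_distrib nat_pow_inv)
    qed
    ultimately have "g \<otimes> inv a \<in> C" by (rule H(2))
    moreover have "a \<in> A" using f(1) ex by (auto simp: A_def a_def)
    ultimately show "\<exists>a\<in>A. g \<otimes> inv a \<in> C" by blast
  qed
qed

text \<open>Countability of H/C, expressed by representatives, is an invariant of the recursion: it
  keeps the set of forbidden classes countable at the next stage.\<close>

definition countable_torsion_free :: "'a set \<Rightarrow> bool" where
  "countable_torsion_free H \<longleftrightarrow> subgroup H K \<and> C \<subseteq> H \<and>
     (\<exists>S. countable S \<and> S \<subseteq> carrier K \<and> (\<forall>x\<in>H. \<exists>s\<in>S. x \<otimes> inv s \<in> C)) \<and>
     (\<forall>x\<in>H. \<forall>k::nat. k > 0 \<longrightarrow> x [^] k \<in> C \<longrightarrow> x \<in> C)"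

text \<open>Adjoining g preserves torsion-freeness as soon as no positive multiple of g lies in
  \<open>H\<close>. The classes to avoid solve k g = s modulo \<open>C\<close> with k > 0 and s
  among the representatives of H/C; each equation has finitely many solutions, so the list is
  countable.\<close>

lemma extend_countable_torsion_free:
  assumes inf: "\<not> finite_index C" and H: "countable_torsion_free H" and U: "open_subgroup U" and t: "t \<in> carrier K"
  obtains H' g where "countable_torsion_free H'" "H \<subseteq> H'" "g \<in> H'" "g \<otimes> inv t \<in> U"
proof -
  obtain S where S: "countable S" "S \<subseteq> carrier K" "\<And>x. x \<in> H \<Longrightarrow> \<exists>s\<in>S. x \<otimes> inv s \<in> C"
    using H unfolding countable_torsion_free_def by blast
  have Hs: "subgroup H K" and CH: "C \<subseteq> H"
    and tf: "\<And>x k::nat. x \<in> H \<Longrightarrow> k > 0 \<Longrightarrow> x [^] k \<in> C \<Longrightarrow> x \<in> C"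
    using H unfolding countable_torsion_free_def by blast+
  have Hc: "H \<subseteq> carrier K" using Hs by (rule subgroup.subset)
  have "\<exists>A. k > 0 \<longrightarrow> finite A \<and> A \<subseteq> carrier K \<and>
      (\<forall>g. g \<in> carrier K \<longrightarrow> g [^] k \<otimes> inv s \<in> C \<longrightarrow> s \<in> carrier K \<longrightarrow> (\<exists>a\<in>A. g \<otimes> inv a \<in> C))" for k :: nat and s
  proof (cases "k > 0")
      case True
      obtain A where "finite A" "A \<subseteq> carrier K" "\<And>g. g \<in> carrier K \<Longrightarrow> g [^] k \<otimes> inv s \<in> C \<Longrightarrow> s \<in> carrier K \<Longrightarrow> \<exists>a\<in>A. g \<otimes> inv a \<in> C"
        using roots_finite_mod_component[OF True, of s] by metis
      then show ?thesis by (intro exI[of _ A]) simp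
  qed simp
  then obtain A where A: "\<And>k s. k > (0::nat) \<Longrightarrow> finite (A k s) \<and> A k s \<subseteq> carrier K \<and>
      (\<forall>g. g \<in> carrier K \<longrightarrow> g [^] k \<otimes> inv s \<in> C \<longrightarrow> s \<in> carrier K \<longrightarrow> (\<exists>a\<in>A k s. g \<otimes> inv a \<in> C))"
    by metis
  define R where "R = (\<Union>k\<in>{0<..}. \<Union>s\<in>S. A k s)"
  have "countable R" unfolding R_def
  proof (intro countable_UN S(1))
    fix k :: nat and s assume "k \<in> {0<..}"
    then have "finite (A k s)" using A[of k s] by simp
    then show "countable (A k s)" by (rule countable_finite)
  qed simp
  moreover have "R \<subseteq> carrier K"
    unfolding R_def
  proof (intro UN_least)
    fix k :: nat and s assume "k \<in> {0<..}"
    then show "A k s \<subseteq> carrier K" using A[of k s] by simp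
  qed
  ultimately obtain g where g: "g \<in> carrier K" "g \<otimes> inv t \<in> U" "\<And>s. s \<in> R \<Longrightarrow> g \<otimes> inv s \<notin> C"
    using avoid_countable[OF inf U t] by blast
  have gn: "g [^] k \<notin> H" if k: "k > 0" for k :: nat
  proof
    assume "g [^] k \<in> H"
    then obtain s where s: "s \<in> S" "g [^] k \<otimes> inv s \<in> C" using S(3) by blast
    moreover have "s \<in> carrier K" using s(1) S(2) by blast
    ultimately obtain a where a: "a \<in> A k s" "g \<otimes> inv a \<in> C" using A[OF k, of s] g(1) by blast
    have "a \<in> R" unfolding R_def using a(1) s(1) k by blast
    then show False using g(3) a(2) by blast
  qed
  define H' where "H' = {h \<otimes> g [^] i | h i. h \<in> H \<and> i \<in> (UNIV :: int set)}"
  have H'I: "h \<otimes> g [^] i \<in> H'" if "h \<in> H" for h and i :: int using that by (auto simp: H'_def)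
  have H'E: "\<exists>h i. h \<in> H \<and> x = h \<otimes> g [^] (i::int)" if "x \<in> H'" for x using that by (auto simp: H'_def)
  have H'c: "H' \<subseteq> carrier K" using H'E Hc g(1) by fastforce
  have HH': "H \<subseteq> H'"
  proof
    fix h assume "h \<in> H"
    then show "h \<in> H'" using H'I[of h 0] Hc by auto
  qed
  have gH': "g \<in> H'" using H'I[OF subgroup.one_closed[OF Hs], of 1] g(1) by simp
  have H's: "subgroup H' K"
  proof (rule subgroupI[OF H'c])
    show "H' \<noteq> {}" using gH' by blast
    show "inv a \<in> H'" if a: "a \<in> H'" for a
    proof -
      obtain h i where hi: "h \<in> H" "a = h \<otimes> g [^] (i::int)" using H'E[OF a] by blast
      then have "inv a = inv h \<otimes> g [^] (- i)" using Hc g(1) by (auto simp: inv_mult int_pow_neg)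
      then show ?thesis using H'I[of "inv h" "- i"] subgroup.m_inv_closed[OF Hs hi(1)] by simp
    qed
    show "a \<otimes> b \<in> H'" if a: "a \<in> H'" and b: "b \<in> H'" for a b
    proof -
      obtain h i where hi: "h \<in> H" "a = h \<otimes> g [^] (i::int)" using H'E[OF a] by blast
      obtain u j where uj: "u \<in> H" "b = u \<otimes> g [^] (j::int)" using H'E[OF b] by blast
      have car: "h \<in> carrier K" "u \<in> carrier K" using hi(1) uj(1) Hc by auto
      have "a \<otimes> b = (h \<otimes> u) \<otimes> g [^] (i + j)"
        unfolding hi(2) uj(2) using car g(1) by (simp add: int_pow_mult m_ac)
      then show ?thesis using H'I[of "h \<otimes> u"] subgroup.m_closed[OF Hs hi(1) uj(1)] by simp
    qed
  qed
  have "x \<in> C" if x: "x \<in> H'" "x [^] k \<in> C" and k: "k > 0" for x and k :: nat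
  proof -
    obtain h i where hi: "h \<in> H" "x = h \<otimes> g [^] (i::int)" using H'E[OF x(1)] by blast
    have hc: "h \<in> carrier K" using hi(1) Hc by blast
    have hk: "h [^] k \<in> H" using subgroup_nat_pow[OF Hs hi(1)] .
    have "x [^] k = h [^] k \<otimes> (g [^] i) [^] k" unfolding hi(2) using hc g(1) by (simp add: nat_pow_distrib)
    moreover have "(g [^] i) [^] k = g [^] (i * int k)"
      using g(1) by (simp only: int_pow_pow[symmetric] int_pow_int)
    ultimately have "inv (h [^] k) \<otimes> x [^] k = g [^] (i * int k)"
      using hc g(1) by (simp add: m_assoc[symmetric])
    moreover have "inv (h [^] k) \<otimes> x [^] k \<in> H"
      using subgroup.m_closed[OF Hs] subgroup.m_inv_closed[OF Hs hk] x(2) CH by blast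
    ultimately have gik: "g [^] (i * int k) \<in> H" by simp
    have "i = 0"
    proof (rule ccontr)
      assume "i \<noteq> 0"
      then have pos: "nat \<bar>i * int k\<bar> > 0" using k by simp
      have "g [^] (nat \<bar>i * int k\<bar>) \<in> H"
      proof (cases "i * int k \<ge> 0")
        case True then show ?thesis using gik by simp
      next
        case False
        then have "g [^] (nat \<bar>i * int k\<bar>) = inv (g [^] (i * int k))"
          using g(1) by (simp add: int_pow_neg)
        then show ?thesis using subgroup.m_inv_closed[OF Hs gik] by simp
      qed
      then show False using gn[OF pos] by blast
    qed
    then have "x = h" using hi(2) hc by simp
    then show ?thesis using tf[OF hi(1) k] x(2) by simp
  qed
  moreover have "\<exists>S. countable S \<and> S \<subseteq> carrier K \<and> (\<forall>x\<in>H'. \<exists>s\<in>S. x \<otimes> inv s \<in> C)"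
  proof (intro exI conjI ballI)
    let ?S = "(\<lambda>(s, i::int). s \<otimes> g [^] i) ` (S \<times> UNIV)"
    show "countable ?S" using S(1) by simp
    show "?S \<subseteq> carrier K" using S(2) g(1) by auto
    fix x assume "x \<in> H'"
    then obtain h i where hi: "h \<in> H" "x = h \<otimes> g [^] (i::int)" using H'E by blast
    obtain s where s: "s \<in> S" "h \<otimes> inv s \<in> C" using S(3)[OF hi(1)] by blast
    have car: "h \<in> carrier K" "s \<in> carrier K" using hi(1) Hc s(1) S(2) by auto
    have "x \<otimes> inv (s \<otimes> g [^] i) = h \<otimes> inv s"
    proof -
      have "g [^] i \<otimes> inv (s \<otimes> g [^] i) = inv s" using car g(1) by (simp add: inv_mult_group m_assoc[symmetric])
      then show ?thesis unfolding hi(2) using car g(1) by (simp add: m_assoc)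
    qed
    then show "\<exists>s\<in>?S. x \<otimes> inv s \<in> C" using s by (intro bexI[of _ "s \<otimes> g [^] i"]) auto
  qed
  ultimately have "countable_torsion_free H'"
    unfolding countable_torsion_free_def using H's CH HH' by blast
  then show thesis using that HH' gH' g(2) by blast
qed

text \<open>The cosets of all mK + C form a countable list, and each step of the recursion meets one
  of them. By cofinality the union meets every coset of every open subgroup. Compactness then places
  a point of its closure in each x + C, which suffices because \<open>C\<close> lies in the
  union.\<close>

lemma dense_torsion_free_subgroup:
  assumes inf: "\<not> finite_index C"
  obtains G where "subgroup G K" "C \<subseteq> G" "T closure_of G = carrier K"
    "\<And>x k::nat. x \<in> G \<Longrightarrow> k > 0 \<Longrightarrow> x [^] k \<in> C \<Longrightarrow> x \<in> C"
proof -
  have "\<exists>F. m > 0 \<longrightarrow> finite F \<and> F \<subseteq> carrier K \<and>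
      (\<forall>x\<in>carrier K. \<exists>f\<in>F. x \<otimes> inv f \<in> powers m (carrier K) <#> C)" for m :: nat
  proof (cases "m > 0")
    case True
    show ?thesis
      using finite_index_open_subgroup[OF powers_open_subgroup[OF True]] True unfolding finite_index_def by simp
  qed simp
  then obtain F where F: "\<And>m::nat. m > 0 \<Longrightarrow> finite (F m) \<and> F m \<subseteq> carrier K \<and>
      (\<forall>x\<in>carrier K. \<exists>f\<in>F m. x \<otimes> inv f \<in> powers m (carrier K) <#> C)" by metis
  define D where "D = (\<Union>m\<in>{0<..}. (\<lambda>f. (f, m)) ` F m)"
  have "countable D" unfolding D_def
  proof (intro countable_UN countable_image)
    fix m :: nat assume "m \<in> {0<..}"
    then have "finite (F m)" using F[of m] by simp
    then show "countable (F m)" by (rule countable_finite)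
  qed simp
  moreover have "D \<noteq> {}"
  proof -
    obtain f where "f \<in> F 1" using F[of 1] one_closed by auto
    then have "(f, 1) \<in> D" by (auto simp: D_def)
    then show ?thesis by blast
  qed
  ultimately have D: "range (from_nat_into D) = D" by (rule range_from_nat_into[rotated])
  define e where "e = from_nat_into D"
  have e: "fst (e n) \<in> carrier K" "snd (e n) > 0" for n
  proof -
    have "e n \<in> D" using D by (auto simp: e_def)
    then obtain m f where mf: "m > 0" "f \<in> F m" "e n = (f, m)" by (auto simp: D_def)
    then show "fst (e n) \<in> carrier K" "snd (e n) > 0" using F[OF mf(1)] by auto
  qed
  have C0: "countable_torsion_free C"
    unfolding countable_torsion_free_def
  proof (intro conjI)
    show "\<exists>S. countable S \<and> S \<subseteq> carrier K \<and> (\<forall>x\<in>C. \<exists>s\<in>S. x \<otimes> inv s \<in> C)"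
      using C_facts(3) by (intro exI[of _ "{\<one>}"]) auto
  qed (use C_facts in auto)
  define Q where "Q n H H' \<longleftrightarrow> H \<subseteq> H' \<and> (\<exists>g\<in>H'. g \<otimes> inv (fst (e n)) \<in> powers (snd (e n)) (carrier K) <#> C)" for n H H'
  have step: "\<exists>H'. countable_torsion_free H' \<and> Q n H H'" if ctf: "countable_torsion_free H" for n H
  proof -
    obtain H' g where "countable_torsion_free H'" "H \<subseteq> H'" "g \<in> H'"
      "g \<otimes> inv (fst (e n)) \<in> powers (snd (e n)) (carrier K) <#> C"
      using extend_countable_torsion_free[OF inf ctf powers_open_subgroup[OF e(2)] e(1)] by blast
    then show ?thesis unfolding Q_def by blast
  qed
  obtain H where H: "\<And>n. countable_torsion_free (H n)" "\<And>n. Q n (H n) (H (Suc n))"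
    using dependent_nat_choice[of "\<lambda>_. countable_torsion_free" Q] C0 step by metis
  have mono: "H i \<subseteq> H j" if "i \<le> j" for i j
    by (rule lift_Suc_mono_le[of H, OF _ that]) (use H(2) in \<open>auto simp: Q_def\<close>)
  have Hs: "subgroup (H n) K" and CH: "C \<subseteq> H n" for n
    using H(1)[of n] by (auto simp: countable_torsion_free_def)
  define G where "G = (\<Union>n. H n)"
  have Gs: "subgroup G K"
  proof (rule subgroupI)
    show "G \<subseteq> carrier K" using subgroup.subset[OF Hs] by (auto simp: G_def)
    show "G \<noteq> {}" using subgroup.one_closed[OF Hs] by (auto simp: G_def)
    show "inv a \<in> G" if "a \<in> G" for a using that subgroup.m_inv_closed[OF Hs] by (auto simp: G_def)
    show "a \<otimes> b \<in> G" if a: "a \<in> G" and b: "b \<in> G" for a b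
    proof -
      obtain i j where "a \<in> H i" "b \<in> H j" using a b by (auto simp: G_def)
      then have "a \<in> H (max i j)" "b \<in> H (max i j)" using mono[of i "max i j"] mono[of j "max i j"] by auto
      then show ?thesis using subgroup.m_closed[OF Hs] by (auto simp: G_def)
    qed
  qed
  have CG: "C \<subseteq> G" using CH by (auto simp: G_def)
  have approx: "\<exists>g\<in>G. x \<otimes> inv g \<in> U" if x: "x \<in> carrier K" and U: "open_subgroup U" for x U
  proof -
    obtain m :: nat where m: "m > 0" "powers m (carrier K) <#> C \<subseteq> U" using powers_subset_open_subgroup[OF U] by blast
    let ?P = "powers m (carrier K) <#> C"
    have Ps: "subgroup ?P K" using powers_open_subgroup[OF m(1)] by (simp add: open_subgroup_def)
    obtain f where f: "f \<in> F m" "x \<otimes> inv f \<in> ?P" using F[OF m(1)] x by blast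
    have fc: "f \<in> carrier K" using f(1) F[OF m(1)] by blast
    have "(f, m) \<in> D" using f(1) m(1) by (auto simp: D_def)
    then obtain n where n: "e n = (f, m)" using D by (metis e_def rangeE)
    then obtain g where g: "g \<in> H (Suc n)" "g \<otimes> inv f \<in> ?P" using H(2)[of n] by (auto simp: Q_def)
    have gc: "g \<in> carrier K" using g(1) subgroup.mem_carrier[OF Hs] by blast
    have "x \<otimes> inv g \<in> ?P"
      using quotient_trans[OF Ps x fc gc f(2)] quotient_sym[OF Ps gc fc g(2)] by blast
    then show ?thesis using g(1) m(2) by (auto simp: G_def)
  qed
  have "T closure_of G = carrier K"
  proof
    show "T closure_of G \<subseteq> carrier K" using closure_of_subset_topspace[of T G] topspace_eq by blast
    show "carrier K \<subseteq> T closure_of G"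
    proof
      fix x assume x: "x \<in> carrier K"
      let ?B = "T closure_of G"
      have B: "closed_subgroup ?B" by (rule subgroup_closure[OF Gs])
      have GB: "G \<subseteq> ?B" using subgroup.subset[OF Gs] by (simp add: closure_of_subset topspace_eq)
      have cl: "closedin T {g \<in> carrier K. x \<otimes> inv g \<in> U}" if "open_subgroup U" for U
        using x closed_subgroupD(2)[OF open_subgroupD(1)[OF that]]
        by (intro closedin_preimage continuous_map_mult continuous_map_const_carrier continuous_inv)
      have "\<Inter> ((\<lambda>U. ?B \<inter> {g \<in> carrier K. x \<otimes> inv g \<in> U}) ` Collect open_subgroup) \<noteq> {}"
      proof (rule compact[unfolded compact_space_fip, rule_format], intro conjI ballI allI impI)
        fix S assume "S \<in> (\<lambda>U. ?B \<inter> {g \<in> carrier K. x \<otimes> inv g \<in> U}) ` Collect open_subgroup"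
        then show "closedin T S" using cl closed_subgroupD(2)[OF B] by (auto intro!: closedin_Int)
      next
        fix \<F> assume "finite \<F> \<and> \<F> \<subseteq> (\<lambda>U. ?B \<inter> {g \<in> carrier K. x \<otimes> inv g \<in> U}) ` Collect open_subgroup"
        then obtain \<G> where G: "finite \<G>" "\<G> \<subseteq> Collect open_subgroup"
          "\<F> = (\<lambda>U. ?B \<inter> {g \<in> carrier K. x \<otimes> inv g \<in> U}) ` \<G>"
          by (meson finite_subset_image)
        have "open_subgroup (carrier K \<inter> \<Inter>\<G>)" using G(2) by (intro open_subgroup_Inter[OF G(1)]) auto
        then obtain g where "g \<in> G" "x \<otimes> inv g \<in> carrier K \<inter> \<Inter>\<G>" using approx[OF x] by blast
        then have "g \<in> \<Inter>\<F>" unfolding G(3) using GB subgroup.mem_carrier[OF Gs] by auto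
        then show "\<Inter>\<F> \<noteq> {}" by blast
      qed
      then obtain g where "g \<in> \<Inter> ((\<lambda>U. ?B \<inter> {g \<in> carrier K. x \<otimes> inv g \<in> U}) ` Collect open_subgroup)"
        by (auto simp only: ex_in_conv[symmetric])
      then have "g \<in> ?B \<inter> {g \<in> carrier K. x \<otimes> inv g \<in> U}" if "open_subgroup U" for U using that by blast
      then have g: "g \<in> ?B \<and> g \<in> carrier K \<and> x \<otimes> inv g \<in> U" if "open_subgroup U" for U using that by simp
      have "open_subgroup (carrier K)" using subgroup_self openin_carrier by (simp add: open_subgroup_def)
      then have gB: "g \<in> ?B" "g \<in> carrier K" using g by auto
      have "x \<otimes> inv g \<in> C"
      proof (rule ccontr)
        assume "x \<otimes> inv g \<notin> C"
        moreover have "x \<otimes> inv g \<in> carrier K" using x gB by simp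
        ultimately obtain U where "open_subgroup U" "x \<otimes> inv g \<notin> U" using separate_component by blast
        then show False using g by blast
      qed
      then have "(x \<otimes> inv g) \<otimes> g \<in> ?B" using CG GB gB closed_subgroupD(5)[OF B] by blast
      then show "x \<in> ?B" using x gB by (simp add: m_assoc)
    qed
  qed
  moreover have "x \<in> C" if "x \<in> G" "k > 0" "x [^] k \<in> C" for x and k :: nat
    using that H(1) by (auto simp: G_def countable_torsion_free_def)
  ultimately show thesis using that Gs CG by blast
qed

end

lemma top_group_imp_abelian_topological_group:
  "top_group K T \<Longrightarrow> abelian_topological_group K T"
  by (simp add: top_group_def abelian_topological_group_def abelian_topological_group_axioms_def)

lemma top_group_imp_compact_abelian_group:
  "top_group K T \<Longrightarrow> compact_space T \<Longrightarrow> compact_abelian_group K T"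
  by (simp add: top_group_imp_abelian_topological_group compact_abelian_group_def compact_abelian_group_axioms_def)

section \<open>Local minimality\<close>

text \<open>The defining predicate is a topology because distinct cosets are disjoint, so that
  taking unions of families of cosets commutes with intersection.\<close>

lemma openin_quot_top:
  assumes "group G" "subgroup H G"
  shows "openin (quot_top G T H) U \<longleftrightarrow> U \<subseteq> rcosets\<^bsub>G\<^esub> H \<and> openin T (\<Union>U)"
proof -
  have disj: "A = B" if "A \<in> rcosets\<^bsub>G\<^esub> H" "B \<in> rcosets\<^bsub>G\<^esub> H" "x \<in> A" "x \<in> B" for A B x
    using group.rcos_disjoint[OF assms] that by (auto simp: pairwise_def disjnt_def)
  have "istopology (\<lambda>U. U \<subseteq> rcosets\<^bsub>G\<^esub> H \<and> openin T (\<Union>U))"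
    unfolding istopology_def
  proof (intro conjI allI impI)
    fix A B assume A: "A \<subseteq> rcosets\<^bsub>G\<^esub> H \<and> openin T (\<Union>A)" and B: "B \<subseteq> rcosets\<^bsub>G\<^esub> H \<and> openin T (\<Union>B)"
    then show "A \<inter> B \<subseteq> rcosets\<^bsub>G\<^esub> H" by blast
    have "\<Union>(A \<inter> B) = \<Union>A \<inter> \<Union>B"
    proof (intro equalityI subsetI)
      fix x assume "x \<in> \<Union>A \<inter> \<Union>B"
      then obtain a b where ab: "a \<in> A" "b \<in> B" "x \<in> a" "x \<in> b" by blast
      then have "a = b" using A B disj by blast
      then show "x \<in> \<Union>(A \<inter> B)" using ab by blast
    qed blast
    then show "openin T (\<Union>(A \<inter> B))" using A B by (simp add: openin_Int)
  next
    fix \<K> assume \<K>: "\<forall>A\<in>\<K>. A \<subseteq> rcosets\<^bsub>G\<^esub> H \<and> openin T (\<Union>A)"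
    then show "\<Union>\<K> \<subseteq> rcosets\<^bsub>G\<^esub> H" by blast
    have "\<Union>(\<Union>\<K>) = \<Union>(Union ` \<K>)" by blast
    moreover have "openin T (\<Union>(Union ` \<K>))" using \<K> by (intro openin_Union) auto
    ultimately show "openin T (\<Union>(\<Union>\<K>))" by simp
  qed
  then show ?thesis by (simp add: quot_top_def)
qed

context compact_abelian_group
begin

lemma closure_quotient:
  assumes P: "P \<subseteq> carrier K" and Q: "\<And>x y. x \<in> P \<Longrightarrow> y \<in> P \<Longrightarrow> x \<otimes> inv y \<in> Q"
    and x: "x \<in> T closure_of P" and y: "y \<in> T closure_of P"
  shows "x \<otimes> inv y \<in> T closure_of Q"
proof -
  have Pc: "T closure_of P \<subseteq> carrier K" using closure_of_subset_topspace[of T P] topspace_eq by blast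
  have Qs: "z \<in> T closure_of Q" if "z \<in> Q" "z \<in> carrier K" for z
    using that closure_of_subset_Int[of T Q] by (auto simp: topspace_eq)
  have 1: "x \<otimes> inv q \<in> T closure_of Q" if q: "q \<in> P" for q
  proof -
    have "T closure_of P \<subseteq> {u \<in> carrier K. u \<otimes> inv q \<in> T closure_of Q}"
      using P q Q Qs by (intro closure_of_minimal closedin_translate) (auto simp: subset_iff)
    then show ?thesis using x by blast
  qed
  have "T closure_of P \<subseteq> {u \<in> carrier K. x \<otimes> inv u \<in> T closure_of Q}"
  proof (rule closure_of_minimal)
    show "P \<subseteq> {u \<in> carrier K. x \<otimes> inv u \<in> T closure_of Q}" using 1 P by blast
    show "closedin T {u \<in> carrier K. x \<otimes> inv u \<in> T closure_of Q}"
      using x Pc by (intro closedin_preimage continuous_map_mult continuous_map_const_carrier continuous_inv) auto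
  qed
  then show ?thesis using y by blast
qed

end

locale component_subgroup = component_locally_essential +
  fixes G :: "'a set"
  assumes G: "subgroup G K" and CG: "C \<subseteq> G"
begin

abbreviation KG :: "'a monoid" where "KG \<equiv> subgrp K G"
abbreviation TG :: "'a topology" where "TG \<equiv> subtopology T G"

lemma G_carrier: "G \<subseteq> carrier K"
  using G by (rule subgroup.subset)

lemma KG_simps [simp]: "carrier KG = G" "mult KG = mult K" "one KG = \<one>"
  by (simp_all add: subgrp_def)

lemma KG_comm_group: "comm_group KG"
proof -
  have "group KG" unfolding subgrp_def by (rule subgroup_imp_group[OF G])
  then show ?thesis by (rule group.group_comm_groupI) (use m_comm G_carrier in auto)
qed

lemma topspace_TG: "topspace TG = G"
  using G_carrier by (auto simp: topspace_eq)

lemma conn_comp_G: "conn_comp KG TG = C"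
proof
  have "connectedin T (conn_comp KG TG)"
    using connectedin_connected_component_of[of TG \<one>] by (simp add: conn_comp_def connectedin_subtopology)
  moreover have "\<one> \<in> conn_comp KG TG"
    using subgroup.one_closed[OF G] by (simp add: conn_comp_def connected_component_of_refl topspace_TG topspace_eq)
  ultimately show "conn_comp KG TG \<subseteq> C"
    unfolding conn_comp_def[of K T] by (intro connected_component_of_maximal) auto
  have "connectedin TG C"
    using CG by (simp add: connectedin_subtopology conn_comp_def connectedin_connected_component_of)
  then have "C \<subseteq> connected_component_of_set TG \<one>"
    using C_facts(4) by (intro connected_component_of_maximal) auto
  then show "C \<subseteq> conn_comp KG TG" by (simp add: conn_comp_def[of KG TG])
qed

lemma compactin_C: "compactin TG C"
  using CG compactin_closedin[OF closed_subgroupD(2)[OF C_facts(1)]] by (simp add: compactin_subtopology)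

text \<open>For a competing f from \<open>G\<close> to H, \<open>N\<close> below consists of the
  limits in \<open>K\<close> of elements whose images become small; it stands in for the kernel of
  an extension of f to \<open>K\<close>. It is a closed subgroup inside \<open>U\<close>, and it
  meets \<open>G\<close> trivially because H is Hausdorff, so local essentiality of \<open>C\<close>
  makes it trivial. By compactness small images then come from small elements, which is openness of
  f.\<close>

lemma locally_minimal_G: "locally_minimal KG TG"
proof -
  obtain U where U: "openin T U" "\<one> \<in> U"
    "\<And>N. closed_subgroup N \<Longrightarrow> N \<subseteq> U \<Longrightarrow> C \<inter> N = {\<one>} \<Longrightarrow> N = {\<one>}"
    using essential_nbhd by blast
  obtain V where V: "openin T V" "\<one> \<in> V" "T closure_of V \<subseteq> U" using nbhd_closure[OF U(1,2)] by blast
  have op: "open_map TG TH f"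
    if H: "top_group H TH" and f: "f \<in> iso KG H" and cont: "continuous_map TG TH f"
      and fV: "nbhd TH \<one>\<^bsub>H\<^esub> (f ` (V \<inter> G))" for H :: "'a monoid" and TH f
  proof -
    interpret H: abelian_topological_group H TH by (rule top_group_imp_abelian_topological_group[OF H])
    interpret KG: comm_group KG by (rule KG_comm_group)
    interpret f: group_hom KG H f
      using f by (simp add: group_hom_def group_hom_axioms_def KG.is_group H.is_group iso_def)
    have bij: "bij_betw f G (carrier H)" using f by (simp add: iso_def)
    have inj: "inj_on f G" using bij by (rule bij_betw_imp_inj_on)
    have fmult: "f (x \<otimes> y) = f x \<otimes>\<^bsub>H\<^esub> f y" if "x \<in> G" "y \<in> G" for x y
      using f.hom_mult that by simp
    have f1: "f \<one> = \<one>\<^bsub>H\<^esub>" using f.hom_one by simp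
    have finv: "f (inv y) = inv\<^bsub>H\<^esub> f y" if "y \<in> G" for y
    proof -
      have iy: "inv y \<in> G" using that subgroup.m_inv_closed[OF G] by blast
      have "f (inv y) \<otimes>\<^bsub>H\<^esub> f y = \<one>\<^bsub>H\<^esub>"
        using fmult[OF iy that] f1 that G_carrier by auto
      then show ?thesis using H.inv_equality[of "f (inv y)" "f y"] f.hom_closed iy that by simp
    qed
    have fc: "f x \<in> carrier H" if "x \<in> G" for x using f.hom_closed that by simp
    define P where "P A = {g \<in> G. f g \<in> A}" for A
    have PG: "P A \<subseteq> G" for A by (auto simp: P_def)
    have Pc: "P A \<subseteq> carrier K" for A using PG G_carrier by blast
    define \<A> where "\<A> = {A. openin TH A \<and> \<one>\<^bsub>H\<^esub> \<in> A}"
    have \<A>ne: "carrier H \<in> \<A>" using H.openin_carrier by (simp add: \<A>_def)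
    define N where "N = \<Inter>((\<lambda>A. T closure_of (P A)) ` \<A>)"
    have Nmem: "x \<in> N \<longleftrightarrow> (\<forall>A\<in>\<A>. x \<in> T closure_of (P A))" for x by (auto simp: N_def)
    have oneP: "\<one> \<in> T closure_of (P A)" if "A \<in> \<A>" for A
    proof -
      have "\<one> \<in> P A" using that subgroup.one_closed[OF G] f1 by (simp add: P_def \<A>_def)
      moreover have "P A \<subseteq> T closure_of (P A)" using Pc by (simp add: closure_of_subset topspace_eq)
      ultimately show ?thesis by blast
    qed
    have Ndiff: "x \<otimes> inv y \<in> N" if xy: "x \<in> N" "y \<in> N" for x y
      unfolding Nmem
    proof
      fix A assume "A \<in> \<A>"
      then obtain B where B: "openin TH B" "\<one>\<^bsub>H\<^esub> \<in> B" "\<And>u v. u \<in> B \<Longrightarrow> v \<in> B \<Longrightarrow> u \<otimes>\<^bsub>H\<^esub> inv\<^bsub>H\<^esub> v \<in> A"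
        using H.nbhd_quotient[of A] by (auto simp: \<A>_def)
      have "u \<otimes> inv v \<in> P A" if "u \<in> P B" "v \<in> P B" for u v
        using that B(3) subgroup.m_closed[OF G] subgroup.m_inv_closed[OF G] fmult finv by (simp add: P_def)
      moreover have "x \<in> T closure_of (P B)" "y \<in> T closure_of (P B)" using xy B(1,2) by (auto simp: Nmem \<A>_def)
      ultimately show "x \<otimes> inv y \<in> T closure_of (P A)" using closure_quotient[OF Pc] by blast
    qed
    have Nc: "N \<subseteq> carrier K"
      using \<A>ne closure_of_subset_topspace[of T "P (carrier H)"] by (auto simp: N_def topspace_eq)
    have N1: "\<one> \<in> N" using oneP by (simp add: Nmem)
    have "subgroup N K"
    proof (rule subgroupI)
      show i: "inv a \<in> N" if "a \<in> N" for a using Ndiff[OF N1 that] that Nc by auto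
      show "a \<otimes> b \<in> N" if "a \<in> N" "b \<in> N" for a b
        using Ndiff[OF that(1) i[OF that(2)]] that Nc by auto
    qed (use Nc N1 in auto)
    moreover have "closedin T N" unfolding N_def using \<A>ne by (intro closedin_Inter) auto
    ultimately have Ncs: "closed_subgroup N" by (simp add: closed_subgroup_def)
    have "N \<subseteq> U"
    proof -
      obtain A where A: "openin TH A" "\<one>\<^bsub>H\<^esub> \<in> A" "A \<subseteq> f ` (V \<inter> G)" using fV unfolding nbhd_def by blast
      have "P A \<subseteq> V"
      proof
        fix x assume x: "x \<in> P A"
        then obtain v where v: "v \<in> V" "v \<in> G" "f x = f v" using A(3) by (auto simp: P_def)
        then have "x = v" using inj x by (auto simp: P_def inj_on_def)
        then show "x \<in> V" using v(1) by simp
      qed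
      then have "T closure_of (P A) \<subseteq> U" using V(3) closure_of_mono[of "P A" V T] by blast
      moreover have "A \<in> \<A>" using A by (simp add: \<A>_def)
      ultimately show ?thesis by (auto simp: N_def)
    qed
    \<comment> \<open>Disjoint open sets separate \<open>f x\<close> from 0; by continuity f maps
      points of \<open>G\<close> near \<open>x\<close> into the first, so they cannot have small
      images.\<close>
    moreover have NG: "x = \<one>" if x: "x \<in> N" "x \<in> G" for x
    proof (rule ccontr)
      assume "x \<noteq> \<one>"
      then have "f x \<noteq> \<one>\<^bsub>H\<^esub>" using inj f1 x(2) subgroup.one_closed[OF G] by (metis inj_onD)
      moreover have "f x \<in> topspace TH" "\<one>\<^bsub>H\<^esub> \<in> topspace TH" using fc[OF x(2)] by (simp_all add: H.topspace_eq)
      ultimately obtain A D where AD: "openin TH A" "openin TH D" "\<one>\<^bsub>H\<^esub> \<in> A" "f x \<in> D" "disjnt A D"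
        using H.hausdorff unfolding Hausdorff_space_def by metis
      have "openin TG {g \<in> topspace TG. f g \<in> D}" by (rule openin_continuous_map_preimage[OF cont AD(2)])
      then obtain D' where D': "openin T D'" "{g \<in> topspace TG. f g \<in> D} = D' \<inter> G"
        by (auto simp: openin_subtopology)
      have xD': "x \<in> D'" using D'(2) x(2) AD(4) topspace_TG by auto
      have "x \<in> T closure_of (P A)" using x(1) AD(1,3) by (simp add: Nmem \<A>_def)
      then obtain g where g: "g \<in> P A" "g \<in> D'" using xD' D'(1) by (auto simp: in_closure_of)
      then have "g \<in> D' \<inter> G" using PG by blast
      then have "f g \<in> D" using D'(2) by blast
      moreover have "f g \<in> A" using g(1) by (simp add: P_def)
      ultimately show False using AD(5) by (auto simp: disjnt_def)
    qed
    then have "C \<inter> N = {\<one>}" using CG C_facts(4) N1 by blast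
    ultimately have Ntriv: "N = {\<one>}" using U(3) Ncs by blast
    have small: "\<exists>A\<in>\<A>. P A \<subseteq> W" if W: "openin T W" "\<one> \<in> W" for W
    proof (rule ccontr)
      assume no: "\<not> ?thesis"
      have "\<Inter> ((\<lambda>A. T closure_of (P A) - W) ` \<A>) \<noteq> {}"
      proof (rule compact[unfolded compact_space_fip, rule_format], intro conjI ballI allI impI)
        fix S assume "S \<in> (\<lambda>A. T closure_of (P A) - W) ` \<A>"
        then show "closedin T S" using W(1) by (auto intro: closedin_diff)
      next
        fix \<F> assume "finite \<F> \<and> \<F> \<subseteq> (\<lambda>A. T closure_of (P A) - W) ` \<A>"
        then obtain \<G> where \<G>: "finite \<G>" "\<G> \<subseteq> \<A>" "\<F> = (\<lambda>A. T closure_of (P A) - W) ` \<G>"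
          by (meson finite_subset_image)
        define B where "B = \<Inter>(insert (carrier H) \<G>)"
        have "openin TH B"
          unfolding B_def using \<G>(1,2) H.openin_carrier by (intro openin_Inter) (auto simp: \<A>_def)
        moreover have "\<one>\<^bsub>H\<^esub> \<in> B" using \<G>(2) by (auto simp: B_def \<A>_def)
        ultimately have "B \<in> \<A>" by (simp add: \<A>_def)
        then obtain x where x: "x \<in> P B" "x \<notin> W" using no by blast
        have "x \<in> T closure_of (P A) - W" if A: "A \<in> \<G>" for A
        proof -
          have "P B \<subseteq> P A" using A by (auto simp: P_def B_def)
          also have "P A \<subseteq> T closure_of (P A)" using Pc by (simp add: closure_of_subset topspace_eq)
          finally show ?thesis using x by blast
        qed
        then have "x \<in> \<Inter>\<F>" unfolding \<G>(3) by blast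
        then show "\<Inter>\<F> \<noteq> {}" by blast
      qed
      then obtain x where "x \<in> \<Inter> ((\<lambda>A. T closure_of (P A) - W) ` \<A>)" by (auto simp only: ex_in_conv[symmetric])
      then have x: "x \<in> T closure_of (P A) - W" if "A \<in> \<A>" for A using that by blast
      then have "x \<in> N" by (auto simp: Nmem)
      then show False using Ntriv W(2) x[OF \<A>ne] by blast
    qed
    show "open_map TG TH f"
      unfolding open_map_def
    proof (intro allI impI)
      fix S assume "openin TG S"
      then obtain S' where S': "openin T S'" "S = S' \<inter> G" by (auto simp: openin_subtopology)
      show "openin TH (f ` S)"
      proof (subst openin_subopen, intro ballI)
        fix y assume "y \<in> f ` S"
        then obtain s where s: "s \<in> S'" "s \<in> G" "y = f s" using S'(2) by blast
        have sc: "s \<in> carrier K" using s(2) G_carrier by blast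
        have yc: "y \<in> carrier H" using fc s by simp
        have "openin T {w \<in> carrier K. w \<otimes> s \<in> S'}" by (rule openin_translate[OF S'(1) sc])
        moreover have "\<one> \<in> {w \<in> carrier K. w \<otimes> s \<in> S'}" using s(1) sc by simp
        ultimately obtain A where A: "A \<in> \<A>" "P A \<subseteq> {w \<in> carrier K. w \<otimes> s \<in> S'}" using small by blast
        show "\<exists>W. openin TH W \<and> y \<in> W \<and> W \<subseteq> f ` S"
        proof (intro exI conjI)
          show "openin TH {z \<in> carrier H. z \<otimes>\<^bsub>H\<^esub> inv\<^bsub>H\<^esub> y \<in> A}"
            using A(1) yc by (intro H.openin_translate) (auto simp: \<A>_def)
          show "y \<in> {z \<in> carrier H. z \<otimes>\<^bsub>H\<^esub> inv\<^bsub>H\<^esub> y \<in> A}" using A(1) yc by (simp add: \<A>_def)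
          show "{z \<in> carrier H. z \<otimes>\<^bsub>H\<^esub> inv\<^bsub>H\<^esub> y \<in> A} \<subseteq> f ` S"
          proof
            fix z assume z: "z \<in> {z \<in> carrier H. z \<otimes>\<^bsub>H\<^esub> inv\<^bsub>H\<^esub> y \<in> A}"
            then have "z \<in> f ` G" using bij by (auto simp: bij_betw_def)
            then obtain g where g: "g \<in> G" "z = f g" by blast
            have gs: "g \<otimes> inv s \<in> G" using g(1) s(2) subgroup.m_closed[OF G] subgroup.m_inv_closed[OF G] by blast
            have "f (g \<otimes> inv s) = z \<otimes>\<^bsub>H\<^esub> inv\<^bsub>H\<^esub> y"
              using fmult[OF g(1) subgroup.m_inv_closed[OF G s(2)]] finv[OF s(2)] g(2) s(3) by simp
            then have "g \<otimes> inv s \<in> P A" using z gs by (simp add: P_def)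
            then have "(g \<otimes> inv s) \<otimes> s \<in> S'" using A(2) by blast
            then have "g \<in> S'" using g(1) G_carrier sc by (auto simp: m_assoc)
            then show "z \<in> f ` S" using g S'(2) by blast
          qed
        qed
      qed
    qed
  qed
  have "nbhd TG \<one> (V \<inter> G)"
  proof -
    have "V \<inter> G \<subseteq> topspace TG" unfolding topspace_TG by blast
    moreover have "openin TG (V \<inter> G)" using V(1) by (auto simp: openin_subtopology)
    moreover have "\<one> \<in> V \<inter> G" using V(2) subgroup.one_closed[OF G] by simp
    ultimately show ?thesis unfolding nbhd_def by blast
  qed
  then show ?thesis
    unfolding locally_minimal_def
  proof (intro exI[of _ "V \<inter> G"] conjI allI impI)
    fix H :: "'a monoid" and TH f
    assume "top_group H TH \<and> f \<in> iso KG H \<and> continuous_map TG TH f \<and> nbhd TH \<one>\<^bsub>H\<^esub> (f ` (V \<inter> G))"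
    then show "open_map TG TH f" by (elim conjE) (rule op)
  qed simp
qed

section \<open>The quotient G/C and a coarser topology on it\<close>

lemma coset_KG [simp]: "C #>\<^bsub>KG\<^esub> g = C #> g"
  by (simp add: r_coset_def)

lemma mem_coset: "g \<in> carrier K \<Longrightarrow> x \<in> C #> g \<longleftrightarrow> x \<in> carrier K \<and> x \<otimes> inv g \<in> C"
proof
  assume g: "g \<in> carrier K"
  show "x \<in> C #> g \<Longrightarrow> x \<in> carrier K \<and> x \<otimes> inv g \<in> C"
    using g C_facts(3) by (auto simp: r_coset_def m_assoc subset_iff)
  assume x: "x \<in> carrier K \<and> x \<otimes> inv g \<in> C"
  then have "x = (x \<otimes> inv g) \<otimes> g" using g by (simp add: m_assoc)
  then show "x \<in> C #> g" using x unfolding r_coset_def by blast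
qed

lemma coset_self: "g \<in> carrier K \<Longrightarrow> g \<in> C #> g"
  using mem_coset C_facts(4) by simp

lemma coset_eq_iff: "g \<in> carrier K \<Longrightarrow> h \<in> carrier K \<Longrightarrow> C #> g = C #> h \<longleftrightarrow> g \<otimes> inv h \<in> C"
  using mem_coset coset_self coset_join2 repr_independence[OF _ _ C_facts(2)] by metis

lemma rcosets_KG: "rcosets\<^bsub>KG\<^esub> C = (\<lambda>g. C #> g) ` G"
  by (auto simp: RCOSETS_def)

lemma subgroup_C_KG: "subgroup C KG"
  using C_facts(2) CG by (simp add: subgroup_def m_inv_consistent[OF G] subset_iff subgrp_def)

lemma coset_subset_G: "g \<in> G \<Longrightarrow> C #> g \<subseteq> G"
  using CG subgroup.m_closed[OF G] by (auto simp: r_coset_def)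

end

text \<open>\<open>NG\<close> makes the map from G/C to K/N injective. The topology pulled back
  along it is put on the cosets of \<open>C\<close> themselves, so that the identity can serve as
  the competing isomorphism in the definition of local minimality.\<close>

locale component_subgroup_quotient = component_subgroup +
  fixes N :: "'a set"
  assumes N: "closed_subgroup N" and CN: "C \<subseteq> N" and NG: "N \<inter> G \<subseteq> C"
begin

definition saturated :: "'a set \<Rightarrow> bool" where
  "saturated W \<longleftrightarrow> openin T W \<and> (\<forall>w\<in>W. \<forall>n\<in>N. w \<otimes> n \<in> W)"

definition cosets_in :: "'a set \<Rightarrow> 'a set set" where
  "cosets_in W = (\<lambda>g. C #> g) ` (G \<inter> W)"

text \<open>The topology induced on G/C by its injection into K/N.\<close>

definition coarse_top :: "'a set topology" where
  "coarse_top = topology (\<lambda>A. \<exists>W. saturated W \<and> A = cosets_in W)"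

text \<open>The N-saturation of the translate a + V, used as a basic neighbourhood of the class of
  \<open>a\<close>.\<close>

definition tube :: "'a \<Rightarrow> 'a set \<Rightarrow> 'a set" where
  "tube a V = {w \<in> carrier K. \<exists>n\<in>N. w \<otimes> inv (a \<otimes> n) \<in> V}"

lemma N_facts:
  shows "N \<subseteq> carrier K" "\<one> \<in> N" "\<And>m n. m \<in> N \<Longrightarrow> n \<in> N \<Longrightarrow> m \<otimes> n \<in> N" "\<And>n. n \<in> N \<Longrightarrow> inv n \<in> N"
    "\<And>n. n \<in> N \<Longrightarrow> n \<in> carrier K"
  using closed_subgroupD(3-6)[OF N] by blast+

lemma saturatedD:
  assumes "saturated W"
  shows "openin T W" "W \<subseteq> carrier K" "\<And>w n. w \<in> W \<Longrightarrow> n \<in> N \<Longrightarrow> w \<otimes> n \<in> W"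
  using assms openin_subset_carrier by (auto simp: saturated_def)

text \<open>Saturation under \<open>N\<close>, which contains \<open>C\<close>, makes membership in
  \<open>W\<close> independent of the representative of the coset.\<close>

lemma coset_in_iff:
  assumes W: "saturated W" and g: "g \<in> G"
  shows "C #> g \<in> cosets_in W \<longleftrightarrow> g \<in> W"
proof
  assume "C #> g \<in> cosets_in W"
  then obtain h where h: "h \<in> G" "h \<in> W" "C #> g = C #> h" by (auto simp: cosets_in_def)
  have car: "g \<in> carrier K" "h \<in> carrier K" using g h(1) G_carrier by auto
  have "g \<otimes> inv h \<in> N" using h(3) car coset_eq_iff CN by blast
  then have "h \<otimes> (g \<otimes> inv h) \<in> W" using saturatedD(3)[OF W h(2)] by blast
  moreover have "h \<otimes> (g \<otimes> inv h) = g"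
    using car by (simp add: m_comm[of g "inv h"] m_assoc[symmetric])
  ultimately show "g \<in> W" by simp
qed (use g in \<open>auto simp: cosets_in_def\<close>)

lemma cosets_in_subset: "A \<in> cosets_in W \<Longrightarrow> \<exists>g\<in>G. A = C #> g"
  by (auto simp: cosets_in_def)

lemma openin_coarse_top: "openin coarse_top A \<longleftrightarrow> (\<exists>W. saturated W \<and> A = cosets_in W)"
proof -
  have "istopology (\<lambda>A. \<exists>W. saturated W \<and> A = cosets_in W)"
    unfolding istopology_def
  proof (intro conjI allI impI)
    fix A B assume "\<exists>W. saturated W \<and> A = cosets_in W" "\<exists>W. saturated W \<and> B = cosets_in W"
    then obtain V W where VW: "saturated V" "A = cosets_in V" "saturated W" "B = cosets_in W" by blast
    have s: "saturated (V \<inter> W)" using VW(1,3) by (auto simp: saturated_def)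
    have "A \<inter> B = cosets_in (V \<inter> W)"
    proof (intro equalityI subsetI)
      fix x assume x: "x \<in> A \<inter> B"
      then obtain g where g: "g \<in> G" "x = C #> g" using VW cosets_in_subset by blast
      then have "g \<in> V" "g \<in> W" using x VW coset_in_iff by auto
      then show "x \<in> cosets_in (V \<inter> W)" using g by (auto simp: cosets_in_def)
    qed (use VW in \<open>auto simp: cosets_in_def\<close>)
    then show "\<exists>W. saturated W \<and> A \<inter> B = cosets_in W" using s by blast
  next
    fix \<K> assume \<K>: "\<forall>A\<in>\<K>. \<exists>W. saturated W \<and> A = cosets_in W"
    define W where "W = \<Union>{V. saturated V \<and> cosets_in V \<in> \<K>}"
    have "saturated W"
      unfolding saturated_def
    proof (intro conjI ballI)
      show "openin T W" unfolding W_def by (intro openin_Union) (auto simp: saturated_def)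
      fix w n assume "w \<in> W" "n \<in> N"
      then show "w \<otimes> n \<in> W" unfolding W_def by (auto simp: saturated_def)
    qed
    moreover have "\<Union>\<K> = cosets_in W"
    proof (intro equalityI subsetI)
      fix x assume "x \<in> \<Union>\<K>"
      then obtain A where "A \<in> \<K>" "x \<in> A" by blast
      moreover obtain V where "saturated V" "A = cosets_in V" using \<K>[rule_format, OF \<open>A \<in> \<K>\<close>] by blast
      ultimately have "saturated V" "cosets_in V \<in> \<K>" "x \<in> cosets_in V" by simp_all
      then show "x \<in> cosets_in W" unfolding cosets_in_def W_def by blast
    next
      fix x assume "x \<in> cosets_in W"
      then obtain g V where "g \<in> G" "x = C #> g" "g \<in> V" "saturated V" "cosets_in V \<in> \<K>"
        unfolding cosets_in_def W_def by blast
      then show "x \<in> \<Union>\<K>" unfolding cosets_in_def by blast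
    qed
    ultimately show "\<exists>W. saturated W \<and> \<Union>\<K> = cosets_in W" by blast
  qed
  then show ?thesis by (simp add: coarse_top_def)
qed

lemma saturated_carrier: "saturated (carrier K)"
  using openin_carrier N_facts(5) by (simp add: saturated_def)

lemma topspace_coarse_top: "topspace coarse_top = (\<lambda>g. C #> g) ` G"
proof
  show "topspace coarse_top \<subseteq> (\<lambda>g. C #> g) ` G"
    unfolding topspace_def openin_coarse_top cosets_in_def by blast
  have "openin coarse_top (cosets_in (carrier K))" using saturated_carrier openin_coarse_top by blast
  moreover have "cosets_in (carrier K) = (\<lambda>g. C #> g) ` G" using G_carrier by (auto simp: cosets_in_def)
  ultimately show "(\<lambda>g. C #> g) ` G \<subseteq> topspace coarse_top" using openin_subset by metis
qed

lemma saturated_tube: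
  assumes V: "openin T V" and a: "a \<in> carrier K"
  shows "saturated (tube a V)"
  unfolding saturated_def
proof (intro conjI ballI)
  have "tube a V = (\<Union>n\<in>N. {w \<in> carrier K. w \<otimes> inv (a \<otimes> n) \<in> V})" by (auto simp: tube_def)
  moreover have "openin T (\<Union>n\<in>N. {w \<in> carrier K. w \<otimes> inv (a \<otimes> n) \<in> V})"
    using a N_facts(5) by (intro openin_Union) (auto intro!: openin_translate V)
  ultimately show "openin T (tube a V)" by simp
  fix w m assume w: "w \<in> tube a V" and m: "m \<in> N"
  obtain n where n: "n \<in> N" "w \<otimes> inv (a \<otimes> n) \<in> V" using w by (auto simp: tube_def)
  have car: "w \<in> carrier K" "m \<in> carrier K" "n \<in> carrier K" using w m n N_facts(5) by (auto simp: tube_def)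
  have "(w \<otimes> m) \<otimes> inv ((a \<otimes> n) \<otimes> m) = w \<otimes> inv (a \<otimes> n)" using car a by (intro quotient_cancel) auto
  then have "(w \<otimes> m) \<otimes> inv (a \<otimes> (n \<otimes> m)) \<in> V" using n(2) car a by (simp add: m_assoc)
  then show "w \<otimes> m \<in> tube a V" using N_facts(3)[OF n(1) m] car unfolding tube_def by blast
qed

lemma mem_tube: "a \<in> carrier K \<Longrightarrow> \<one> \<in> V \<Longrightarrow> a \<in> tube a V"
  using N_facts(2) by (auto simp: tube_def intro!: bexI[of _ \<one>])

lemma Mod_mult: "g \<in> G \<Longrightarrow> h \<in> G \<Longrightarrow> (C #> g) \<otimes>\<^bsub>KG Mod C\<^esub> (C #> h) = C #> (g \<otimes> h)"
  using normal.rcos_sum[OF comm_group.subgroup_imp_normal[OF KG_comm_group subgroup_C_KG], of g h] by simp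

lemma Mod_comm_group: "comm_group (KG Mod C)"
  by (rule comm_group.abelian_FactGroup[OF KG_comm_group subgroup_C_KG])

lemma Mod_carrier: "carrier (KG Mod C) = (\<lambda>g. C #> g) ` G"
  by (simp add: FactGroup_def rcosets_KG)

lemma Mod_inv: "g \<in> G \<Longrightarrow> inv\<^bsub>KG Mod C\<^esub> (C #> g) = C #> inv g"
proof -
  assume g: "g \<in> G"
  interpret M: comm_group "KG Mod C" by (rule Mod_comm_group)
  have ig: "inv g \<in> G" using subgroup.m_inv_closed[OF G g] .
  have "(C #> inv g) \<otimes>\<^bsub>KG Mod C\<^esub> (C #> g) = \<one>\<^bsub>KG Mod C\<^esub>"
    unfolding Mod_mult[OF ig g] using g G_carrier C_facts(3) by auto
  then show ?thesis using g ig by (intro M.inv_equality) (auto simp: Mod_carrier)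
qed

lemma top_group_coarse: "top_group (KG Mod C) coarse_top"
  unfolding top_group_def
proof (intro conjI)
  show "comm_group (KG Mod C)" by (rule Mod_comm_group)
  show "topspace coarse_top = carrier (KG Mod C)" by (simp add: topspace_coarse_top Mod_carrier)
  show "Hausdorff_space coarse_top"
    unfolding Hausdorff_space_def
  proof (intro allI impI)
    fix x y assume xy: "x \<in> topspace coarse_top \<and> y \<in> topspace coarse_top \<and> x \<noteq> y"
    then obtain g h where gh: "g \<in> G" "x = C #> g" "h \<in> G" "y = C #> h" by (auto simp: topspace_coarse_top)
    have car: "g \<in> carrier K" "h \<in> carrier K" using gh G_carrier by auto
    \<comment> \<open>Classes that differ in G/C differ modulo \<open>N\<close>, so \<open>d\<close>
      is not in \<open>N\<close>. A common point of the two tubes would give u in \<open>U\<close>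
      with u + d = n - m in \<open>N\<close>, which \<open>U\<close> is chosen to exclude.\<close>
    define d where "d = g \<otimes> inv h"
    have dc: "d \<in> carrier K" using car by (simp add: d_def)
    have "d \<notin> C" using xy gh car coset_eq_iff by (auto simp: d_def)
    moreover have "d \<in> G" using gh subgroup.m_closed[OF G] subgroup.m_inv_closed[OF G] by (simp add: d_def)
    ultimately have dN: "d \<notin> N" using NG by blast
    define U where "U = {u \<in> carrier K. u \<otimes> d \<in> carrier K - N}"
    have U: "openin T U" unfolding U_def
      using closed_subgroupD(2)[OF N] openin_carrier by (intro openin_translate dc) blast
    have "\<one> \<in> U" using dc dN by (simp add: U_def)
    then obtain V where V: "openin T V" "\<one> \<in> V" "\<And>u v. u \<in> V \<Longrightarrow> v \<in> V \<Longrightarrow> u \<otimes> inv v \<in> U"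
      using nbhd_quotient[OF U] by blast
    have disj: False if w: "w \<in> tube g V" "w \<in> tube h V" for w
    proof -
      obtain m where m: "m \<in> N" "w \<otimes> inv (g \<otimes> m) \<in> V" using w(1) by (auto simp: tube_def)
      obtain n where n: "n \<in> N" "w \<otimes> inv (h \<otimes> n) \<in> V" using w(2) by (auto simp: tube_def)
      have c: "w \<in> carrier K" "m \<in> carrier K" "n \<in> carrier K" using w m n N_facts(5) by (auto simp: tube_def)
      have "(w \<otimes> inv (g \<otimes> m)) \<otimes> inv (w \<otimes> inv (h \<otimes> n)) \<in> U" using V(3) m(2) n(2) by blast
      moreover have "(w \<otimes> inv (g \<otimes> m)) \<otimes> inv (w \<otimes> inv (h \<otimes> n)) = inv (g \<otimes> m) \<otimes> (h \<otimes> n)"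
        using quotient_cancel[of "inv (g \<otimes> m)" "inv (h \<otimes> n)" w] c car by (simp add: m_comm[of w])
      ultimately have "(inv (g \<otimes> m) \<otimes> (h \<otimes> n)) \<otimes> d \<notin> N" by (simp add: U_def)
      moreover have "(inv (g \<otimes> m) \<otimes> (h \<otimes> n)) \<otimes> d = n \<otimes> inv m"
      proof -
        have "(h \<otimes> n) \<otimes> d = n \<otimes> g"
        proof -
          have "h \<otimes> d = g" unfolding d_def using car by (simp add: m_comm[of g "inv h"] m_assoc[symmetric])
          then show ?thesis using c car dc by (simp add: m_comm[of h n] m_assoc)
        qed
        note e = this
        have "(inv (g \<otimes> m) \<otimes> (h \<otimes> n)) \<otimes> d = (n \<otimes> g) \<otimes> inv (m \<otimes> g)"
        proof -
          have "(inv (g \<otimes> m) \<otimes> (h \<otimes> n)) \<otimes> d = inv (g \<otimes> m) \<otimes> ((h \<otimes> n) \<otimes> d)"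
            using c car dc by (intro m_assoc) auto
          also have "\<dots> = (n \<otimes> g) \<otimes> inv (g \<otimes> m)" unfolding e using c car by (intro m_comm) auto
          finally show ?thesis using c car by (simp add: m_comm[of g m])
        qed
        also have "\<dots> = n \<otimes> inv m" using c car by (intro quotient_cancel) auto
        finally show ?thesis .
      qed
      ultimately show False using N_facts(3)[OF n(1) N_facts(4)[OF m(1)]] by simp
    qed
    show "\<exists>A B. openin coarse_top A \<and> openin coarse_top B \<and> x \<in> A \<and> y \<in> B \<and> disjnt A B"
    proof (intro exI conjI)
      have s: "saturated (tube g V)" "saturated (tube h V)" using saturated_tube[OF V(1)] car by auto
      show "openin coarse_top (cosets_in (tube g V))" "openin coarse_top (cosets_in (tube h V))"
        using s openin_coarse_top by blast+
      show "x \<in> cosets_in (tube g V)" using gh car mem_tube V(2) by (auto simp: cosets_in_def)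
      show "y \<in> cosets_in (tube h V)" using gh car mem_tube V(2) by (auto simp: cosets_in_def)
      show "disjnt (cosets_in (tube g V)) (cosets_in (tube h V))"
        unfolding disjnt_iff
      proof (intro allI notI)
        fix z assume z: "z \<in> cosets_in (tube g V) \<and> z \<in> cosets_in (tube h V)"
        then obtain k where "k \<in> G" "z = C #> k" using cosets_in_subset by blast
        then show False using z s coset_in_iff disj by blast
      qed
    qed
  qed
  show "continuous_map (prod_topology coarse_top coarse_top) coarse_top (\<lambda>(x, y). x \<otimes>\<^bsub>KG Mod C\<^esub> y)"
    unfolding continuous_map_def
  proof (intro conjI allI impI)
    show "(\<lambda>(x, y). x \<otimes>\<^bsub>KG Mod C\<^esub> y) \<in> topspace (prod_topology coarse_top coarse_top) \<rightarrow> topspace coarse_top"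
      using subgroup.m_closed[OF G] by (auto simp: topspace_coarse_top Mod_mult simp del: mult_FactGroup)
    fix A assume "openin coarse_top A"
    then obtain W where W: "saturated W" "A = cosets_in W" using openin_coarse_top by blast
    show "openin (prod_topology coarse_top coarse_top)
       {z \<in> topspace (prod_topology coarse_top coarse_top). (case z of (x, y) \<Rightarrow> x \<otimes>\<^bsub>KG Mod C\<^esub> y) \<in> A}" (is "openin _ ?S")
      unfolding openin_prod_topology_alt
    proof (intro allI impI)
      fix x y assume "(x, y) \<in> ?S"
      then obtain g h where gh: "g \<in> G" "x = C #> g" "h \<in> G" "y = C #> h" "x \<otimes>\<^bsub>KG Mod C\<^esub> y \<in> A"
        by (auto simp: topspace_coarse_top simp del: mult_FactGroup)
      have car: "g \<in> carrier K" "h \<in> carrier K" using gh G_carrier by auto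
      have gh': "g \<otimes> h \<in> G" using gh subgroup.m_closed[OF G] by blast
      have "g \<otimes> h \<in> W" using gh(5) coset_in_iff[OF W(1) gh'] unfolding gh(2,4) Mod_mult[OF gh(1,3)] W(2) by simp
      then have one: "\<one> \<in> {u \<in> carrier K. u \<otimes> (g \<otimes> h) \<in> W}" using car by simp
      have "openin T {u \<in> carrier K. u \<otimes> (g \<otimes> h) \<in> W}"
        using car saturatedD(1)[OF W(1)] by (intro openin_translate) auto
      then obtain V where V: "openin T V" "\<one> \<in> V" "\<And>u v. u \<in> V \<Longrightarrow> v \<in> V \<Longrightarrow> u \<otimes> v \<in> {u \<in> carrier K. u \<otimes> (g \<otimes> h) \<in> W}"
        using nbhd_mult[OF _ one] by blast
      have s: "saturated (tube g V)" "saturated (tube h V)" using saturated_tube[OF V(1)] car by auto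
      have prod: "u \<otimes> v \<in> W" if uv: "u \<in> tube g V" "v \<in> tube h V" for u v
      proof -
        obtain m where m: "m \<in> N" "u \<otimes> inv (g \<otimes> m) \<in> V" using uv(1) by (auto simp: tube_def)
        obtain n where n: "n \<in> N" "v \<otimes> inv (h \<otimes> n) \<in> V" using uv(2) by (auto simp: tube_def)
        have c: "u \<in> carrier K" "v \<in> carrier K" "m \<in> carrier K" "n \<in> carrier K"
          using uv m n N_facts(5) by (auto simp: tube_def)
        define a where "a = u \<otimes> inv (g \<otimes> m)"
        define b where "b = v \<otimes> inv (h \<otimes> n)"
        have ab: "a \<in> carrier K" "b \<in> carrier K" using c car by (auto simp: a_def b_def)
        have "(a \<otimes> b) \<otimes> (g \<otimes> h) \<in> W" using V(3)[OF m(2) n(2)] by (simp add: a_def b_def)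
        then have "((a \<otimes> b) \<otimes> (g \<otimes> h)) \<otimes> (m \<otimes> n) \<in> W"
          using saturatedD(3)[OF W(1)] N_facts(3)[OF m(1) n(1)] by blast
        moreover have "((a \<otimes> b) \<otimes> (g \<otimes> h)) \<otimes> (m \<otimes> n) = (a \<otimes> (g \<otimes> m)) \<otimes> (b \<otimes> (h \<otimes> n))"
          using ab c car by (simp add: m_ac)
        moreover have "a \<otimes> (g \<otimes> m) = u" "b \<otimes> (h \<otimes> n) = v"
          unfolding a_def b_def using c car by (simp_all add: m_assoc)
        ultimately show ?thesis by simp
      qed
      show "\<exists>U V. openin coarse_top U \<and> openin coarse_top V \<and> x \<in> U \<and> y \<in> V \<and> U \<times> V \<subseteq> ?S"
      proof (intro exI conjI)
        show "openin coarse_top (cosets_in (tube g V))" "openin coarse_top (cosets_in (tube h V))"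
          using s openin_coarse_top by blast+
        show "x \<in> cosets_in (tube g V)" using gh car mem_tube V(2) by (auto simp: cosets_in_def)
        show "y \<in> cosets_in (tube h V)" using gh car mem_tube V(2) by (auto simp: cosets_in_def)
        show "cosets_in (tube g V) \<times> cosets_in (tube h V) \<subseteq> ?S"
        proof
          fix z assume "z \<in> cosets_in (tube g V) \<times> cosets_in (tube h V)"
          then obtain u v where uv: "u \<in> G" "u \<in> tube g V" "v \<in> G" "v \<in> tube h V" "z = (C #> u, C #> v)"
            by (auto simp: cosets_in_def)
          have "u \<otimes> v \<in> G \<inter> W" using prod uv subgroup.m_closed[OF G] by blast
          then have "(C #> u) \<otimes>\<^bsub>KG Mod C\<^esub> (C #> v) \<in> A"
            unfolding Mod_mult[OF uv(1,3)] W(2) cosets_in_def by blast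
          then show "z \<in> ?S" using uv by (simp add: topspace_coarse_top)
        qed
      qed
    qed
  qed
  show "continuous_map coarse_top coarse_top (\<lambda>x. inv\<^bsub>KG Mod C\<^esub> x)"
    unfolding continuous_map_def
  proof (intro conjI allI impI)
    show "(\<lambda>x. inv\<^bsub>KG Mod C\<^esub> x) \<in> topspace coarse_top \<rightarrow> topspace coarse_top"
      using subgroup.m_inv_closed[OF G] by (auto simp: topspace_coarse_top Mod_inv)
    fix A assume "openin coarse_top A"
    then obtain W where W: "saturated W" "A = cosets_in W" using openin_coarse_top by blast
    define W' where "W' = {w \<in> carrier K. inv w \<in> W}"
    have s: "saturated W'"
      unfolding saturated_def
    proof (intro conjI ballI)
      show "openin T W'" unfolding W'_def using saturatedD(1)[OF W(1)] by (intro openin_preimage continuous_inv)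
      fix w n assume w: "w \<in> W'" "n \<in> N"
      have "inv w \<otimes> inv n \<in> W" using w saturatedD(3)[OF W(1)] N_facts(4) by (auto simp: W'_def)
      then show "w \<otimes> n \<in> W'" using w N_facts(5) by (simp add: W'_def inv_mult)
    qed
    have "{x \<in> topspace coarse_top. inv\<^bsub>KG Mod C\<^esub> x \<in> A} = cosets_in W'"
    proof (intro equalityI subsetI)
      fix x assume x: "x \<in> {x \<in> topspace coarse_top. inv\<^bsub>KG Mod C\<^esub> x \<in> A}"
      then obtain g where g: "g \<in> G" "x = C #> g" by (auto simp: topspace_coarse_top)
      have "C #> inv g \<in> cosets_in W" using x W(2) Mod_inv[OF g(1)] g(2) by simp
      then have "inv g \<in> W" using coset_in_iff[OF W(1) subgroup.m_inv_closed[OF G g(1)]] by simp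
      then show "x \<in> cosets_in W'" using g G_carrier by (auto simp: cosets_in_def W'_def)
    next
      fix x assume "x \<in> cosets_in W'"
      then obtain g where g: "g \<in> G" "x = C #> g" "inv g \<in> W" by (auto simp: cosets_in_def W'_def)
      then show "x \<in> {x \<in> topspace coarse_top. inv\<^bsub>KG Mod C\<^esub> x \<in> A}"
        using W(2) subgroup.m_inv_closed[OF G g(1)] by (auto simp: topspace_coarse_top Mod_inv cosets_in_def)
    qed
    then show "openin coarse_top {x \<in> topspace coarse_top. inv\<^bsub>KG Mod C\<^esub> x \<in> A}"
      using s openin_coarse_top by metis
  qed
qed

end

section \<open>Subgroups of prime order in K/C and failure of local minimality\<close>

context component_locally_essential
begin

text \<open>The group C + <b> is a union of p translates of \<open>C\<close> because p b is in
  \<open>C\<close>; being a finite union it is closed.\<close>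

lemma prime_order_extension:
  fixes p :: nat
  assumes p: "Factorial_Ring.prime p" and b: "b \<in> carrier K" "b [^] p \<in> C"
  obtains N where "closed_subgroup N" "C \<subseteq> N" "b \<in> N" "\<And>x. x \<in> N \<Longrightarrow> x [^] p \<in> C"
    "\<And>H. subgroup H K \<Longrightarrow> C \<subseteq> H \<Longrightarrow> b \<in> H \<Longrightarrow> N \<subseteq> H"
proof -
  define N where "N = (\<Union>i<p. {b [^] i} <#> C)"
  have p0: "p > 0" using p by (simp add: prime_gt_0_nat)
  have NE: "\<exists>i c. c \<in> C \<and> x = b [^] (i::int) \<otimes> c" if "x \<in> N" for x
    using that unfolding N_def set_mult_def by (auto simp flip: int_pow_int)
  have NI: "b [^] (i::int) \<otimes> c \<in> N" if c: "c \<in> C" for i c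
  proof -
    have cc: "c \<in> carrier K" using c C_facts(3) by blast
    have "i = int (nat (i mod int p)) + int p * (i div int p)" using p0 by simp
    then have "b [^] i = b [^] (nat (i mod int p)) \<otimes> (b [^] p) [^] (i div int p)"
      using b(1) by (metis int_pow_int int_pow_mult int_pow_pow)
    then have "b [^] i \<otimes> c = b [^] (nat (i mod int p)) \<otimes> ((b [^] p) [^] (i div int p) \<otimes> c)"
      using b(1) cc by (simp add: m_assoc del: pow_nat)
    moreover have "(b [^] p) [^] (i div int p) \<otimes> c \<in> C"
      using closed_subgroupD(5,8)[OF C_facts(1)] b(2) c by blast
    moreover have "nat (i mod int p) < p" using p0 by (simp add: nat_less_iff)
    ultimately show ?thesis unfolding N_def by (auto simp: set_mult_def simp del: pow_nat)
  qed
  have Nc: "N \<subseteq> carrier K"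
  proof
    fix x assume "x \<in> N"
    then obtain i c where "c \<in> C" "x = b [^] (i::int) \<otimes> c" using NE by blast
    then show "x \<in> carrier K" using b(1) C_facts(3) by auto
  qed
  have bN: "b \<in> N" using NI[OF C_facts(4), of 1] b(1) by simp
  show thesis
  proof (rule that)
    have "subgroup N K"
    proof (rule subgroupI[OF Nc])
      show "N \<noteq> {}" using bN by blast
      show "inv a \<in> N" if a: "a \<in> N" for a
      proof -
        obtain i c where ic: "c \<in> C" "a = b [^] (i::int) \<otimes> c" using NE[OF a] by blast
        then have "inv a = b [^] (- i) \<otimes> inv c" using b(1) C_facts(3) by (auto simp: inv_mult int_pow_neg)
        then show ?thesis using NI closed_subgroupD(6)[OF C_facts(1) ic(1)] by simp
      qed
      show "a \<otimes> e \<in> N" if a: "a \<in> N" and e: "e \<in> N" for a e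
      proof -
        obtain i c where ic: "c \<in> C" "a = b [^] (i::int) \<otimes> c" using NE[OF a] by blast
        obtain j d where jd: "d \<in> C" "e = b [^] (j::int) \<otimes> d" using NE[OF e] by blast
        have "c \<in> carrier K" "d \<in> carrier K" using ic(1) jd(1) C_facts(3) by auto
        then have "a \<otimes> e = b [^] (i + j) \<otimes> (c \<otimes> d)"
          unfolding ic(2) jd(2) using b(1) by (simp add: int_pow_mult m_ac)
        then show ?thesis using NI closed_subgroupD(5)[OF C_facts(1) ic(1) jd(1)] by simp
      qed
    qed
    moreover have "closedin T N" unfolding N_def
      using b(1) closed_subgroupD(2)[OF C_facts(1)]
      by (intro closedin_Union) (auto intro!: closedin_set_mult closedin_singleton)
    ultimately show "closed_subgroup N" by (simp add: closed_subgroup_def)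
    show "C \<subseteq> N"
    proof
      fix c assume "c \<in> C"
      then show "c \<in> N" using NI[of c 0] C_facts(3) by auto
    qed
    show "b \<in> N" by (rule bN)
    show "x [^] p \<in> C" if x: "x \<in> N" for x
    proof -
      obtain i c where ic: "c \<in> C" "x = b [^] (i::int) \<otimes> c" using NE[OF x] by blast
      have cc: "c \<in> carrier K" using ic(1) C_facts(3) by blast
      have "x [^] p = (b [^] i) [^] p \<otimes> c [^] p" unfolding ic(2) using b(1) cc by (simp add: nat_pow_distrib)
      also have "(b [^] i) [^] p = (b [^] p) [^] i"
        using b(1) by (metis int_pow_int int_pow_pow mult.commute)
      finally show ?thesis using closed_subgroupD(5,7,8)[OF C_facts(1)] b(2) ic(1) by metis
    qed
    show "N \<subseteq> H" if H: "subgroup H K" "C \<subseteq> H" "b \<in> H" for H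
    proof
      fix x assume "x \<in> N"
      then obtain i c where "c \<in> C" "x = b [^] (i::int) \<otimes> c" using NE by blast
      then show "x \<in> H" using H(2) subgroup.m_closed[OF H(1)] subgroup_int_pow[OF H(1,3)] by blast
    qed
  qed
qed

end

context component_subgroup
begin

text \<open>Any neighbourhood of 0 in K/C contains some N/C of prime order. As G/C is torsion-free
  it embeds in K/N, and the induced topology still has the given \<open>V\<close> as a
  neighbourhood. It is strictly coarser: density of \<open>G\<close> provides points near b, which
  count as near 0 modulo \<open>N\<close> but not modulo \<open>C\<close>.\<close>

lemma quotient_not_locally_minimal:
  assumes inf: "\<not> finite_index C" and dense: "T closure_of G = carrier K"
    and tf: "\<And>x k::nat. x \<in> G \<Longrightarrow> k > 0 \<Longrightarrow> x [^] k \<in> C \<Longrightarrow> x \<in> C"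
  shows "\<not> locally_minimal (KG Mod C) (quot_top KG TG C)"
proof
  assume "locally_minimal (KG Mod C) (quot_top KG TG C)"
  then obtain V where V: "nbhd (quot_top KG TG C) C V"
    and min: "\<And>(H :: 'a set monoid) TH f. \<lbrakk>top_group H TH; f \<in> iso (KG Mod C) H;
      continuous_map (quot_top KG TG C) TH f; nbhd TH \<one>\<^bsub>H\<^esub> (f ` V)\<rbrakk> \<Longrightarrow> open_map (quot_top KG TG C) TH f"
    unfolding locally_minimal_def by auto
  have KGg: "group KG" using KG_comm_group by (rule comm_group.axioms(2))
  note opq = openin_quot_top[OF KGg subgroup_C_KG, of TG]
  obtain A where A: "openin (quot_top KG TG C) A" "C \<in> A" "A \<subseteq> V" using V unfolding nbhd_def by blast
  then obtain W0 where W0: "openin T W0" "\<Union>A = W0 \<inter> G" "A \<subseteq> rcosets\<^bsub>KG\<^esub> C"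
    by (auto simp: opq openin_subtopology)
  have "C \<subseteq> W0" using A(2) W0(2) by blast
  then obtain U where U: "open_subgroup U" "U \<subseteq> W0" using open_subgroup_inside[OF W0(1)] by blast
  have Us: "subgroup U K" using U(1) by (simp add: open_subgroup_def)
  obtain p :: nat and b where p: "Factorial_Ring.prime p" and b: "b \<in> U" "b \<notin> C" "b [^] p \<in> C"
    by (rule prime_torsion_in_open_subgroup[OF U(1) open_subgroup_neq_component[OF inf U(1)]]) (rule that)
  have bc: "b \<in> carrier K" using b(1) subgroup.mem_carrier[OF Us] by blast
  obtain N where N: "closed_subgroup N" "C \<subseteq> N" "b \<in> N" "\<And>x. x \<in> N \<Longrightarrow> x [^] p \<in> C"
    "\<And>H. subgroup H K \<Longrightarrow> C \<subseteq> H \<Longrightarrow> b \<in> H \<Longrightarrow> N \<subseteq> H"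
    using prime_order_extension[OF p bc b(3)] by blast
  have NU: "N \<subseteq> U" using N(5)[OF Us component_subset_open_subgroup[OF U(1)] b(1)] .
  have NG: "N \<inter> G \<subseteq> C" using N(4) tf prime_gt_0_nat[OF p] by blast
  interpret Q: component_subgroup_quotient K T G N
    by unfold_locales (use N NG in auto)
  \<comment> \<open>Its trace on G/C is open in the quotient topology, but cannot be open in the
    coarser one, since an N-saturated neighbourhood of 0 contains b.\<close>
  obtain O2 where O2: "open_subgroup O2" "b \<notin> O2" using separate_component[OF bc b(2)] by blast
  have O2s: "subgroup O2 K" using O2(1) by (simp add: open_subgroup_def)
  have quot: "openin (quot_top KG TG C) ((\<lambda>g. C #> g) ` (G \<inter> W))" and quotU: "\<Union>((\<lambda>g. C #> g) ` (G \<inter> W)) = G \<inter> W"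
    if W: "openin T W" "\<And>w c. w \<in> W \<Longrightarrow> c \<in> C \<Longrightarrow> w \<otimes> c \<in> W" for W
  proof -
    show *: "\<Union>((\<lambda>g. C #> g) ` (G \<inter> W)) = G \<inter> W"
    proof (intro equalityI subsetI)
      fix x assume "x \<in> \<Union>((\<lambda>g. C #> g) ` (G \<inter> W))"
      then obtain g where g: "g \<in> G" "g \<in> W" "x \<in> C #> g" by blast
      then obtain c where c: "c \<in> C" "x = c \<otimes> g" by (auto simp: r_coset_def)
      then have "x = g \<otimes> c" using g(1) G_carrier C_facts(3) m_comm by blast
      then show "x \<in> G \<inter> W" using W(2)[OF g(2) c(1)] coset_subset_G[OF g(1)] g(3) by blast
    next
      fix x assume "x \<in> G \<inter> W"
      then show "x \<in> \<Union>((\<lambda>g. C #> g) ` (G \<inter> W))" using coset_self G_carrier by blast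
    qed
    show "openin (quot_top KG TG C) ((\<lambda>g. C #> g) ` (G \<inter> W))"
      unfolding opq * using W(1) by (auto simp: rcosets_KG openin_subtopology)
  qed
  have cont: "continuous_map (quot_top KG TG C) Q.coarse_top (\<lambda>x. x)"
    unfolding continuous_map_def
  proof (intro conjI allI impI)
    have "topspace (quot_top KG TG C) \<subseteq> rcosets\<^bsub>KG\<^esub> C" unfolding topspace_def by (auto simp: opq)
    then show "(\<lambda>x. x) \<in> topspace (quot_top KG TG C) \<rightarrow> topspace Q.coarse_top"
      by (auto simp: Q.topspace_coarse_top rcosets_KG)
    fix B assume "openin Q.coarse_top B"
    then obtain W where W: "Q.saturated W" "B = Q.cosets_in W" using Q.openin_coarse_top by blast
    have "openin (quot_top KG TG C) B"
      unfolding W(2) Q.cosets_in_def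
      using Q.saturatedD(1,3)[OF W(1)] N(2) by (intro quot) auto
    then show "openin (quot_top KG TG C) {x \<in> topspace (quot_top KG TG C). x \<in> B}"
      using openin_subset by (metis Collect_conj_eq Collect_mem_eq inf.absorb2)
  qed
  \<comment> \<open>\<open>N\<close> was chosen inside the open subgroup \<open>U\<close>, so
    \<open>U\<close> remains a witness that \<open>V\<close> is a neighbourhood in the coarser
    topology.\<close>
  have satU: "Q.saturated U"
    unfolding Q.saturated_def using open_subgroupD(2)[OF U(1)] NU subgroup.m_closed[OF Us] by blast
  have nb: "nbhd Q.coarse_top C V"
    unfolding nbhd_def
  proof
    have "V \<subseteq> topspace (quot_top KG TG C)" using V by (simp add: nbhd_def)
    also have "\<dots> \<subseteq> rcosets\<^bsub>KG\<^esub> C" unfolding topspace_def by (auto simp: opq)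
    finally show "V \<subseteq> topspace Q.coarse_top" by (simp add: Q.topspace_coarse_top rcosets_KG)
    show "\<exists>U. openin Q.coarse_top U \<and> C \<in> U \<and> U \<subseteq> V"
    proof (intro exI conjI)
      show "openin Q.coarse_top (Q.cosets_in U)" using satU Q.openin_coarse_top by blast
      have "C #> \<one> \<in> Q.cosets_in U"
        using subgroup.one_closed[OF G] subgroup.one_closed[OF Us] unfolding Q.cosets_in_def by blast
      then show "C \<in> Q.cosets_in U" using C_facts(3) by simp
      show "Q.cosets_in U \<subseteq> V"
      proof
        fix x assume "x \<in> Q.cosets_in U"
        then obtain g where g: "g \<in> G" "g \<in> U" "x = C #> g" by (auto simp: Q.cosets_in_def)
        then have "g \<in> \<Union>A" using U(2) W0(2) by blast
        then obtain y where y: "y \<in> A" "g \<in> y" by blast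
        then obtain h where h: "h \<in> G" "y = C #> h" using W0(3) by (auto simp: rcosets_KG)
        have "g \<otimes> inv h \<in> C" using y(2) h mem_coset G_carrier by blast
        then have "x = y" using g h coset_eq_iff G_carrier by blast
        then show "x \<in> V" using y(1) A(3) by blast
      qed
    qed
  qed
  have iso: "(\<lambda>x. x) \<in> iso (KG Mod C) (KG Mod C)" using iso_set_refl[of "KG Mod C"] by simp
  have "nbhd Q.coarse_top \<one>\<^bsub>KG Mod C\<^esub> ((\<lambda>x. x) ` V)" using nb by simp
  with min[OF Q.top_group_coarse iso cont] have "open_map (quot_top KG TG C) Q.coarse_top (\<lambda>x. x)" by blast
  moreover have "openin (quot_top KG TG C) ((\<lambda>g. C #> g) ` (G \<inter> O2))"
    using open_subgroupD(2)[OF O2(1)] component_subset_open_subgroup[OF O2(1)] subgroup.m_closed[OF O2s]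
    by (intro quot) auto
  ultimately have "openin Q.coarse_top ((\<lambda>g. C #> g) ` (G \<inter> O2))"
    unfolding open_map_def by (metis image_ident)
  then obtain W where W: "Q.saturated W" "(\<lambda>g. C #> g) ` (G \<inter> O2) = Q.cosets_in W"
    using Q.openin_coarse_top by blast
  have GW: "G \<inter> O2 = G \<inter> W"
  proof -
    have "\<Union>((\<lambda>g. C #> g) ` (G \<inter> O2)) = G \<inter> O2"
      using open_subgroupD(2)[OF O2(1)] component_subset_open_subgroup[OF O2(1)] subgroup.m_closed[OF O2s]
      by (intro quotU) auto
    moreover have "\<Union>(Q.cosets_in W) = G \<inter> W"
      unfolding Q.cosets_in_def using Q.saturatedD(1,3)[OF W(1)] N(2) by (intro quotU) auto
    ultimately show ?thesis using W(2) by simp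
  qed
  \<comment> \<open>Saturation carries 0 to b inside \<open>W\<close>. Then W - O2 is an open set
    around b, so it meets the dense \<open>G\<close>, although \<open>W\<close> and
    \<open>O2\<close> have the same trace on \<open>G\<close>.\<close>
  have "\<one> \<in> W" using GW subgroup.one_closed[OF G] subgroup.one_closed[OF O2s] by blast
  then have "\<one> \<otimes> b \<in> W" using Q.saturatedD(3)[OF W(1)] N(3) by blast
  then have bW: "b \<in> W - O2" using bc O2(2) by simp
  have "openin T (W - O2)"
    using Q.saturatedD(1)[OF W(1)] closed_subgroupD(2)[OF open_subgroupD(1)[OF O2(1)]] by (rule openin_diff)
  moreover have "b \<in> T closure_of G" using bc dense by simp
  ultimately obtain g where "g \<in> G" "g \<in> W - O2" using bW unfolding in_closure_of by blast
  then show False using GW by blast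
qed

end

section \<open>The equivalence\<close>

text \<open>With n = p^v r and r prime to p, the coordinate v + i of n x = 0 shows that p^i divides
  x (v + i), whose residue modulo p^i is x i. The shift by v pays for the factor p^v.\<close>

lemma Zp_torsion_free:
  fixes p n :: nat
  assumes p: "Factorial_Ring.prime p" and n: "n > 0" and x: "x \<in> Zp_carrier p"
    and zero: "\<And>i. (int n * x i) mod int p ^ i = 0"
  shows "x = (\<lambda>_. 0)"
proof
  fix i
  have p1: "p > 1" using p by (rule prime_gt_1_nat)
  have bnd: "0 \<le> x j \<and> x j < int p ^ j" and rec: "x j = x (Suc j) mod int p ^ j" for j
    using x unfolding Zp_carrier_def by blast+
  have step: "x j = x (j + k) mod int p ^ j" for j k
  proof (induction k)
    case 0
    show ?case using bnd[of j] by simp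
  next
    case (Suc k)
    have "x (j + k) = x (Suc (j + k)) mod int p ^ (j + k)" by (rule rec)
    then have "x (j + k) mod int p ^ j = x (Suc (j + k)) mod int p ^ j"
      by (simp add: mod_mod_cancel le_imp_power_dvd)
    then show ?case using Suc by simp
  qed
  obtain v r where vr: "n = p ^ v * r" "\<not> p dvd r"
    using multiplicity_decompose'[of n p] n p by (metis not_prime_unit not_gr_zero)
  have "int p ^ (v + i) dvd int n * x (v + i)" using zero by (simp add: dvd_eq_mod_eq_0)
  then have "int p ^ v * int p ^ i dvd int p ^ v * (int r * x (v + i))"
    by (simp add: vr(1) power_add mult.assoc)
  then have "int p ^ i dvd int r * x (v + i)" using p1 by simp
  moreover have "coprime (int p ^ i) (int r)" using prime_imp_coprime[OF p vr(2)] by simp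
  ultimately have "int p ^ i dvd x (v + i)" by (simp add: coprime_dvd_mult_right_iff)
  then show "x i = 0" using step[of i v] by (simp add: add.commute dvd_eq_mod_eq_0)
qed

text \<open>In a finite group every element is torsion, while subgroups of the p-adic integers are
  torsion-free. A nontrivial p-monothetic subgroup is therefore of the cyclic kind and has at least
  p elements.\<close>

lemma pi_star_prime_le_order:
  assumes A: "group A" and fin: "finite (carrier A)" and p: "p \<in> pi_star A TA"
  shows "p \<le> card (carrier A)"
proof -
  interpret A: group A by (rule A)
  have pr: "Factorial_Ring.prime p" and td: "td p A TA \<noteq> {\<one>\<^bsub>A\<^esub>}" using p by (simp_all add: pi_star_def)
  \<comment> \<open>This puts 0 into \<open>td\<close>, so that \<open>td\<close> being different
    from {0} yields a nonzero element.\<close>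
  have "p_monothetic_sub p A TA {\<one>\<^bsub>A\<^esub>}"
    unfolding p_monothetic_sub_def
    by (intro conjI A.triv_subgroup disjI1 bexI[of _ "\<one>\<^bsub>A\<^esub>"] exI[of _ 0])
       (auto simp: A.generate_one)
  then have "\<one>\<^bsub>A\<^esub> \<in> td p A TA" by (auto simp: td_def)
  with td obtain x where "x \<in> td p A TA" "x \<noteq> \<one>\<^bsub>A\<^esub>" by blast
  then obtain S where S: "p_monothetic_sub p A TA S" "x \<in> S" by (auto simp: td_def)
  have Ss: "subgroup S A" using S(1) by (simp add: p_monothetic_sub_def)
  have Sc: "S \<subseteq> carrier A" using Ss by (rule subgroup.subset)
  have xc: "x \<in> carrier A" using S(2) Sc by blast
  consider (fin) k where "card S = p ^ k"
    | (Zp) Z f where "subgroup Z (Zp p)" "f \<in> iso (subgrp A S) (subgrp (Zp p) Z)"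
    using S(1) unfolding p_monothetic_sub_def by blast
  then show ?thesis
  proof cases
    case fin
    have "card S \<noteq> 1"
    proof
      assume "card S = 1"
      then obtain y where "S = {y}" by (auto simp: card_1_singleton_iff)
      then show False using S(2) subgroup.one_closed[OF Ss] \<open>x \<noteq> \<one>\<^bsub>A\<^esub>\<close> by auto
    qed
    then have "k \<noteq> 0" using fin by auto
    then have "p \<le> p ^ k" using prime_gt_0_nat[OF pr] by (intro self_le_power) auto
    also have "\<dots> \<le> card (carrier A)" using fin Sc \<open>finite (carrier A)\<close> by (metis card_mono)
    finally show ?thesis .
  next
    case Zp
    define n where "n = A.ord x"
    have n: "n > 0" "x [^]\<^bsub>A\<^esub> n = \<one>\<^bsub>A\<^esub>"
      using A.ord_ge_1[OF \<open>finite (carrier A)\<close> xc] A.pow_ord_eq_1[OF xc] by (simp_all add: n_def)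
    have Zc: "Z \<subseteq> Zp_carrier p" using subgroup.subset[OF Zp(1)] by (simp add: Zp_def)
    have fZ: "f y \<in> Z" if "y \<in> S" for y
      using Zp(2) that by (auto simp: iso_def hom_def subgrp_def)
    have inj: "inj_on f S" using Zp(2) by (auto simp: iso_def bij_betw_def subgrp_def)
    have fm: "f (y \<otimes>\<^bsub>A\<^esub> z) = (\<lambda>i. (f y i + f z i) mod int p ^ i)" if "y \<in> S" "z \<in> S" for y z
      using Zp(2) that by (auto simp: iso_def hom_def subgrp_def Zp_def)
    have rng: "0 \<le> f y i \<and> f y i < int p ^ i" if "y \<in> S" for y i
      using fZ[OF that] Zc by (auto simp: Zp_carrier_def)
    have f1: "f \<one>\<^bsub>A\<^esub> = (\<lambda>_. 0)"
    proof
      fix i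
      have o: "\<one>\<^bsub>A\<^esub> \<in> S" by (rule subgroup.one_closed[OF Ss])
      have "f \<one>\<^bsub>A\<^esub> i = (f \<one>\<^bsub>A\<^esub> i + f \<one>\<^bsub>A\<^esub> i) mod int p ^ i" using fm[OF o o] by (simp add: fun_eq_iff)
      then have "f \<one>\<^bsub>A\<^esub> i mod int p ^ i = (f \<one>\<^bsub>A\<^esub> i + f \<one>\<^bsub>A\<^esub> i) mod int p ^ i" using rng[OF o] by simp
      then have "int p ^ i dvd f \<one>\<^bsub>A\<^esub> i" by (simp add: mod_eq_dvd_iff)
      then show "f \<one>\<^bsub>A\<^esub> i = 0" using rng[OF o, of i] by (metis dvd_eq_mod_eq_0 mod_pos_pos_trivial)
    qed
    have pow: "x [^]\<^bsub>A\<^esub> k \<in> S \<and> f (x [^]\<^bsub>A\<^esub> k) = (\<lambda>i. (int k * f x i) mod int p ^ i)" for k :: nat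
    proof (induction k)
      case 0
      then show ?case using subgroup.one_closed[OF Ss] f1 by simp
    next
      case (Suc k)
      then have "f (x [^]\<^bsub>A\<^esub> Suc k) = (\<lambda>i. ((int k * f x i) mod int p ^ i + f x i) mod int p ^ i)"
        using fm[of "x [^]\<^bsub>A\<^esub> k" x] S(2) by simp
      also have "\<dots> = (\<lambda>i. (int (Suc k) * f x i) mod int p ^ i)"
        by (simp add: mod_simps algebra_simps)
      finally show ?case using Suc S(2) subgroup.m_closed[OF Ss] by simp
    qed
    have "f x = (\<lambda>_. 0)"
    proof (rule Zp_torsion_free[OF pr n(1)])
      show "f x \<in> Zp_carrier p" using fZ[OF S(2)] Zc by blast
      show "(int n * f x i) mod int p ^ i = 0" for i
        using pow[of n] f1 n(2) by (metis (no_types, lifting))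
    qed
    then have "x = \<one>\<^bsub>A\<^esub>" using inj S(2) subgroup.one_closed[OF Ss] f1 by (metis inj_onD)
    then show ?thesis using \<open>x \<noteq> \<one>\<^bsub>A\<^esub>\<close> by blast
  qed
qed

lemma finite_pi_star: "group A \<Longrightarrow> finite (carrier A) \<Longrightarrow> finite (pi_star A TA)"
  using pi_star_prime_le_order by (meson finite_atMost finite_subset atMost_iff subsetI)

lemma prime_order_in_pi_star:
  assumes A: "group A" and p: "Factorial_Ring.prime p" and x: "x \<in> carrier A" "x \<noteq> \<one>\<^bsub>A\<^esub>" "x [^]\<^bsub>A\<^esub> p = \<one>\<^bsub>A\<^esub>"
  shows "p \<in> pi_star A TA"
proof -
  interpret A: group A by (rule A)
  have "A.ord x dvd p" using A.pow_eq_id[OF x(1)] x(3) by blast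
  moreover have "A.ord x \<noteq> 1" using A.ord_eq_1[OF x(1)] x(2) by blast
  ultimately have ord: "A.ord x = p" using p by (auto simp: prime_nat_iff)
  let ?S = "generate A {x}"
  have card: "card ?S = p" using A.generate_pow_card[OF x(1)] ord by simp
  then have "finite ?S" using prime_gt_0_nat[OF p] card_ge_0_finite by metis
  moreover have "x \<in> ?S" by (simp add: generate.incl)
  moreover have "subgroup ?S A" using x(1) by (intro A.generate_is_subgroup) simp
  ultimately have "p_monothetic_sub p A TA ?S"
    unfolding p_monothetic_sub_def using card by (intro conjI disjI1 bexI[of _ x] exI[of _ 1]) simp_all
  then have "x \<in> td p A TA" using \<open>x \<in> ?S\<close> by (auto simp: td_def)
  then show ?thesis using p x(2) by (auto simp: pi_star_def)
qed

text \<open>With V = {0} the image {0} is a neighbourhood of 0 in the target. The target is then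
  discrete, and every map into it is open.\<close>

lemma discrete_locally_minimal:
  fixes A :: "'b monoid"
  assumes A: "group A" and top: "openin TA {\<one>\<^bsub>A\<^esub>}"
  shows "locally_minimal A TA"
  unfolding locally_minimal_def
proof (intro exI[of _ "{\<one>\<^bsub>A\<^esub>}"] conjI allI impI)
  show "nbhd TA \<one>\<^bsub>A\<^esub> {\<one>\<^bsub>A\<^esub>}" unfolding nbhd_def using top openin_subset by blast
  fix H :: "'b monoid" and TH f
  assume *: "top_group H TH \<and> f \<in> iso A H \<and> continuous_map TA TH f \<and> nbhd TH \<one>\<^bsub>H\<^esub> (f ` {\<one>\<^bsub>A\<^esub>})"
  then interpret H: abelian_topological_group H TH by (intro top_group_imp_abelian_topological_group) simp
  interpret A: group A by (rule A)
  have "f \<in> hom A H" using * by (simp add: iso_def)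
  then have "f \<one>\<^bsub>A\<^esub> = \<one>\<^bsub>H\<^esub>" using hom_one A.is_group H.is_group by blast
  then have "nbhd TH \<one>\<^bsub>H\<^esub> {\<one>\<^bsub>H\<^esub>}" using * by simp
  then obtain W where W: "openin TH W" "\<one>\<^bsub>H\<^esub> \<in> W" "W \<subseteq> {\<one>\<^bsub>H\<^esub>}" unfolding nbhd_def by blast
  have sing: "openin TH {y}" if y: "y \<in> carrier H" for y
  proof -
    have "openin TH {z \<in> carrier H. z \<otimes>\<^bsub>H\<^esub> inv\<^bsub>H\<^esub> y \<in> W}" using W(1) y by (intro H.openin_translate) auto
    moreover have "{z \<in> carrier H. z \<otimes>\<^bsub>H\<^esub> inv\<^bsub>H\<^esub> y \<in> W} = {y}"
    proof (intro equalityI subsetI)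
      fix z assume z: "z \<in> {z \<in> carrier H. z \<otimes>\<^bsub>H\<^esub> inv\<^bsub>H\<^esub> y \<in> W}"
      then have "z \<otimes>\<^bsub>H\<^esub> inv\<^bsub>H\<^esub> y = \<one>\<^bsub>H\<^esub>" using W(3) by blast
      then have "z = \<one>\<^bsub>H\<^esub> \<otimes>\<^bsub>H\<^esub> y" using z y H.inv_solve_right'[of "\<one>\<^bsub>H\<^esub>" z y] by simp
      then show "z \<in> {y}" using y by simp
    qed (use y W(2) in auto)
    ultimately show ?thesis by simp
  qed
  show "open_map TA TH f"
    unfolding open_map_def
  proof (intro allI impI)
    fix S assume "openin TA S"
    then have "f ` S \<subseteq> carrier H"
      using * openin_subset[of TA S] by (auto simp: continuous_map_def H.topspace_eq Pi_iff)
    then have "openin TH (\<Union>y\<in>f ` S. {y})" using sing by (intro openin_Union) auto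
    then show "openin TH (f ` S)" by simp
  qed
qed

context component_locally_essential
begin

lemma quotient_group: "comm_group (K Mod C)"
  by (rule abelian_FactGroup[OF C_facts(2)])

lemma finite_index_C_iff: "finite_index C \<longleftrightarrow> finite (carrier (K Mod C))"
proof -
  have car: "carrier (K Mod C) = (\<lambda>g. C #> g) ` carrier K" by (rule carrier_FactGroup)
  have mem: "x \<otimes> inv g \<in> C" if "g \<in> carrier K" "C #> x = C #> g" "x \<in> carrier K" for x g
  proof -
    have "x \<in> C #> x" using that C_facts(2) by (intro rcos_self)
    then have "x \<in> C #> g" using that(2) by simp
    then show ?thesis using subgroup.rcos_module_imp[OF C_facts(2) is_group that(1)] by simp
  qed
  show ?thesis
  proof
    assume "finite_index C"
    then obtain F where F: "finite F" "F \<subseteq> carrier K" "\<And>x. x \<in> carrier K \<Longrightarrow> \<exists>f\<in>F. x \<otimes> inv f \<in> C"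
      unfolding finite_index_def by blast
    have "carrier (K Mod C) \<subseteq> (\<lambda>g. C #> g) ` F"
    proof
      fix y assume "y \<in> carrier (K Mod C)"
      then obtain x where x: "x \<in> carrier K" "y = C #> x" by (auto simp: car)
      obtain f where f: "f \<in> F" "x \<otimes> inv f \<in> C" using F(3)[OF x(1)] by blast
      have "f \<in> carrier K" using f(1) F(2) by blast
      then have "x \<in> C #> f" using subgroup.rcos_module_rev[OF C_facts(2) is_group] x(1) f(2) by blast
      then have "C #> f = C #> x" using \<open>f \<in> carrier K\<close> C_facts(2) by (intro repr_independence)
      then show "y \<in> (\<lambda>g. C #> g) ` F" using f(1) x(2) by auto
    qed
    then show "finite (carrier (K Mod C))" using F(1) finite_surj by blast
  next
    assume "finite (carrier (K Mod C))"
    then obtain F where F: "finite F" "F \<subseteq> carrier K" "carrier (K Mod C) = (\<lambda>g. C #> g) ` F"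
      unfolding car by (metis finite_subset_image subset_refl)
    show "finite_index C"
      unfolding finite_index_def
    proof (intro exI[of _ F] conjI ballI F(1,2))
      fix x assume x: "x \<in> carrier K"
      then have "C #> x \<in> (\<lambda>g. C #> g) ` F" using F(3) car by blast
      then obtain f where "f \<in> F" "C #> x = C #> f" by blast
      then show "\<exists>f\<in>F. x \<otimes> inv f \<in> C" using mem[of f x] x F(2) by blast
    qed
  qed
qed

text \<open>One open subgroup can exclude torsion for finitely many primes at once, whereas every
  open subgroup different from \<open>C\<close> contains an element of prime order modulo
  \<open>C\<close>.\<close>

lemma infinite_pi_star:
  assumes inf: "\<not> finite_index C"
  shows "infinite (pi_star (K Mod C) TA)"
proof
  assume fin: "finite (pi_star (K Mod C) TA)"
  interpret M: comm_group "K Mod C" by (rule quotient_group)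
  interpret N: normal C K by (rule subgroup_imp_normal[OF C_facts(2)])
  have "Factorial_Ring.prime p" if "p \<in> pi_star (K Mod C) TA" for p using that by (simp add: pi_star_def)
  then obtain H where H: "open_subgroup H"
    "\<And>p x. p \<in> pi_star (K Mod C) TA \<Longrightarrow> x \<in> H \<Longrightarrow> x [^] p \<in> C \<Longrightarrow> x \<in> C"
    using open_subgroup_without_torsion[OF fin] by blast
  obtain p :: nat and b where p: "Factorial_Ring.prime p" and b: "b \<in> H" "b \<notin> C" "b [^] p \<in> C"
    by (rule prime_torsion_in_open_subgroup[OF H(1) open_subgroup_neq_component[OF inf H(1)]]) (rule that)
  have bc: "b \<in> carrier K" using b(1) closed_subgroupD(3)[OF open_subgroupD(1)[OF H(1)]] by blast
  have "p \<in> pi_star (K Mod C) TA"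
  proof (rule prime_order_in_pi_star[OF M.is_group p])
    show "C #> b \<in> carrier (K Mod C)" using bc by (simp add: carrier_FactGroup)
    show "C #> b \<noteq> \<one>\<^bsub>K Mod C\<^esub>"
      using rcos_self[OF bc C_facts(2)] b(2) by auto
    have "(C #> b) [^]\<^bsub>K Mod C\<^esub> p = C #> (b [^] p)" using N.FactGroup_pow[OF bc] by simp
    also have "\<dots> = C" using b(3) bc C_facts(2) by (simp add: coset_join2)
    finally show "(C #> b) [^]\<^bsub>K Mod C\<^esub> p = \<one>\<^bsub>K Mod C\<^esub>" by simp
  qed
  then show False using H(2) b by blast
qed

lemma in_C_Clm_if_infinite:
  assumes inf: "\<not> finite_index C" and top: "top_group K T"
  shows "in_C_Clm K T"
proof -
  obtain G where G: "subgroup G K" "C \<subseteq> G" "T closure_of G = carrier K"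
    "\<And>x k::nat. x \<in> G \<Longrightarrow> k > 0 \<Longrightarrow> x [^] k \<in> C \<Longrightarrow> x \<in> C"
    using dense_torsion_free_subgroup[OF inf] by blast
  interpret S: component_subgroup K T G
    by (intro component_subgroup.intro component_locally_essential_axioms component_subgroup_axioms.intro G)
  have "\<not> locally_minimal (S.KG Mod C) (quot_top S.KG S.TG C)"
    by (rule S.quotient_not_locally_minimal[OF inf G(3,4)])
  then have "critical_in K T G"
    unfolding critical_in_def Let_def S.conn_comp_G
    using S.locally_minimal_G S.compactin_C by blast
  then show ?thesis unfolding in_C_Clm_def using top compact G by blast
qed

text \<open>A component of finite index is open. Criticality places it inside G, and a dense
  subgroup that contains an open subgroup is everything, so G/C = K/C is discrete and hence locally
  minimal.\<close>

lemma not_in_C_Clm_if_finite: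
  assumes fin: "finite_index C"
  shows "\<not> in_C_Clm K T"
proof
  assume "in_C_Clm K T"
  then obtain G where G: "subgroup G K" "T closure_of G = carrier K" "critical_in K T G"
    unfolding in_C_Clm_def by blast
  have cG: "conn_comp (subgrp K G) (subtopology T G) = C"
    and nlm: "\<not> locally_minimal (subgrp K G Mod C) (quot_top (subgrp K G) (subtopology T G) C)"
    using G(3) unfolding critical_in_def Let_def by auto
  have "conn_comp (subgrp K G) (subtopology T G) \<subseteq> topspace (subtopology T G)"
    unfolding conn_comp_def by (rule connected_component_of_subset_topspace)
  then have CG: "C \<subseteq> G" unfolding cG by simp
  have oC: "open_subgroup C" by (rule open_subgroup_finite_index[OF C_facts(1) fin])
  have Gc: "G \<subseteq> carrier K" by (rule subgroup.subset[OF G(1)])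
  have "carrier K \<subseteq> G"
  proof
    fix x assume x: "x \<in> carrier K"
    define B where "B = {u \<in> carrier K. u \<otimes> inv x \<in> C}"
    have "openin T B" unfolding B_def using open_subgroupD(2)[OF oC] x by (intro openin_translate) auto
    moreover have "x \<in> B" using x C_facts(4) by (simp add: B_def)
    moreover have "x \<in> T closure_of G" using x G(2) by simp
    ultimately have "\<exists>g. g \<in> G \<and> g \<in> B" by (simp add: in_closure_of)
    then obtain g where g: "g \<in> G" "g \<otimes> inv x \<in> C" by (auto simp: B_def)
    have gc: "g \<in> carrier K" using g(1) Gc by blast
    have "x \<otimes> inv g \<in> G" by (rule subsetD[OF CG quotient_sym[OF C_facts(2) gc x g(2)]])
    then have "(x \<otimes> inv g) \<otimes> g \<in> G" using g(1) subgroup.m_closed[OF G(1)] by blast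
    then show "x \<in> G" using x gc by (simp add: m_assoc)
  qed
  then have Geq: "G = carrier K" using Gc by blast
  have "subgrp K G = K" by (simp add: subgrp_def Geq)
  moreover have "subtopology T G = T" unfolding Geq topspace_eq[symmetric] by simp
  ultimately have "\<not> locally_minimal (K Mod C) (quot_top K T C)" using nlm by simp
  moreover have "locally_minimal (K Mod C) (quot_top K T C)"
  proof (rule discrete_locally_minimal)
    show "group (K Mod C)" using quotient_group by (rule comm_group.axioms(2))
    have "C \<in> rcosets C" using subgroup.subgroup_in_rcosets[OF C_facts(2) is_group] .
    then show "openin (quot_top K T C) {\<one>\<^bsub>K Mod C\<^esub>}"
      using open_subgroupD(2)[OF oC] by (simp add: openin_quot_top[OF is_group C_facts(2)])
  qed
  ultimately show False by blast
qed

end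

theorem theorem5p8:
  fixes K :: "'a monoid" and T :: "'a topology"
  assumes "top_group K T" and "compact_space T"
    and "locally_essential K T (conn_comp K T)"
  shows "(in_C_Clm K T \<longleftrightarrow>
            infinite (pi_star (K Mod conn_comp K T) (quot_top K T (conn_comp K T))))
       \<and> (infinite (pi_star (K Mod conn_comp K T) (quot_top K T (conn_comp K T)))
            \<longleftrightarrow> infinite (carrier (K Mod conn_comp K T)))"
proof -
  interpret component_locally_essential K T
    using top_group_imp_compact_abelian_group[OF assms(1,2)] assms(3)
    by (simp add: component_locally_essential_def component_locally_essential_axioms_def)
  have "group (K Mod C)" using quotient_group by (rule comm_group.axioms(2))
  \<comment> \<open>Each condition is compared with \<open>finite_index C\<close>; finiteness of
    \<open>pi_star\<close> for a finite quotient supplies the step from (b) to (c).\<close>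
  then show ?thesis
    using finite_index_C_iff infinite_pi_star in_C_Clm_if_infinite[OF _ assms(1)]
      not_in_C_Clm_if_finite finite_pi_star by blast
qed

end
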